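(* The symplectic Lorentz map $\Psi_\hbar:TQ\rightarrow TQ:(q,v)\mapsto(\overline{q},\overline{v})$, defined by the implicit relations $$\vartheta_{\overline{q}}+\hbar^2\,g_{\overline{q}}(\overline{v},d\overline{q})=\partial_{\overline{q}}S(q,\overline{q}),\qquad \vartheta_q+\hbar^2\,g_q(v,dq)=-\partial_qS(q,\overline{q}),$$ is well-defined and smooth in $(q,v,\hbar)$ for $\hbar$ in a neighborhood of $0\in\mathbb{R}$. Moreover, it preserves the $\hbar$-dependent symplectic form $\Omega^*_\hbar$ (that is, $\Psi_\hbar^*\Omega^*_\hbar=\Omega^*_\hbar$) and satisfies $$\Psi_0(q,v)=\bigl(q,\;X_H(q)+\exp(-\theta_0\,\mathbb{J}(q))[v-X_H(q)]\bigr).$$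
   Context: $Q\subset E$ is a connected open subset of a finite-dimensional real vector space $E$, with tangent bundle projection $\pi:TQ\rightarrow Q$; points of $TQ$ are written $(q,v)$. $Q$ carries an exact symplectic form $\omega=-\mathbf{d}\vartheta$, a Hamiltonian $H:Q\rightarrow\mathbb{R}$, and an almost complex structure $\mathbb{J}:TQ\rightarrow TQ$ compatible with $\omega$, so that $g(v,w)=\omega(v,\mathbb{J}w)$ defines a metric tensor on $Q$; $\langle\cdot,\cdot\rangle$ is shorthand for $g(\cdot,\cdot)$. $X_H=-\mathbb{J}\nabla H$ is the Hamiltonian vector field of $H$ ($\iota_{X_H}\omega=\mathbf{d}H$), with $\nabla$ the $g$-gradient. For a real parameter $\hbar$, $TQ$ is equipped with the form $\Omega^*_\hbar=\pi^*\omega+\hbar^2\,\Omega$, where $\Omega$ is the pullback of the canonical symplectic form on $T^*Q$ along the bundle map $TQ\rightarrow T^*Q$ defined by $g$. Smooth means $C^\infty$. Let $\theta_0\notin\{0,\pi\}$ be a fixed angle. In linear coordinates on $E$ let $\omega_{j\ell}$ be the components of $\omega$ (repeated indices are summed). Define $\Sigma:TQ\rightarrow\mathbb{R}$ by $$\Sigma(x,\xi)=-\hbar H(x)+\hbar^2\langle X_H(x),\xi\rangle-\tfrac{1}{12}\hbar^2\,\partial_k\omega_{j\ell}(x)\,X_H^k(x)\,X_H^j(x)\,\xi^\ell-\tfrac14\Bigl(\tfrac{\sin\theta_0}{1-\cos\theta_0}\Bigr)\langle\xi-\hbar X_H(x),\xi-\hbar X_H(x)\rangle,$$ with the metric evaluated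 at $x$, and define the generating function $$S(q,\overline{q})=\int_q^{\overline{q}}\vartheta+\Sigma\Bigl(\tfrac{q+\overline{q}}{2},\,\overline{q}-q\Bigr),$$ where the integral is taken along the straight line connecting $q$ with $\overline{q}$. $\partial_qS$ and $\partial_{\overline{q}}S$ denote the differentials of $S$ in the variables $q$ and $\overline{q}$, respectively.
   Formalization: The neighborhood of ħ=0 may depend (locally uniformly) on (q,v), since one interval for all of TQ fails, e.g. on a disc with H=0 and large v; the solution is unique among q̄ near q, and Ψ_0 is the smooth extension to ħ=0. *)

theory Defs
  imports "HOL-Analysis.Analysis"
begin

text \<open>
  Since \<open>Q\<close> is an open subset of the vector space \<open>'a\<close>, its tangent bundle is \<open>Q \<times> UNIV\<close>; tensor
  fields are functions of the base point and of tangent vectors, and are only meaningful for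
  base points in \<open>Q\<close>. The inner product of \<open>'a\<close> plays no role except that \<open>Basis\<close> provides the
  linear coordinates \<open>x \<bullet> k\<close>.
\<close>

subsection \<open>Smooth maps, differential forms, pullbacks\<close>

text \<open>\<open>C\<^sup>k\<close> maps by means of iterated directional derivatives; intended for open \<open>S\<close> and finite-dimensional
  \<open>'a\<close>.\<close>

primrec Ck_on :: "nat \<Rightarrow> ('a::real_normed_vector \<Rightarrow> 'b::real_normed_vector) \<Rightarrow> 'a set \<Rightarrow> bool" where
  "Ck_on 0 f S = continuous_on S f"
| "Ck_on (Suc k) f S =
     ((\<forall>x\<in>S. f differentiable (at x)) \<and> (\<forall>v. Ck_on k (\<lambda>x. frechet_derivative f (at x) v) S))"

definition smooth_on :: "('a::real_normed_vector \<Rightarrow> 'b::real_normed_vector) \<Rightarrow> 'a set \<Rightarrow> bool" where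
  "smooth_on f S \<longleftrightarrow> (\<forall>k. Ck_on k f S)"

definition smooth_1form_on ::
    "'a::euclidean_space set \<Rightarrow> ('a \<Rightarrow> 'a \<Rightarrow> real) \<Rightarrow> bool" where
  "smooth_1form_on Q \<alpha> \<longleftrightarrow> (\<forall>x\<in>Q. linear (\<alpha> x)) \<and> (\<forall>v. smooth_on (\<lambda>x. \<alpha> x v) Q)"

text \<open>Exterior derivative of a one-form, with the convention
  \<open>d\<alpha>(u,v) = u(\<alpha>(v)) - v(\<alpha>(u))\<close> for constant vector fields \<open>u, v\<close>.\<close>

definition ext_deriv ::
    "('b::real_normed_vector \<Rightarrow> 'b \<Rightarrow> real) \<Rightarrow> 'b \<Rightarrow> 'b \<Rightarrow> 'b \<Rightarrow> real" where
  "ext_deriv \<alpha> x u v =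
     frechet_derivative (\<lambda>y. \<alpha> y v) (at x) u - frechet_derivative (\<lambda>y. \<alpha> y u) (at x) v"

definition pullback2 ::
    "('b::real_normed_vector \<Rightarrow> 'c::real_normed_vector) \<Rightarrow> ('c \<Rightarrow> 'c \<Rightarrow> 'c \<Rightarrow> real)
      \<Rightarrow> 'b \<Rightarrow> 'b \<Rightarrow> 'b \<Rightarrow> real" where
  "pullback2 f \<beta> x u v =
     \<beta> (f x) (frechet_derivative f (at x) u) (frechet_derivative f (at x) v)"

subsection \<open>The almost Kaehler data\<close>

definition omega :: "('a::euclidean_space \<Rightarrow> 'a \<Rightarrow> real) \<Rightarrow> 'a \<Rightarrow> 'a \<Rightarrow> 'a \<Rightarrow> real" where
  "omega \<theta> x u v = - ext_deriv \<theta> x u v"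

text \<open>Closedness and antisymmetry of \<open>omega \<theta>\<close> are automatic, hence only nondegeneracy is required.\<close>

definition exact_symplectic_on ::
    "'a::euclidean_space set \<Rightarrow> ('a \<Rightarrow> 'a \<Rightarrow> real) \<Rightarrow> bool" where
  "exact_symplectic_on Q \<theta> \<longleftrightarrow> smooth_1form_on Q \<theta> \<and>
     (\<forall>x\<in>Q. \<forall>u. (\<forall>w. omega \<theta> x u w = 0) \<longrightarrow> u = 0)"

definition almost_complex_on ::
    "'a::euclidean_space set \<Rightarrow> ('a \<Rightarrow> 'a \<Rightarrow> 'a) \<Rightarrow> bool" where
  "almost_complex_on Q J \<longleftrightarrow>
     (\<forall>x\<in>Q. linear (J x) \<and> (\<forall>v. J x (J x v) = - v)) \<and> (\<forall>v. smooth_on (\<lambda>x. J x v) Q)"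

definition compatible_on ::
    "'a::euclidean_space set \<Rightarrow> ('a \<Rightarrow> 'a \<Rightarrow> real) \<Rightarrow> ('a \<Rightarrow> 'a \<Rightarrow> 'a) \<Rightarrow> bool" where
  "compatible_on Q \<theta> J \<longleftrightarrow>
     (\<forall>x\<in>Q. (\<forall>u v. omega \<theta> x (J x u) (J x v) = omega \<theta> x u v) \<and>
             (\<forall>v. v \<noteq> 0 \<longrightarrow> omega \<theta> x v (J x v) > 0))"

definition metric ::
    "('a::euclidean_space \<Rightarrow> 'a \<Rightarrow> real) \<Rightarrow> ('a \<Rightarrow> 'a \<Rightarrow> 'a) \<Rightarrow> 'a \<Rightarrow> 'a \<Rightarrow> 'a \<Rightarrow> real" where
  "metric \<theta> J x v w = omega \<theta> x v (J x w)"

definition gradient ::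
    "('a::euclidean_space \<Rightarrow> 'a \<Rightarrow> real) \<Rightarrow> ('a \<Rightarrow> 'a \<Rightarrow> 'a) \<Rightarrow> ('a \<Rightarrow> real) \<Rightarrow> 'a \<Rightarrow> 'a" where
  "gradient \<theta> J H x = (THE u. \<forall>w. metric \<theta> J x u w = frechet_derivative H (at x) w)"

definition hamiltonian_vf ::
    "('a::euclidean_space \<Rightarrow> 'a \<Rightarrow> real) \<Rightarrow> ('a \<Rightarrow> 'a \<Rightarrow> 'a) \<Rightarrow> ('a \<Rightarrow> real) \<Rightarrow> 'a \<Rightarrow> 'a" where
  "hamiltonian_vf \<theta> J H x = - J x (gradient \<theta> J H x)"

subsection \<open>The symplectic form on the tangent bundle\<close>

text \<open>The cotangent bundle of \<open>'a\<close> is the product of \<open>'a\<close> with its dual \<open>'a \<Rightarrow>\<^sub>L real\<close>; the canonical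
  symplectic form is \<open>-d(p dq) = dq \<and> dp\<close>, the same sign convention as \<open>\<omega> = -d\<theta>\<close>.\<close>

definition tautological_form ::
    "'a::euclidean_space \<times> ('a \<Rightarrow>\<^sub>L real) \<Rightarrow> 'a \<times> ('a \<Rightarrow>\<^sub>L real) \<Rightarrow> real" where
  "tautological_form z \<delta> = blinfun_apply (snd z) (fst \<delta>)"

definition canonical_symplectic ::
    "'a::euclidean_space \<times> ('a \<Rightarrow>\<^sub>L real) \<Rightarrow> 'a \<times> ('a \<Rightarrow>\<^sub>L real) \<Rightarrow> 'a \<times> ('a \<Rightarrow>\<^sub>L real) \<Rightarrow> real" where
  "canonical_symplectic z \<delta> \<delta>' = - ext_deriv tautological_form z \<delta> \<delta>'"

definition flat_map ::
    "('a::euclidean_space \<Rightarrow> 'a \<Rightarrow> real) \<Rightarrow> ('a \<Rightarrow> 'a \<Rightarrow> 'a) \<Rightarrow> 'a \<times> 'a \<Rightarrow> 'a \<times> ('a \<Rightarrow>\<^sub>L real)" where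
  "flat_map \<theta> J z = (fst z, Blinfun (metric \<theta> J (fst z) (snd z)))"

definition lorentz_form ::
    "('a::euclidean_space \<Rightarrow> 'a \<Rightarrow> real) \<Rightarrow> ('a \<Rightarrow> 'a \<Rightarrow> 'a) \<Rightarrow> real
      \<Rightarrow> 'a \<times> 'a \<Rightarrow> 'a \<times> 'a \<Rightarrow> 'a \<times> 'a \<Rightarrow> real" where
  "lorentz_form \<theta> J hbar z a b =
     pullback2 fst (omega \<theta>) z a b
     + hbar^2 * pullback2 (flat_map \<theta> J) canonical_symplectic z a b"

subsection \<open>The generating function and the implicit relations\<close>

definition Sigma_fun ::
    "('a::euclidean_space \<Rightarrow> 'a \<Rightarrow> real) \<Rightarrow> ('a \<Rightarrow> 'a \<Rightarrow> 'a) \<Rightarrow> ('a \<Rightarrow> real) \<Rightarrow> real \<Rightarrow> real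
      \<Rightarrow> 'a \<Rightarrow> 'a \<Rightarrow> real" where
  "Sigma_fun \<theta> J H \<theta>\<^sub>0 hbar x \<xi> =
    (let X = hamiltonian_vf \<theta> J H x in
       - hbar * H x
       + hbar^2 * metric \<theta> J x X \<xi>
       - 1/12 * hbar^2 *
           (\<Sum>k\<in>Basis. \<Sum>j\<in>Basis. \<Sum>l\<in>Basis.
              frechet_derivative (\<lambda>y. omega \<theta> y j l) (at x) k * (X \<bullet> k) * (X \<bullet> j) * (\<xi> \<bullet> l))
       - 1/4 * (sin \<theta>\<^sub>0 / (1 - cos \<theta>\<^sub>0)) *
           metric \<theta> J x (\<xi> - hbar *\<^sub>R X) (\<xi> - hbar *\<^sub>R X))"

definition gen_fun ::
    "('a::euclidean_space \<Rightarrow> 'a \<Rightarrow> real) \<Rightarrow> ('a \<Rightarrow> 'a \<Rightarrow> 'a) \<Rightarrow> ('a \<Rightarrow> real) \<Rightarrow> real \<Rightarrow> real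
      \<Rightarrow> 'a \<Rightarrow> 'a \<Rightarrow> real" where
  "gen_fun \<theta> J H \<theta>\<^sub>0 hbar q q' =
     integral {0..1} (\<lambda>t. \<theta> (q + t *\<^sub>R (q' - q)) (q' - q))
     + Sigma_fun \<theta> J H \<theta>\<^sub>0 hbar ((1/2) *\<^sub>R (q + q')) (q' - q)"

text \<open>The two implicit relations between \<open>(q, v)\<close> and \<open>(q', v')\<close>, as equalities of covectors. They are
  meaningful only if the segment from \<open>q\<close> to \<open>q'\<close> lies in \<open>Q\<close>.\<close>

definition lorentz_relations ::
    "('a::euclidean_space \<Rightarrow> 'a \<Rightarrow> real) \<Rightarrow> ('a \<Rightarrow> 'a \<Rightarrow> 'a) \<Rightarrow> ('a \<Rightarrow> real) \<Rightarrow> real \<Rightarrow> real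
      \<Rightarrow> 'a \<times> 'a \<Rightarrow> 'a \<times> 'a \<Rightarrow> bool" where
  "lorentz_relations \<theta> J H \<theta>\<^sub>0 hbar = (\<lambda>(q, v) (q', v').
     (\<forall>w. \<theta> q' w + hbar^2 * metric \<theta> J q' v' w =
            frechet_derivative (\<lambda>y. gen_fun \<theta> J H \<theta>\<^sub>0 hbar q y) (at q') w) \<and>
     (\<forall>w. \<theta> q w + hbar^2 * metric \<theta> J q v w =
            - frechet_derivative (\<lambda>y. gen_fun \<theta> J H \<theta>\<^sub>0 hbar y q') (at q) w))"

text \<open>The exponential series of an endomorphism, evaluated at a vector.\<close>

definition endo_exp :: "('a::real_normed_vector \<Rightarrow> 'a) \<Rightarrow> 'a \<Rightarrow> 'a" where
  "endo_exp A v = (\<Sum>n. (1 / fact n) *\<^sub>R (A ^^ n) v)"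

end

(* At hbar = 0 the relations only say q' = q and do not determine v'. This is resolved by the
   coordinates (m, zeta) with q = m - xi/2, q' = m + xi/2, xi = hbar X(m) + hbar^2 zeta. In them
   the differential of the generating function, without its theta-part, is divisible by hbar^2
   because omega(X, .) = dH, and both (q, v) and (q', v') become smooth functions of (m, zeta, hbar).
   At hbar = 0 they are v = X - (J + c) zeta / 2 and v' = X + (J - c) zeta / 2 with c = cot(theta_0 / 2),
   so that v' - X is v - X rotated by -theta_0. The map (m, zeta, hbar) -> (q, v, hbar) is injective
   because hbar^2 v is, for small hbar, an injective function of the displacement xi near 0; hence
   it is a diffeomorphism onto an open set by invariance of domain and the inverse function theorem.
   Finally, the relations say that the pullback of the potential theta + hbar^2 g(v, dq) differs from
   the potential by an exact form. *)

theory Submission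
  imports Defs
begin

subsection \<open>Smooth maps\<close>

text \<open>The slice h = 0 is noncompact in v, so local inverses of the coordinate change do not by
  themselves give one inverse near the whole slice. The displacement map \<open>\<Gamma>\<close>
  takes v out of the question: its radius of injectivity depends on q alone, which yields one
  neighbourhood of the diagonal that serves all v. At \<xi> = 0, h = 0 the derivative of
  \<open>N\<close> in the direction \<xi>, paired with \<xi>, is -c/2 g(\<xi>, \<xi>); here c must
  be nonzero. The constant 1/12 in \<Sigma> is the integral of (t - 1/2)^2 over [0, 1]. The
  variation of \<omega> along the segment, seen from the midpoint, leaves this factor at order h^2,
  and the term with the derivative of \<omega> in \<Sigma> cancels it, so that the limit involves no
  derivative of \<omega>. The correction to h X in the displacement has to start at h^2: the metric
  term of \<Sigma> is quadratic in \<xi> - h X, and only then is its differential divisible by h^2.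
  The limit map on v - X is the Cayley transform (c - J)/(c + J), which for c =
  cot(\<open>\<theta>\<^sub>0\<close>/2) is the rotation by
  \<open>- \<theta>\<^sub>0\<close>.\<close>

lemma linear_basis_expansion:
  fixes w :: "'a::euclidean_space"
  assumes "linear f"
  shows "f w = (\<Sum>b\<in>Basis. (w \<bullet> b) *\<^sub>R f b)"
proof -
  have "f w = f (\<Sum>b\<in>Basis. (w \<bullet> b) *\<^sub>R b)" by (simp only: euclidean_representation)
  also have "\<dots> = (\<Sum>b\<in>Basis. (w \<bullet> b) *\<^sub>R f b)"
    by (simp only: linear_sum[OF assms] linear_cmul[OF assms])
  finally show ?thesis .
qed

lemma Ck_on_Suc_imp_Ck_on: "Ck_on (Suc k) f S \<Longrightarrow> Ck_on k f S"
proof (induction k arbitrary: f)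
  case 0
  then show ?case
    by (auto intro!: continuous_at_imp_continuous_on differentiable_imp_continuous_within)
next
  case (Suc k)
  then show ?case by simp
qed

lemma Ck_on_subset: "Ck_on k f S \<Longrightarrow> T \<subseteq> S \<Longrightarrow> Ck_on k f T"
  by (induction k arbitrary: f) (auto intro: continuous_on_subset)

lemma Ck_on_imp_continuous_on: "Ck_on k f S \<Longrightarrow> continuous_on S f"
proof (induction k)
  case (Suc k)
  then show ?case using Ck_on_Suc_imp_Ck_on by blast
qed simp

text \<open>\<open>frechet_derivative\<close> is a choice among all derivatives at the point. Both
  functions admit exactly the same ones, so the choices agree even where there is none.\<close>

lemma frechet_derivative_cong:
  assumes "open S" "x \<in> S" "\<And>y. y \<in> S \<Longrightarrow> f y = g y"
  shows "frechet_derivative f (at x) = frechet_derivative g (at x)"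
proof -
  have "(f has_derivative D) (at x) \<longleftrightarrow> (g has_derivative D) (at x)" for D
    using has_derivative_transform_within_open[of f D x UNIV S g]
      has_derivative_transform_within_open[of g D x UNIV S f] assms by auto
  then show ?thesis by (simp add: frechet_derivative_def)
qed

lemma Ck_on_cong:
  assumes "open S" "\<And>x. x \<in> S \<Longrightarrow> f x = g x" "Ck_on k f S"
  shows "Ck_on k g S"
  using assms
proof (induction k arbitrary: f g)
  case 0
  then show ?case by (auto cong: continuous_on_cong)
next
  case (Suc k)
  have D: "frechet_derivative f (at x) = frechet_derivative g (at x)" if "x \<in> S" for x
    using frechet_derivative_cong[OF Suc.prems(1) that, of f g] Suc.prems(2) by blast
  have "g differentiable (at x)" if x: "x \<in> S" for x
  proof -
    obtain D where "(f has_derivative D) (at x)"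
      using Suc.prems(3) x by (auto simp: differentiable_def)
    from has_derivative_transform_within_open[OF this Suc.prems(1) x Suc.prems(2)]
    show ?thesis by (auto simp: differentiable_def)
  qed
  moreover have "Ck_on k (\<lambda>x. frechet_derivative g (at x) v) S" for v
    by (rule Suc.IH[OF Suc.prems(1), of "\<lambda>x. frechet_derivative f (at x) v"])
      (use Suc.prems(3) in \<open>simp_all add: D\<close>)
  ultimately show ?case by simp
qed

text \<open>The form in which every induction on k proceeds: an explicit formula for the derivative
  replaces the chosen \<open>frechet_derivative\<close>.\<close>

lemma Ck_on_SucI:
  assumes "open S" "\<And>x. x \<in> S \<Longrightarrow> (f has_derivative f' x) (at x)" "\<And>v. Ck_on k (\<lambda>x. f' x v) S"
  shows "Ck_on (Suc k) f S"
proof -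
  have "frechet_derivative f (at x) = f' x" if "x \<in> S" for x
    using assms(2)[OF that] frechet_derivative_at by metis
  then have "Ck_on k (\<lambda>x. frechet_derivative f (at x) v) S" for v
    using assms by (intro Ck_on_cong[OF assms(1) _ assms(3)[of v]]) simp
  then show ?thesis using assms(2) by (auto simp: differentiable_def)
qed

lemma Ck_on_SucD:
  assumes "Ck_on (Suc k) f S" "x \<in> S"
  shows "(f has_derivative frechet_derivative f (at x)) (at x)"
  using assms by (simp add: frechet_derivative_works)

lemma Ck_on_const: "Ck_on k (\<lambda>x. c) S"
  by (induction k arbitrary: c) auto

lemma Ck_on_bounded_linear: 
  assumes "bounded_linear f" "open S" shows "Ck_on k f S"
proof (cases k)
  case 0
  then show ?thesis using assms by (simp add: linear_continuous_on)
next
  case (Suc j)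
  then show ?thesis
    using Ck_on_SucI[OF assms(2), of f "\<lambda>_. f"] bounded_linear_imp_has_derivative[OF assms(1)]
    by (auto intro: Ck_on_const)
qed

lemma Ck_on_add:
  assumes "open S" "Ck_on k f S" "Ck_on k g S" shows "Ck_on k (\<lambda>x. f x + g x) S"
  using assms
proof (induction k arbitrary: f g)
  case 0
  then show ?case by (auto intro: continuous_intros)
next
  case (Suc k)
  show ?case
    by (rule Ck_on_SucI[OF assms(1) has_derivative_add[OF Ck_on_SucD Ck_on_SucD]])
      (use Suc in auto)
qed

lemma Ck_on_bounded_bilinear:
  assumes "bounded_bilinear b" "open S" "Ck_on k f S" "Ck_on k g S"
  shows "Ck_on k (\<lambda>x. b (f x) (g x)) S"
  using assms
proof (induction k arbitrary: f g)
  case 0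
  then show ?case by (auto intro: bounded_bilinear.continuous_on)
next
  case (Suc k)
  show ?case
  proof (rule Ck_on_SucI[OF \<open>open S\<close> bounded_bilinear.FDERIV[OF assms(1) Ck_on_SucD Ck_on_SucD]])
    show "Ck_on k (\<lambda>x. b (f x) (frechet_derivative g (at x) v) + b (frechet_derivative f (at x) v) (g x)) S" for v
      using Suc Ck_on_Suc_imp_Ck_on[OF Suc.prems(3)] Ck_on_Suc_imp_Ck_on[OF Suc.prems(4)]
      by (intro Ck_on_add Suc.IH) auto
  qed (use Suc in auto)
qed

lemma Ck_on_bounded_linear_comp:
  assumes "bounded_linear h" "open S" "Ck_on k f S"
  shows "Ck_on k (\<lambda>x. h (f x)) S"
  using assms
proof (induction k arbitrary: f)
  case 0
  then show ?case by (auto intro: bounded_linear.continuous_on)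
next
  case (Suc k)
  show ?case
    by (rule Ck_on_SucI[OF assms(2) bounded_linear.has_derivative[OF assms(1) Ck_on_SucD]])
      (use Suc in auto)
qed

lemma Ck_on_sum:
  assumes "open S" "\<And>i. i \<in> I \<Longrightarrow> Ck_on k (f i) S"
  shows "Ck_on k (\<lambda>x. \<Sum>i\<in>I. f i x) S"
proof (cases "finite I")
  case True
  then show ?thesis using assms
    by (induction I) (auto intro: Ck_on_const Ck_on_add)
qed (auto intro: Ck_on_const)

text \<open>In the chain rule the derivative of f is evaluated in the moving direction g'(x) v,
  whereas \<open>Ck_on\<close> speaks about fixed directions only. Expanding this direction in the
  basis of the intermediate space leaves finitely many fixed directions with C^k coefficients, to
  which the induction hypothesis for other f applies.\<close>

lemma Ck_on_compose:
  fixes g :: "'b::real_normed_vector \<Rightarrow> 'c::euclidean_space"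
  assumes "open S" "open T" "Ck_on k f S" "Ck_on k g T" "g ` T \<subseteq> S"
  shows "Ck_on k (\<lambda>x. f (g x)) T"
  using assms
proof (induction k arbitrary: f)
  case 0
  then show ?case using continuous_on_compose2[of S f T g] by auto
next
  case (Suc k)
  show ?case
  proof (rule Ck_on_SucI[OF \<open>open T\<close>])
    fix x assume x: "x \<in> T"
    have f: "(f has_derivative frechet_derivative f (at (g x))) (at (g x))"
      using Suc x by (auto intro!: Ck_on_SucD)
    have g: "(g has_derivative frechet_derivative g (at x)) (at x)"
      using Suc x by (auto intro!: Ck_on_SucD)
    have 1: "((\<lambda>x. f (g x)) has_derivative (\<lambda>v. frechet_derivative f (at (g x)) (frechet_derivative g (at x) v))) (at x)"
      using has_derivative_compose[OF g f] .
    have 2: "frechet_derivative f (at (g x)) w = (\<Sum>b\<in>Basis. (w \<bullet> b) *\<^sub>R frechet_derivative f (at (g x)) b)" for w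
      using has_derivative_linear[OF f] by (rule linear_basis_expansion)
    show "((\<lambda>x. f (g x)) has_derivative (\<lambda>v. \<Sum>b\<in>Basis. (frechet_derivative g (at x) v \<bullet> b) *\<^sub>R frechet_derivative f (at (g x)) b)) (at x)"
      using 1 by (simp only: 2[symmetric])
  next
    fix v
    show "Ck_on k (\<lambda>x. \<Sum>b\<in>Basis. (frechet_derivative g (at x) v \<bullet> b) *\<^sub>R frechet_derivative f (at (g x)) b) T"
      using Suc.prems Ck_on_Suc_imp_Ck_on[OF Suc.prems(4)]
      by (intro Ck_on_sum Ck_on_bounded_bilinear[OF bounded_bilinear_scaleR] Suc.IH
          Ck_on_bounded_linear_comp[OF bounded_linear_inner_left]) auto
  qed
qed

section \<open>Closure properties of smooth maps\<close>

lemma smooth_on_subset: "smooth_on f S \<Longrightarrow> T \<subseteq> S \<Longrightarrow> smooth_on f T"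
  by (auto simp: smooth_on_def intro: Ck_on_subset)

lemma smooth_on_imp_continuous_on: "smooth_on f S \<Longrightarrow> continuous_on S f"
  by (auto simp: smooth_on_def intro: Ck_on_imp_continuous_on)

lemma smooth_on_cong:
  assumes "smooth_on f S" "open S" "\<And>x. x \<in> S \<Longrightarrow> f x = g x"
  shows "smooth_on g S"
  using assms Ck_on_cong[of S f g] by (auto simp: smooth_on_def)

lemma smooth_on_has_derivative:
  assumes "smooth_on f S" "x \<in> S"
  shows "(f has_derivative frechet_derivative f (at x)) (at x)"
  using assms Ck_on_SucD[of 0 f S x] unfolding smooth_on_def by blast

lemma smooth_on_linear_derivative: "smooth_on f S \<Longrightarrow> x \<in> S \<Longrightarrow> linear (frechet_derivative f (at x))"
  using smooth_on_has_derivative has_derivative_linear by blast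

lemma smooth_on_frechet_derivative:
  "smooth_on f S \<Longrightarrow> smooth_on (\<lambda>x. frechet_derivative f (at x) v) S"
  unfolding smooth_on_def by (metis Ck_on.simps(2))

lemma smooth_on_const: "smooth_on (\<lambda>x. c) S"
  by (simp add: smooth_on_def Ck_on_const)

lemma smooth_on_bounded_linear: "bounded_linear f \<Longrightarrow> open S \<Longrightarrow> smooth_on f S"
  by (simp add: smooth_on_def Ck_on_bounded_linear)

lemma smooth_on_id: "open S \<Longrightarrow> smooth_on (\<lambda>x. x) S"
  by (simp add: bounded_linear_ident smooth_on_bounded_linear)

lemma smooth_on_add: "open S \<Longrightarrow> smooth_on f S \<Longrightarrow> smooth_on g S \<Longrightarrow> smooth_on (\<lambda>x. f x + g x) S"
  by (simp add: smooth_on_def Ck_on_add)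

lemma smooth_on_bounded_bilinear:
  "bounded_bilinear b \<Longrightarrow> open S \<Longrightarrow> smooth_on f S \<Longrightarrow> smooth_on g S \<Longrightarrow> smooth_on (\<lambda>x. b (f x) (g x)) S"
  by (simp add: smooth_on_def Ck_on_bounded_bilinear)

lemma smooth_on_bounded_linear_comp:
  "bounded_linear h \<Longrightarrow> open S \<Longrightarrow> smooth_on f S \<Longrightarrow> smooth_on (\<lambda>x. h (f x)) S"
  by (simp add: smooth_on_def Ck_on_bounded_linear_comp)

lemma smooth_on_sum:
  "open S \<Longrightarrow> (\<And>i. i \<in> I \<Longrightarrow> smooth_on (f i) S) \<Longrightarrow> smooth_on (\<lambda>x. \<Sum>i\<in>I. f i x) S"
  by (simp add: smooth_on_def Ck_on_sum)

lemma smooth_on_compose: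
  fixes g :: "'b::real_normed_vector \<Rightarrow> 'c::euclidean_space"
  assumes "smooth_on f S" "open S" "open T" "smooth_on g T" "\<And>x. x \<in> T \<Longrightarrow> g x \<in> S"
  shows "smooth_on (\<lambda>x. f (g x)) T"
  using assms Ck_on_compose[of S T _ f g] unfolding smooth_on_def by (meson image_subsetI)

lemma smooth_on_minus: "open S \<Longrightarrow> smooth_on f S \<Longrightarrow> smooth_on (\<lambda>x. - f x) S"
  by (rule smooth_on_bounded_linear_comp[OF bounded_linear_minus[OF bounded_linear_ident]])

lemma smooth_on_diff: "open S \<Longrightarrow> smooth_on f S \<Longrightarrow> smooth_on g S \<Longrightarrow> smooth_on (\<lambda>x. f x - g x) S"
  using smooth_on_add[of S f "\<lambda>x. - g x"] smooth_on_minus[of S g] by simp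

lemma smooth_on_fst: "open S \<Longrightarrow> smooth_on f S \<Longrightarrow> smooth_on (\<lambda>x. fst (f x)) S"
  by (rule smooth_on_bounded_linear_comp[OF bounded_linear_fst])

lemma smooth_on_snd: "open S \<Longrightarrow> smooth_on f S \<Longrightarrow> smooth_on (\<lambda>x. snd (f x)) S"
  by (rule smooth_on_bounded_linear_comp[OF bounded_linear_snd])

lemma smooth_on_Pair:
  assumes "open S" "smooth_on f S" "smooth_on g S"
  shows "smooth_on (\<lambda>x. (f x, g x)) S"
proof -
  have "smooth_on (\<lambda>x. (f x, 0) + (0, g x)) S"
    by (intro smooth_on_add smooth_on_bounded_linear_comp[where h = "\<lambda>x. (x, 0)"]
        smooth_on_bounded_linear_comp[where h = "\<lambda>x. (0, x)"] assms bounded_linear_intros)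
  then show ?thesis by simp
qed

lemmas smooth_on_scaleR = smooth_on_bounded_bilinear[OF bounded_bilinear_scaleR]
lemmas smooth_on_mult = smooth_on_bounded_bilinear[OF bounded_bilinear_mult]
lemmas smooth_on_inner = smooth_on_bounded_bilinear[OF bounded_bilinear_inner]

lemma smooth_on_power: 
  fixes f :: "'a::real_normed_vector \<Rightarrow> real"
  shows "open S \<Longrightarrow> smooth_on f S \<Longrightarrow> smooth_on (\<lambda>x. f x ^ n) S"
  by (induction n) (auto intro: smooth_on_const smooth_on_mult)

section \<open>Smooth families of linear maps, their inverses, and inverse functions\<close>

lemma smooth_on_linear_family:
  fixes A :: "'p::euclidean_space \<Rightarrow> 'a::euclidean_space \<Rightarrow> 'b::real_normed_vector"
  assumes "open S" "\<And>x. x \<in> S \<Longrightarrow> linear (A x)" "\<And>b. b \<in> Basis \<Longrightarrow> smooth_on (\<lambda>x. A x b) S"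
  shows "smooth_on (\<lambda>(x, v). A x v) (S \<times> UNIV)"
proof -
  have o: "open (S \<times> UNIV)" using assms(1) by (simp add: open_Times)
  have "smooth_on (\<lambda>p. \<Sum>b\<in>Basis. (snd p \<bullet> b) *\<^sub>R A (fst p) b) (S \<times> (UNIV :: 'a set))"
    by (intro smooth_on_sum smooth_on_scaleR smooth_on_inner smooth_on_snd smooth_on_id smooth_on_const o
        smooth_on_compose[OF assms(3) assms(1)] smooth_on_fst) auto
  then show ?thesis
    by (rule smooth_on_cong[OF _ o]) (auto simp: linear_basis_expansion[OF assms(2), symmetric])
qed

text \<open>Joint smoothness supplies a total derivative; its restrictions to the two coordinate
  slices identify it.\<close>

lemma has_derivative_linear_family:
  fixes A :: "'p::euclidean_space \<Rightarrow> 'a::euclidean_space \<Rightarrow> 'b::real_normed_vector"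
  assumes "open S" "\<And>x. x \<in> S \<Longrightarrow> linear (A x)" "\<And>b. smooth_on (\<lambda>x. A x b) S" "x \<in> S"
  shows "((\<lambda>(x, v). A x v) has_derivative
    (\<lambda>(dx, dv). frechet_derivative (\<lambda>y. A y v) (at x) dx + A x dv)) (at (x, v))"
proof -
  let ?f = "\<lambda>(x, v). A x v"
  have sm: "smooth_on ?f (S \<times> UNIV)" using assms by (intro smooth_on_linear_family)
  define D where "D = frechet_derivative ?f (at (x, v))"
  have D: "(?f has_derivative D) (at (x, v))"
    unfolding D_def using smooth_on_has_derivative[OF sm] assms by auto
  have l: "linear D" using D has_derivative_linear by blast
  have h1: "((\<lambda>y. (y, v)) has_derivative (\<lambda>dx. (dx, 0))) (at x)" by (auto intro!: derivative_eq_intros)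
  have "((\<lambda>y. A y v) has_derivative (\<lambda>dx. D (dx, 0))) (at x)"
    using has_derivative_compose[OF h1, of ?f D] D by simp
  then have 1: "frechet_derivative (\<lambda>y. A y v) (at x) = (\<lambda>dx. D (dx, 0))"
    using frechet_derivative_at by metis
  have h2: "((\<lambda>u. (x, u)) has_derivative (\<lambda>dv. (0, dv))) (at v)" by (auto intro!: derivative_eq_intros)
  have "(A x has_derivative (\<lambda>dv. D (0, dv))) (at v)"
    using has_derivative_compose[OF h2, of ?f D] D by simp
  moreover have "(A x has_derivative A x) (at v)"
    using assms by (intro linear_imp_has_derivative) auto
  ultimately have 2: "A x = (\<lambda>dv. D (0, dv))" using has_derivative_unique by blast
  have "D = (\<lambda>(dx, dv). frechet_derivative (\<lambda>y. A y v) (at x) dx + A x dv)"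
  proof (rule ext, clarify)
    fix dx dv
    have "D (dx, dv) = D ((dx, 0) + (0, dv))" by simp
    also have "\<dots> = D (dx, 0) + D (0, dv)" using l linear_add by blast
    finally show "D (dx, dv) = frechet_derivative (\<lambda>y. A y v) (at x) dx + A x dv"
      unfolding 1 by (simp only: 2)
  qed
  then show ?thesis using D by simp
qed

text \<open>The formula dB = - B (dA) B expresses the derivative of B through B itself, so B being
  C^k makes B of class C^(k+1). Differentiability, the start of this bootstrap, comes from the
  theorem on derivatives of inverse functions.\<close>

lemma smooth_on_inverse_linear_family:
  fixes A B :: "'p::euclidean_space \<Rightarrow> 'a::euclidean_space \<Rightarrow> 'a"
  assumes S: "open S" and A: "\<And>x. x \<in> S \<Longrightarrow> linear (A x)" "\<And>b. smooth_on (\<lambda>x. A x b) S"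
    and AB: "\<And>x w. x \<in> S \<Longrightarrow> A x (B x w) = w" and BA: "\<And>x w. x \<in> S \<Longrightarrow> B x (A x w) = w"
  shows "smooth_on (\<lambda>x. B x w) S"
proof -
  define A' where "A' = (\<lambda>x dx v. frechet_derivative (\<lambda>y. A y v) (at x) dx)"
  have lB: "linear (B x)" if x: "x \<in> S" for x
  proof (rule linearI)
    show "B x (u + v) = B x u + B x v" for u v
      using AB[OF x] BA[OF x] linear_add[OF A(1)[OF x]] by metis
    show "B x (c *\<^sub>R u) = c *\<^sub>R B x u" for c u
      using AB[OF x] BA[OF x] linear_cmul[OF A(1)[OF x]] by metis
  qed
  have o: "open (S \<times> (UNIV :: 'a set))" using S by (simp add: open_Times)
  have der: "((\<lambda>x. B x w) has_derivative (\<lambda>dx. - B x (A' x dx (B x w)))) (at x)" if x: "x \<in> S" for x w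
  proof -
    \<comment> \<open>Carrying x along turns the family of inverses into the inverse of a single map
      on \<open>S \<times> UNIV\<close>, so that no calculus on a space of operators is needed
      here.\<close>
    let ?f = "\<lambda>p. (fst p, A (fst p) (snd p))"
    let ?g = "\<lambda>p. (fst p, B (fst p) (snd p))"
    define f' where "f' = (\<lambda>(x, v) (dx, dv). (dx, A' x dx v + A x dv))"
    define g' where "g' = (\<lambda>(x, v) (dx, dw). (dx, B x (dw - A' x dx v)))"
    have f': "(?f has_derivative f' p) (at p)" if p: "p \<in> S \<times> UNIV" for p
    proof -
      obtain y v where pv: "p = (y, v)" "y \<in> S" using p by auto
      have "((\<lambda>p. A (fst p) (snd p)) has_derivative (\<lambda>d. A' y (fst d) v + A y (snd d))) (at (y, v))"
        using has_derivative_linear_family[OF S A \<open>y \<in> S\<close>, of v] by (simp add: A'_def case_prod_beta')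
      then have "(?f has_derivative (\<lambda>d. (fst d, A' y (fst d) v + A y (snd d)))) (at (y, v))"
        by (intro has_derivative_Pair) (auto intro!: derivative_eq_intros)
      then show ?thesis by (simp add: pv f'_def case_prod_beta')
    qed
    have "(?g has_derivative g' (x, B x w)) (at (?f (x, B x w)))"
      using o f'
    proof (rule has_derivative_inverse_on)
      show "?g (?f p) = p" if "p \<in> S \<times> UNIV" for p using that BA by auto
      show "f' (x, B x w) \<circ> g' (x, B x w) = id"
        using AB[OF x] by (auto simp: f'_def g'_def split_beta)
      show "(x, B x w) \<in> S \<times> UNIV" using x by simp
    qed auto
    then have g: "(?g has_derivative g' (x, B x w)) (at (x, w))" using AB[OF x] by simp
    have h1: "((\<lambda>y. (y, w)) has_derivative (\<lambda>dx. (dx, 0))) (at x)" by (auto intro!: derivative_eq_intros)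
    have "((\<lambda>y. ?g (y, w)) has_derivative (\<lambda>dx. g' (x, B x w) (dx, 0))) (at x)"
      using has_derivative_compose[OF h1 g] .
    from has_derivative_snd[OF this] show ?thesis
      by (simp add: g'_def linear_neg[OF lB[OF x]])
  qed
  have A'l: "A' x dx v = (\<Sum>b\<in>Basis. (v \<bullet> b) *\<^sub>R A' x dx b)" if x: "x \<in> S" for x dx v
  proof -
    have "((\<lambda>y. \<Sum>b\<in>Basis. (v \<bullet> b) *\<^sub>R A y b) has_derivative
      (\<lambda>dx. \<Sum>b\<in>Basis. (v \<bullet> b) *\<^sub>R A' x dx b)) (at x)"
      unfolding A'_def
      by (intro has_derivative_sum has_derivative_scaleR_right smooth_on_has_derivative[OF A(2) x])
    then have "((\<lambda>y. A y v) has_derivative (\<lambda>dx. \<Sum>b\<in>Basis. (v \<bullet> b) *\<^sub>R A' x dx b)) (at x)"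
      by (rule has_derivative_transform_within_open[OF _ S x]) (simp add: linear_basis_expansion[OF A(1), symmetric])
    from frechet_derivative_at[OF this, symmetric] show ?thesis by (simp only: A'_def)
  qed
  have "Ck_on k (\<lambda>x. B x w) S" for k w
  proof (induction k arbitrary: w)
    case 0
    show ?case using has_derivative_continuous[OF der] by (simp add: continuous_at_imp_continuous_on)
  next
    case (Suc k)
    show ?case
    proof (rule Ck_on_SucI[OF S der])
      fix v
      \<comment> \<open>Both arguments that move with x are expanded in the basis; B is then applied
        to fixed vectors only, as the induction hypothesis requires.\<close>
      have "Ck_on k (\<lambda>x. - (\<Sum>b\<in>Basis. (B x w \<bullet> b) *\<^sub>R (\<Sum>c\<in>Basis. (A' x v b \<bullet> c) *\<^sub>R B x c))) S"
        using smooth_on_frechet_derivative[OF A(2), where v = v] unfolding smooth_on_def A'_def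
        by (intro Ck_on_bounded_linear_comp[OF bounded_linear_minus[OF bounded_linear_ident]]
            Ck_on_sum S Ck_on_bounded_bilinear[OF bounded_bilinear_scaleR] Suc
            Ck_on_bounded_linear_comp[OF bounded_linear_inner_left]) auto
      then show "Ck_on k (\<lambda>x. - B x (A' x v (B x w))) S"
      proof (rule Ck_on_cong[OF S, rotated])
        fix x assume x: "x \<in> S"
        show "- (\<Sum>b\<in>Basis. (B x w \<bullet> b) *\<^sub>R (\<Sum>c\<in>Basis. (A' x v b \<bullet> c) *\<^sub>R B x c)) = - B x (A' x v (B x w))"
          by (simp add: A'l[OF x, of v "B x w"] linear_sum[OF lB[OF x]] linear_cmul[OF lB[OF x]]
              linear_basis_expansion[OF lB[OF x], symmetric])
      qed
    qed
  qed
  then show ?thesis by (simp add: smooth_on_def)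
qed

text \<open>The image is open by invariance of domain, since g makes f injective. The derivative of
  g is the inverse derivative of f taken at g(y), a smooth family composed with g; hence g gains one
  order of differentiability at each induction step.\<close>

lemma smooth_on_inverse_function:
  fixes f g :: "'a::euclidean_space \<Rightarrow> 'a"
  assumes S: "open S" and f: "smooth_on f S" and gf: "\<And>x. x \<in> S \<Longrightarrow> g (f x) = x"
    and inj: "\<And>x. x \<in> S \<Longrightarrow> inj (frechet_derivative f (at x))"
  shows "open (f ` S)" "smooth_on g (f ` S)"
proof -
  show o: "open (f ` S)"
    using invariance_of_domain[OF smooth_on_imp_continuous_on[OF f] S] gf by (auto intro: inj_on_inverseI)
  define B where "B = (\<lambda>x. inv (frechet_derivative f (at x)))"
  have lf: "linear (frechet_derivative f (at x))" if "x \<in> S" for x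
    using smooth_on_linear_derivative[OF f that] .
  have bij: "bij (frechet_derivative f (at x))" if "x \<in> S" for x
    using inj[OF that] linear_injective_imp_surjective[OF lf[OF that]] by (simp add: bij_def)
  have smB: "smooth_on (\<lambda>x. B x w) S" for w
    using S lf smooth_on_frechet_derivative[OF f]
    by (rule smooth_on_inverse_linear_family)
      (use bij in \<open>auto simp: B_def bij_is_surj surj_f_inv_f inv_f_f bij_is_inj\<close>)
  have der: "(g has_derivative B (g y)) (at y)" if y: "y \<in> f ` S" for y
  proof -
    obtain x where x: "x \<in> S" "y = f x" using y by auto
    have "(g has_derivative B x) (at (f x))"
      by (rule has_derivative_inverse_on[OF S smooth_on_has_derivative[OF f] gf])
        (use x bij in \<open>auto simp: B_def surj_iff[symmetric] bij_is_surj\<close>)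
    then show ?thesis using x gf by simp
  qed
  have "Ck_on k g (f ` S)" for k
  proof (induction k)
    case 0
    show ?case using has_derivative_continuous[OF der] by (simp add: continuous_at_imp_continuous_on)
  next
    case (Suc k)
    have "g ` f ` S \<subseteq> S" using gf by auto
    then show ?case
      by (intro Ck_on_SucI[OF o der] Ck_on_compose[OF S o _ Suc])
        (use smB in \<open>auto simp: smooth_on_def\<close>)
  qed
  then show "smooth_on g (f ` S)" by (simp add: smooth_on_def)
qed

subsection \<open>Local injectivity, second derivatives, parametrized integrals\<close>

text \<open>In finite dimension, continuity in each basis direction is continuity in the operator
  norm, the form needed for the perturbation estimates below.\<close>

lemma continuous_on_Blinfun_derivative:
  fixes f :: "'a::euclidean_space \<Rightarrow> 'b::euclidean_space"
  assumes "smooth_on f S"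
  shows "continuous_on S (\<lambda>x. Blinfun (frechet_derivative f (at x)))"
proof (rule continuous_on_blinfun_componentwise)
  fix i :: 'a
  have "continuous_on S (\<lambda>x. frechet_derivative f (at x) i)"
    using assms by (intro smooth_on_imp_continuous_on smooth_on_frechet_derivative)
  then show "continuous_on S (\<lambda>x. blinfun_apply (Blinfun (frechet_derivative f (at x))) i)"
    using smooth_on_linear_derivative[OF assms]
    by (auto simp: bounded_linear_Blinfun_apply linear_conv_bounded_linear cong: continuous_on_cong)
qed

text \<open>An injective linear map expands norms by at least some factor B > 0, and a perturbation
  of operator norm less than B cannot create a kernel.\<close>

lemma open_inj_derivative:
  fixes f :: "'a::euclidean_space \<Rightarrow> 'b::euclidean_space"
  assumes S: "open S" and f: "smooth_on f S"
  shows "open {x \<in> S. inj (frechet_derivative f (at x))}"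
proof -
  define F where "F = (\<lambda>x. Blinfun (frechet_derivative f (at x)))"
  have F: "blinfun_apply (F x) = frechet_derivative f (at x)" if "x \<in> S" for x
    using smooth_on_linear_derivative[OF f that]
    by (simp add: F_def bounded_linear_Blinfun_apply linear_conv_bounded_linear)
  have cF: "continuous_on S F" unfolding F_def by (rule continuous_on_Blinfun_derivative[OF f])
  have "\<exists>e>0. \<forall>y. dist y x < e \<longrightarrow> y \<in> S \<and> inj (frechet_derivative f (at y))"
    if x: "x \<in> S" "inj (frechet_derivative f (at x))" for x
  proof -
    obtain B where B: "B > 0" "\<And>v. B * norm v \<le> norm (frechet_derivative f (at x) v)"
      using linear_inj_bounded_below_pos[OF smooth_on_linear_derivative[OF f x(1)] x(2)] by blast
    obtain e1 where e1: "e1 > 0" "\<And>y. y \<in> S \<Longrightarrow> dist y x < e1 \<Longrightarrow> dist (F y) (F x) < B"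
      using cF x(1) B(1) unfolding continuous_on_iff by metis
    obtain e2 where e2: "e2 > 0" "\<And>y. dist y x < e2 \<Longrightarrow> y \<in> S"
      using S x(1) unfolding open_dist by metis
    have "inj (frechet_derivative f (at y))" if y: "dist y x < min e1 e2" for y
    proof -
      have yS: "y \<in> S" using e2 y by simp
      have d: "norm (F y - F x) < B" using e1(2)[OF yS] y by (simp add: dist_norm)
      have "v = 0" if v: "frechet_derivative f (at y) v = 0" for v
      proof (rule ccontr)
        assume nz: "v \<noteq> 0"
        have "B * norm v \<le> norm (blinfun_apply (F x) v)" using B F[OF x(1)] by simp
        also have "\<dots> = norm (blinfun_apply (F y - F x) v)"
          using v F[OF yS] by (simp add: blinfun.diff_left)
        also have "\<dots> \<le> norm (F y - F x) * norm v" by (rule norm_blinfun)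
        also have "\<dots> < B * norm v" using d nz by simp
        finally show False by simp
      qed
      then show ?thesis
        using linear_injective_0[OF smooth_on_linear_derivative[OF f yS]] by blast
    qed
    then show ?thesis using e1 e2 by (intro exI[of _ "min e1 e2"]) auto
  qed
  then show ?thesis unfolding open_dist by auto
qed

lemma smooth_on_locally_injective:
  fixes f :: "'a::euclidean_space \<Rightarrow> 'b::euclidean_space"
  assumes S: "open S" "x \<in> S" and f: "smooth_on f S" and inj: "inj (frechet_derivative f (at x))"
  obtains r where "r > 0" "ball x r \<subseteq> S" "inj_on f (ball x r)"
proof -
  define F where "F = (\<lambda>x. Blinfun (frechet_derivative f (at x)))"
  have F: "blinfun_apply (F x) = frechet_derivative f (at x)" if "x \<in> S" for x
    using smooth_on_linear_derivative[OF f that]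
    by (simp add: F_def bounded_linear_Blinfun_apply linear_conv_bounded_linear)
  have cF: "continuous_on S F" unfolding F_def by (rule continuous_on_Blinfun_derivative[OF f])
  obtain g where g: "linear g" "g \<circ> frechet_derivative f (at x) = id"
    using linear_injective_left_inverse[OF smooth_on_linear_derivative[OF f S(2)] inj] by blast
  show thesis
  proof (rule has_derivative_locally_injective[OF S(2,1), where g' = g and f = f and f' = "\<lambda>x. frechet_derivative f (at x)"])
    show "bounded_linear g" using g by (simp add: linear_conv_bounded_linear)
    show "g \<circ> frechet_derivative f (at x) = id" by (rule g)
    show "(f has_derivative frechet_derivative f (at y)) (at y)" if "y \<in> S" for y
      using smooth_on_has_derivative[OF f that] .
    fix e :: real assume "e > 0"
    then obtain e1 where e1: "e1 > 0" "\<And>y. y \<in> S \<Longrightarrow> dist y x < e1 \<Longrightarrow> dist (F y) (F x) < e"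
      using cF S(2) unfolding continuous_on_iff by metis
    obtain e2 where e2: "e2 > 0" "\<And>y. dist y x < e2 \<Longrightarrow> y \<in> S"
      using S unfolding open_dist by metis
    have "onorm (\<lambda>v. frechet_derivative f (at y) v - frechet_derivative f (at x) v) < e"
      if y: "dist x y < min e1 e2" for y
    proof -
      have yS: "y \<in> S" using e2 y by (simp add: dist_commute)
      have "norm (F y - F x) < e" using e1(2)[OF yS] y by (simp add: dist_norm norm_minus_commute)
      moreover have "blinfun_apply (F y - F x) = (\<lambda>v. frechet_derivative f (at y) v - frechet_derivative f (at x) v)"
        by (simp add: fun_eq_iff blinfun.diff_left F[OF yS] F[OF S(2)])
      ultimately show ?thesis by (simp add: norm_blinfun.rep_eq)
    qed
    then show "\<exists>d>0. \<forall>y. dist x y < d \<longrightarrow>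
        onorm (\<lambda>v. frechet_derivative f (at y) v - frechet_derivative f (at x) v) < e"
      using e1 e2 by (intro exI[of _ "min e1 e2"]) auto
  qed (use that in blast)
qed

section \<open>Symmetry of second derivatives\<close>

lemma has_real_derivative_along_line:
  assumes "(g has_derivative G) (at (p + s *\<^sub>R u))"
  shows "((\<lambda>s. g (p + s *\<^sub>R u)) has_real_derivative G u) (at s)"
proof -
  have 1: "((\<lambda>s. p + s *\<^sub>R u) has_derivative (\<lambda>h. h *\<^sub>R u)) (at s)"
    by (auto intro!: derivative_eq_intros)
  have "((\<lambda>s. g (p + s *\<^sub>R u)) has_derivative (\<lambda>h. G (h *\<^sub>R u))) (at s)"
    using has_derivative_compose[OF 1 assms] .
  moreover have "G (h *\<^sub>R u) = G u * h" for h
    using has_derivative_linear[OF assms] by (simp add: linear_cmul)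
  ultimately show ?thesis by (simp add: has_field_derivative_def)
qed

text \<open>The mean value theorem is applied twice, first in direction u, then in direction v. The
  point of the formula is that its left side is symmetric in u and v.\<close>

lemma second_difference_mean_value:
  fixes f :: "'a::real_normed_vector \<Rightarrow> real"
  assumes f: "smooth_on f S" and S: "ball x \<delta> \<subseteq> S" and h: "h > 0" "h * (norm u + norm v) < \<delta>"
  obtains y where "y \<in> ball x \<delta>"
    "f (x + h *\<^sub>R u + h *\<^sub>R v) - f (x + h *\<^sub>R u) - f (x + h *\<^sub>R v) + f x
      = h^2 * frechet_derivative (\<lambda>y. frechet_derivative f (at y) u) (at y) v"
proof -
  have inb: "x + s *\<^sub>R u + t *\<^sub>R v \<in> ball x \<delta>" if "0 \<le> s" "s \<le> h" "0 \<le> t" "t \<le> h" for s t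
  proof -
    have "norm (s *\<^sub>R u + t *\<^sub>R v) \<le> s * norm u + t * norm v"
      using norm_triangle_ineq[of "s *\<^sub>R u" "t *\<^sub>R v"] that by simp
    also have "\<dots> \<le> h * norm u + h * norm v"
      using that by (intro add_mono mult_right_mono) auto
    finally show ?thesis using h by (simp add: dist_norm algebra_simps norm_minus_commute)
  qed
  have fd: "(f has_derivative frechet_derivative f (at y)) (at y)" if "y \<in> ball x \<delta>" for y
    using smooth_on_has_derivative[OF f] S that by blast
  have fdd: "((\<lambda>y. frechet_derivative f (at y) u) has_derivative
      frechet_derivative (\<lambda>y. frechet_derivative f (at y) u) (at y)) (at y)" if "y \<in> ball x \<delta>" for y
    using smooth_on_has_derivative[OF smooth_on_frechet_derivative[OF f]] S that by blast
  let ?\<phi> = "\<lambda>s. f (x + h *\<^sub>R v + s *\<^sub>R u) - f (x + s *\<^sub>R u)"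
  have "(?\<phi> has_real_derivative
      frechet_derivative f (at (x + h *\<^sub>R v + s *\<^sub>R u)) u - frechet_derivative f (at (x + s *\<^sub>R u)) u) (at s)"
    if "0 \<le> s" "s \<le> h" for s
    using inb[of s h] inb[of s 0] that h
    by (intro DERIV_diff has_real_derivative_along_line fd) (auto simp: algebra_simps)
  from MVT2[OF h(1) this] obtain s where s: "0 < s" "s < h"
    "?\<phi> h - ?\<phi> 0 = (h - 0) * (frechet_derivative f (at (x + h *\<^sub>R v + s *\<^sub>R u)) u - frechet_derivative f (at (x + s *\<^sub>R u)) u)"
    by blast
  let ?\<psi> = "\<lambda>t. frechet_derivative f (at (x + s *\<^sub>R u + t *\<^sub>R v)) u"
  have "(?\<psi> has_real_derivative
      frechet_derivative (\<lambda>y. frechet_derivative f (at y) u) (at (x + s *\<^sub>R u + t *\<^sub>R v)) v) (at t)"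
    if "0 \<le> t" "t \<le> h" for t
    using inb[of s t] s that by (intro has_real_derivative_along_line fdd) auto
  from MVT2[OF h(1) this] obtain t where t: "0 < t" "t < h"
    "?\<psi> h - ?\<psi> 0 = (h - 0) * frechet_derivative (\<lambda>y. frechet_derivative f (at y) u) (at (x + s *\<^sub>R u + t *\<^sub>R v)) v"
    by blast
  show thesis
  proof (rule that[of "x + s *\<^sub>R u + t *\<^sub>R v"])
    show "x + s *\<^sub>R u + t *\<^sub>R v \<in> ball x \<delta>" using s t by (intro inb) auto
    have "f (x + h *\<^sub>R u + h *\<^sub>R v) - f (x + h *\<^sub>R u) - f (x + h *\<^sub>R v) + f x = ?\<phi> h - ?\<phi> 0"
      by (simp add: algebra_simps)
    also have "\<dots> = h * (?\<psi> h - ?\<psi> 0)" using s(3) by (simp add: algebra_simps)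
    finally show "f (x + h *\<^sub>R u + h *\<^sub>R v) - f (x + h *\<^sub>R u) - f (x + h *\<^sub>R v) + f x
      = h^2 * frechet_derivative (\<lambda>y. frechet_derivative f (at y) u) (at (x + s *\<^sub>R u + t *\<^sub>R v)) v"
      using t(3) by (simp add: power2_eq_square)
  qed
qed

lemma second_derivative_symmetric_real:
  fixes f :: "'a::real_normed_vector \<Rightarrow> real"
  assumes S: "open S" and f: "smooth_on f S" and x: "x \<in> S"
  shows "frechet_derivative (\<lambda>y. frechet_derivative f (at y) u) (at x) v
    = frechet_derivative (\<lambda>y. frechet_derivative f (at y) v) (at x) u"
proof (rule ccontr)
  define a where "a = (\<lambda>x. frechet_derivative (\<lambda>y. frechet_derivative f (at y) u) (at x) v)"
  define b where "b = (\<lambda>x. frechet_derivative (\<lambda>y. frechet_derivative f (at y) v) (at x) u)"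
  assume "\<not> ?thesis"
  then have ne: "dist (a x) (b x) / 2 > 0" by (simp add: a_def b_def)
  have "continuous_on S a" "continuous_on S b"
    unfolding a_def b_def
    by (intro smooth_on_imp_continuous_on smooth_on_frechet_derivative f)+
  then obtain d1 d2 where d1: "d1 > 0" "\<And>y. y \<in> S \<Longrightarrow> dist y x < d1 \<Longrightarrow> dist (a y) (a x) < dist (a x) (b x) / 2"
    and d2: "d2 > 0" "\<And>y. y \<in> S \<Longrightarrow> dist y x < d2 \<Longrightarrow> dist (b y) (b x) < dist (a x) (b x) / 2"
    using ne x unfolding continuous_on_iff by metis
  obtain d3 where d3: "d3 > 0" "ball x d3 \<subseteq> S" using S x openE by blast
  define \<delta> where "\<delta> = min d1 (min d2 d3)"
  have \<delta>: "\<delta> > 0" "ball x \<delta> \<subseteq> S" using d1 d2 d3 by (auto simp: \<delta>_def)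
  \<comment> \<open>The summand 1 keeps the denominator of h positive when u and v both
    vanish.\<close>
  define p where "p = norm u + norm v + 1"
  define h where "h = \<delta> / (2 * p)"
  have p: "p > 0" by (simp add: p_def add_nonneg_pos)
  then have h: "h > 0" using \<delta> by (simp add: h_def)
  have "h * (norm u + norm v) \<le> h * p" using h by (simp add: p_def)
  also have "\<dots> = \<delta> / 2" using p by (simp add: h_def)
  also have "\<dots> < \<delta>" using \<delta> by simp
  finally have hu: "h * (norm u + norm v) < \<delta>" .
  then have hv: "h * (norm v + norm u) < \<delta>" by (simp add: add.commute)
  obtain y where y: "y \<in> ball x \<delta>"
    "f (x + h *\<^sub>R u + h *\<^sub>R v) - f (x + h *\<^sub>R u) - f (x + h *\<^sub>R v) + f x = h^2 * a y"
    using second_difference_mean_value[OF f \<delta>(2) h hu] unfolding a_def by blast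
  obtain z where z: "z \<in> ball x \<delta>"
    "f (x + h *\<^sub>R v + h *\<^sub>R u) - f (x + h *\<^sub>R v) - f (x + h *\<^sub>R u) + f x = h^2 * b z"
    using second_difference_mean_value[OF f \<delta>(2) h hv] unfolding b_def by blast
  \<comment> \<open>Both are the same second difference. Since y and z are close to x, continuity
    puts a(y) and b(z) too near to a(x) and b(x) for them to coincide.\<close>
  have "h^2 * a y = h^2 * b z" using y(2) z(2) by (simp add: algebra_simps)
  then have eq: "a y = b z" using h by simp
  have "dist (a y) (a x) < dist (a x) (b x) / 2" "dist (b z) (b x) < dist (a x) (b x) / 2"
    using d1(2)[of y] d2(2)[of z] y(1) z(1) \<delta>(2) by (auto simp: \<delta>_def dist_commute)
  then show False unfolding eq
    using dist_triangle[of "a x" "b x" "b z"] by (simp add: dist_commute)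
qed

lemma second_derivative_symmetric:
  fixes f :: "'a::real_normed_vector \<Rightarrow> 'b::euclidean_space"
  assumes S: "open S" and f: "smooth_on f S" and x: "x \<in> S"
  shows "frechet_derivative (\<lambda>y. frechet_derivative f (at y) u) (at x) v
    = frechet_derivative (\<lambda>y. frechet_derivative f (at y) v) (at x) u"
proof (rule euclidean_eqI)
  fix b :: 'b assume b: "b \<in> Basis"
  have comp: "frechet_derivative (\<lambda>y. g y \<bullet> b) (at y) w = frechet_derivative g (at y) w \<bullet> b"
    if "smooth_on g S" "y \<in> S" for g :: "'a \<Rightarrow> 'b" and y w
    using frechet_derivative_at[OF has_derivative_inner_left[OF smooth_on_has_derivative[OF that], of b]]
    by metis
  have "frechet_derivative (\<lambda>y. frechet_derivative (\<lambda>y. f y \<bullet> b) (at y) u) (at x) v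
      = frechet_derivative (\<lambda>y. frechet_derivative f (at y) u) (at x) v \<bullet> b" for u v
    using frechet_derivative_cong[OF S x, of "\<lambda>y. frechet_derivative (\<lambda>y. f y \<bullet> b) (at y) u"
        "\<lambda>y. frechet_derivative f (at y) u \<bullet> b"] comp[OF f]
      comp[OF smooth_on_frechet_derivative[OF f] x] by metis
  moreover have "smooth_on (\<lambda>y. f y \<bullet> b) S" using S f by (intro smooth_on_inner smooth_on_const)
  ultimately show "frechet_derivative (\<lambda>y. frechet_derivative f (at y) u) (at x) v \<bullet> b
    = frechet_derivative (\<lambda>y. frechet_derivative f (at y) v) (at x) u \<bullet> b"
    using second_derivative_symmetric_real[OF S _ x] by metis
qed

section \<open>Exterior derivatives of exact forms and of pullbacks\<close>

lemma ext_deriv_exact: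
  fixes f :: "'a::real_normed_vector \<Rightarrow> real"
  assumes "open S" "smooth_on f S" "x \<in> S"
  shows "ext_deriv (\<lambda>y. frechet_derivative f (at y)) x u v = 0"
  using second_derivative_symmetric_real[OF assms] by (simp add: ext_deriv_def)

text \<open>Besides the pulled-back derivative of \<alpha>, differentiation produces \<alpha>
  applied to the second derivative of f. This is symmetric in u and v and drops out of the
  alternating difference.\<close>

lemma ext_deriv_pullback:
  fixes \<alpha> :: "'b::euclidean_space \<Rightarrow> 'b \<Rightarrow> real" and f :: "'a::real_normed_vector \<Rightarrow> 'b"
  assumes M: "open M" "x \<in> M" and N: "open N" "f ` M \<subseteq> N" and f: "smooth_on f M"
    and \<alpha>: "\<And>y. y \<in> N \<Longrightarrow> linear (\<alpha> y)" "\<And>b. smooth_on (\<lambda>y. \<alpha> y b) N"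
  shows "((\<lambda>y. \<alpha> (f y) (frechet_derivative f (at y) v)) has_derivative
      (\<lambda>u. frechet_derivative (\<lambda>y. \<alpha> y (frechet_derivative f (at x) v)) (at (f x)) (frechet_derivative f (at x) u)
        + \<alpha> (f x) (frechet_derivative (\<lambda>y. frechet_derivative f (at y) v) (at x) u))) (at x)"
    and "ext_deriv (\<lambda>y u. \<alpha> (f y) (frechet_derivative f (at y) u)) x u v
      = pullback2 f (ext_deriv \<alpha>) x u v"
proof -
  have fx: "f x \<in> N" using N M by auto
  have 1: "((\<lambda>y. \<alpha> (f y) (frechet_derivative f (at y) v)) has_derivative
      (\<lambda>u. frechet_derivative (\<lambda>y. \<alpha> y (frechet_derivative f (at x) v)) (at (f x)) (frechet_derivative f (at x) u)
        + \<alpha> (f x) (frechet_derivative (\<lambda>y. frechet_derivative f (at y) v) (at x) u))) (at x)" for v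
  proof -
    have "((\<lambda>y. (f y, frechet_derivative f (at y) v)) has_derivative
      (\<lambda>u. (frechet_derivative f (at x) u, frechet_derivative (\<lambda>y. frechet_derivative f (at y) v) (at x) u))) (at x)"
      by (intro has_derivative_Pair smooth_on_has_derivative[OF f]
          smooth_on_has_derivative[OF smooth_on_frechet_derivative[OF f]] M)
    from has_derivative_compose[OF this has_derivative_linear_family[OF N(1) \<alpha> fx]]
    show ?thesis by simp
  qed
  then show "((\<lambda>y. \<alpha> (f y) (frechet_derivative f (at y) v)) has_derivative
      (\<lambda>u. frechet_derivative (\<lambda>y. \<alpha> y (frechet_derivative f (at x) v)) (at (f x)) (frechet_derivative f (at x) u)
        + \<alpha> (f x) (frechet_derivative (\<lambda>y. frechet_derivative f (at y) v) (at x) u))) (at x)" .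
  show "ext_deriv (\<lambda>y u. \<alpha> (f y) (frechet_derivative f (at y) u)) x u v
      = pullback2 f (ext_deriv \<alpha>) x u v"
    unfolding ext_deriv_def pullback2_def frechet_derivative_at[OF 1, symmetric]
    using second_derivative_symmetric[OF M(1) f M(2), of u v] by simp
qed

text \<open>Smoothness is required on an open T around [0, 1] because \<open>smooth_on\<close> uses
  two-sided derivatives also in t. The first conclusion says that the differentiated integrand
  satisfies the same hypothesis again, so that differentiation under the integral can be
  iterated.\<close>

lemma
  fixes f :: "real \<Rightarrow> 'a::euclidean_space \<Rightarrow> real"
  assumes T: "open T" "{0..1} \<subseteq> T" and S: "open S" and f: "smooth_on (\<lambda>(t, x). f t x) (T \<times> S)"
  shows smooth_on_integral_param_aux:
      "\<And>v. smooth_on (\<lambda>(t, x). frechet_derivative (f t) (at x) v) (T \<times> S)"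
    and has_derivative_integral_param: "x \<in> S \<Longrightarrow>
      ((\<lambda>x. integral {0..1} (\<lambda>t. f t x)) has_derivative
        (\<lambda>v. integral {0..1} (\<lambda>t. frechet_derivative (f t) (at x) v))) (at x)"
proof -
  let ?f = "\<lambda>(t, x). f t x"
  have o: "open (T \<times> S)" using T S by (simp add: open_Times)
  have part: "(f t has_derivative (\<lambda>v. frechet_derivative ?f (at (t, x)) (0, v))) (at x)"
    if "t \<in> T" "x \<in> S" for t x
  proof -
    have h: "((\<lambda>x. (t, x)) has_derivative (\<lambda>v. (0, v))) (at x)" by (auto intro!: derivative_eq_intros)
    show ?thesis
      using has_derivative_compose[OF h smooth_on_has_derivative[OF f]] that by simp
  qed
  have partD: "frechet_derivative (f t) (at x) = (\<lambda>v. frechet_derivative ?f (at (t, x)) (0, v))"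
    if "t \<in> T" "x \<in> S" for t x
    using frechet_derivative_at[OF part[OF that]] by simp
  show sm: "smooth_on (\<lambda>(t, x). frechet_derivative (f t) (at x) v) (T \<times> S)" for v
    by (rule smooth_on_cong[OF smooth_on_frechet_derivative[OF f, of "(0, v)"] o]) (auto simp: partD)
  assume x: "x \<in> S"
  obtain r where r: "r > 0" "ball x r \<subseteq> S" using S x openE by blast
  \<comment> \<open>\<open>leibniz_rule\<close> integrates the derivative as an operator; evaluation
    at v is moved inside the integral afterwards.\<close>
  define F where "F = (\<lambda>x t. Blinfun (frechet_derivative (f t) (at x)))"
  have F: "blinfun_apply (F y t) = frechet_derivative (f t) (at y)" if "y \<in> S" "t \<in> T" for y t
    using has_derivative_bounded_linear[OF part[OF that(2,1)]] partD[OF that(2,1)]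
    by (simp add: F_def bounded_linear_Blinfun_apply)
  have cswap: "continuous_on (S \<times> {0..1}) (\<lambda>(y, t). g t y)"
    if "continuous_on (T \<times> S) (\<lambda>(t, y). g t y)" for g :: "real \<Rightarrow> 'a \<Rightarrow> real"
  proof -
    have "continuous_on (S \<times> {0..1}) (\<lambda>p. (\<lambda>(t, y). g t y) (snd p, fst p))"
      using T by (intro continuous_on_compose2[OF that]) (auto intro!: continuous_intros)
    then show ?thesis by (simp add: case_prod_beta')
  qed
  have cF: "continuous_on (S \<times> {0..1}) (\<lambda>(y, t). F y t)"
  proof (rule continuous_on_blinfun_componentwise)
    fix i :: 'a
    have "continuous_on (S \<times> {0..1}) (\<lambda>(y, t). frechet_derivative (f t) (at y) i)"
      by (intro cswap smooth_on_imp_continuous_on sm)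
    then show "continuous_on (S \<times> {0..1}) (\<lambda>p. blinfun_apply (case p of (y, t) \<Rightarrow> F y t) i)"
      by (rule continuous_on_eq) (use T F in auto)
  qed
  have slice: "continuous_on {0..1} (g y)" if "continuous_on (S \<times> {0..1}) (\<lambda>(y, t). g y t)" "y \<in> S"
    for g :: "'a \<Rightarrow> real \<Rightarrow> 'c::topological_space" and y
    using continuous_on_compose2[OF that(1) continuous_on_Pair[OF continuous_on_const continuous_on_id], of y "{0..1}"] that(2) by auto
  have L: "((\<lambda>x. integral (cbox 0 1) (\<lambda>t. f t x)) has_derivative blinfun_apply (integral (cbox 0 1) (F x)))
      (at x within ball x r)"
  proof (rule leibniz_rule)
    show "((\<lambda>x. f t x) has_derivative blinfun_apply (F y t)) (at y within ball x r)"
      if "y \<in> ball x r" "t \<in> cbox 0 1" for y t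
      using that r T part[of t y] F[of y t] partD[of t y]
      by (auto intro!: has_derivative_at_withinI simp: subset_iff)
    show "(\<lambda>t. f t y) integrable_on cbox 0 1" if "y \<in> ball x r" for y
      using slice[OF cswap[OF smooth_on_imp_continuous_on[OF f]], of y] that r
      by (auto simp: subset_iff intro!: integrable_continuous_real)
    show "continuous_on (ball x r \<times> cbox 0 1) (\<lambda>(x, t). F x t)"
      by (rule continuous_on_subset[OF cF]) (use r in auto)
  qed (use r in auto)
  have E: "blinfun_apply (integral (cbox 0 1) (F x))
      = (\<lambda>v. integral {0..1} (\<lambda>t. frechet_derivative (f t) (at x) v))"
  proof
    fix v
    have "F x integrable_on cbox 0 1"
      using slice[OF cF x] by (auto intro!: integrable_continuous_real)
    then have "blinfun_apply (integral (cbox 0 1) (F x)) v = integral {0..1} (\<lambda>t. blinfun_apply (F x t) v)"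
      by (simp add: blinfun_apply_integral)
    also have "\<dots> = integral {0..1} (\<lambda>t. frechet_derivative (f t) (at x) v)"
      by (rule integral_cong) (use F[OF x] T in auto)
    finally show "blinfun_apply (integral (cbox 0 1) (F x)) v
      = integral {0..1} (\<lambda>t. frechet_derivative (f t) (at x) v)" .
  qed
  have "((\<lambda>x. integral {0..1} (\<lambda>t. f t x)) has_derivative
      (\<lambda>v. integral {0..1} (\<lambda>t. frechet_derivative (f t) (at x) v))) (at x within ball x r)"
    using L unfolding E by simp
  then show "((\<lambda>x. integral {0..1} (\<lambda>t. f t x)) has_derivative
      (\<lambda>v. integral {0..1} (\<lambda>t. frechet_derivative (f t) (at x) v))) (at x)"
    using at_within_open[of x "ball x r"] r by simp
qed

lemma smooth_on_integral_param:
  fixes f :: "real \<Rightarrow> 'a::euclidean_space \<Rightarrow> real"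
  assumes T: "open T" "{0..1} \<subseteq> T" and S: "open S" and f: "smooth_on (\<lambda>(t, x). f t x) (T \<times> S)"
  shows "smooth_on (\<lambda>x. integral {0..1} (\<lambda>t. f t x)) S"
proof -
  have "Ck_on k (\<lambda>x. integral {0..1} (\<lambda>t. f t x)) S" for k
    using f
  proof (induction k arbitrary: f)
    case 0
    show ?case
      using has_derivative_continuous[OF has_derivative_integral_param[OF T S 0]]
      by (simp add: continuous_at_imp_continuous_on)
  next
    case (Suc k)
    show ?case
      by (rule Ck_on_SucI[OF S has_derivative_integral_param[OF T S Suc.prems]])
        (auto intro!: Suc.IH smooth_on_integral_param_aux[OF T S Suc.prems])
  qed
  then show ?thesis by (simp add: smooth_on_def)
qed

section \<open>Compositions with linear and bilinear families and with partial derivatives\<close>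

lemma smooth_on_linear_family_comp:
  fixes A :: "'p::euclidean_space \<Rightarrow> 'a::euclidean_space \<Rightarrow> 'b::real_normed_vector"
  assumes "open S" "\<And>x. x \<in> S \<Longrightarrow> linear (A x)" "\<And>b. smooth_on (\<lambda>x. A x b) S"
    and "open M" "smooth_on f M" "\<And>p. p \<in> M \<Longrightarrow> f p \<in> S" "smooth_on h M"
  shows "smooth_on (\<lambda>p. A (f p) (h p)) M"
  using smooth_on_compose[OF smooth_on_linear_family[of S A], of M "\<lambda>p. (f p, h p)"] assms
  by (auto intro: open_Times smooth_on_Pair)

text \<open>The result for linear families is used twice: once (x, u) is treated as the base point,
  what remains is a family linear in v.\<close>

lemma smooth_on_bilinear_family_comp:
  fixes A :: "'p::euclidean_space \<Rightarrow> 'a::euclidean_space \<Rightarrow> 'c::euclidean_space \<Rightarrow> 'b::real_normed_vector"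
  assumes S: "open S" and lin: "\<And>x v. x \<in> S \<Longrightarrow> linear (\<lambda>u. A x u v)" "\<And>x u. x \<in> S \<Longrightarrow> linear (A x u)"
    and sm: "\<And>u v. smooth_on (\<lambda>x. A x u v) S"
    and M: "open M" and f: "smooth_on f M" "\<And>p. p \<in> M \<Longrightarrow> f p \<in> S" and h: "smooth_on h M" "smooth_on k M"
  shows "smooth_on (\<lambda>p. A (f p) (h p) (k p)) M"
proof -
  have "smooth_on (\<lambda>p. A (fst p) (snd p) v) (S \<times> UNIV)" for v
    using smooth_on_linear_family[OF S, of "\<lambda>x u. A x u v"] lin sm by (simp add: case_prod_beta')
  from smooth_on_linear_family_comp[of "S \<times> UNIV" "\<lambda>p. A (fst p) (snd p)", OF open_Times[OF S open_UNIV] _ this M smooth_on_Pair[OF M f(1) h(1)] _ h(2)]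
  show ?thesis using f lin by auto
qed

lemma inner_representation_functional:
  fixes f :: "'a::euclidean_space \<Rightarrow> real"
  assumes "linear f" shows "(\<Sum>b\<in>Basis. f b *\<^sub>R b) \<bullet> w = f w"
proof -
  have "(\<Sum>b\<in>Basis. f b *\<^sub>R b) \<bullet> w = (\<Sum>b\<in>Basis. (w \<bullet> b) *\<^sub>R f b)"
    by (auto simp: inner_sum_left inner_commute[of w] intro!: sum.cong)
  then show ?thesis by (simp only: linear_basis_expansion[OF assms, symmetric])
qed

lemma has_derivative_partial:
  fixes F :: "'p::real_normed_vector \<Rightarrow> 'q::real_normed_vector \<Rightarrow> 'b::real_normed_vector"
  assumes "smooth_on (\<lambda>(x, z). F x z) (S \<times> UNIV)" "x \<in> S"
  shows "((\<lambda>y. F y z) has_derivative (\<lambda>a. frechet_derivative (\<lambda>(x, z). F x z) (at (x, z)) (a, 0))) (at x)"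
proof -
  have h: "((\<lambda>y. (y, z)) has_derivative (\<lambda>a. (a, 0))) (at x)" by (auto intro!: derivative_eq_intros)
  have "((\<lambda>(x, z). F x z) has_derivative frechet_derivative (\<lambda>(x, z). F x z) (at (x, z))) (at (x, z))"
    using assms by (intro smooth_on_has_derivative) auto
  from has_derivative_compose[OF h this] show ?thesis by simp
qed

lemma frechet_derivative_partial:
  fixes F :: "'p::real_normed_vector \<Rightarrow> 'q::real_normed_vector \<Rightarrow> 'b::real_normed_vector"
  assumes "smooth_on (\<lambda>(x, z). F x z) (S \<times> UNIV)" "x \<in> S"
  shows "frechet_derivative (\<lambda>y. F y z) (at x) a = frechet_derivative (\<lambda>(x, z). F x z) (at (x, z)) (a, 0)"
  using frechet_derivative_at[OF has_derivative_partial[OF assms]] by metis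

lemma smooth_on_derivative_comp:
  fixes F :: "'p::euclidean_space \<Rightarrow> 'b::real_normed_vector"
  assumes "open S" "smooth_on F S" "open M" "smooth_on f M" "\<And>p. p \<in> M \<Longrightarrow> f p \<in> S" "smooth_on k M"
  shows "smooth_on (\<lambda>p. frechet_derivative F (at (f p)) (k p)) M"
  by (rule smooth_on_linear_family_comp[OF assms(1) _ smooth_on_frechet_derivative[OF assms(2)]])
    (use assms smooth_on_linear_derivative in auto)

lemma smooth_on_partial_comp:
  fixes F :: "'p::euclidean_space \<Rightarrow> 'q::euclidean_space \<Rightarrow> 'b::real_normed_vector"
  assumes S: "open S" and F: "smooth_on (\<lambda>(x, z). F x z) (S \<times> UNIV)"
    and M: "open M" and f: "smooth_on f M" "\<And>p. p \<in> M \<Longrightarrow> f p \<in> S" and h: "smooth_on h M" "smooth_on k M"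
  shows "smooth_on (\<lambda>p. frechet_derivative (\<lambda>y. F y (h p)) (at (f p)) (k p)) M"
proof (rule smooth_on_cong[OF _ M])
  show "smooth_on (\<lambda>p. frechet_derivative (\<lambda>(x, z). F x z) (at (f p, h p)) (k p, 0)) M"
    using S M f h
    by (intro smooth_on_derivative_comp[OF _ F] smooth_on_Pair smooth_on_const open_Times) auto
qed (simp add: frechet_derivative_partial[OF F f(2)])

lemma linear_derivative_family:
  fixes A :: "'p::real_normed_vector \<Rightarrow> 'a::real_vector \<Rightarrow> 'b::real_normed_vector"
  assumes S: "open S" "x \<in> S" and A: "\<And>x. x \<in> S \<Longrightarrow> linear (A x)" "\<And>b. smooth_on (\<lambda>x. A x b) S"
  shows "linear (\<lambda>v. frechet_derivative (\<lambda>y. A y v) (at x) a)"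
proof (rule linearI)
  fix u v :: 'a and r :: real
  have "frechet_derivative (\<lambda>y. A y (u + v)) (at x) = frechet_derivative (\<lambda>y. A y u + A y v) (at x)"
    using A by (intro frechet_derivative_cong[OF S]) (auto simp: linear_add)
  also have "\<dots> = (\<lambda>a. frechet_derivative (\<lambda>y. A y u) (at x) a + frechet_derivative (\<lambda>y. A y v) (at x) a)"
    using frechet_derivative_at[OF has_derivative_add[OF smooth_on_has_derivative[OF A(2)] smooth_on_has_derivative[OF A(2)]]] S
    by metis
  finally show "frechet_derivative (\<lambda>y. A y (u + v)) (at x) a =
    frechet_derivative (\<lambda>y. A y u) (at x) a + frechet_derivative (\<lambda>y. A y v) (at x) a" by simp
  have "frechet_derivative (\<lambda>y. A y (r *\<^sub>R v)) (at x) = frechet_derivative (\<lambda>y. r *\<^sub>R A y v) (at x)"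
    using A by (intro frechet_derivative_cong[OF S]) (auto simp: linear_cmul)
  also have "\<dots> = (\<lambda>a. r *\<^sub>R frechet_derivative (\<lambda>y. A y v) (at x) a)"
    using frechet_derivative_at[OF has_derivative_scaleR_right[OF smooth_on_has_derivative[OF A(2)]]] S
    by metis
  finally show "frechet_derivative (\<lambda>y. A y (r *\<^sub>R v)) (at x) a = r *\<^sub>R frechet_derivative (\<lambda>y. A y v) (at x) a"
    by simp
qed

subsection \<open>Almost Kaehler geometry\<close>

locale almost_kaehler =
  fixes Q :: "'a::euclidean_space set"
    and \<theta> :: "'a \<Rightarrow> 'a \<Rightarrow> real"
    and J :: "'a \<Rightarrow> 'a \<Rightarrow> 'a"
    and H :: "'a \<Rightarrow> real"
  assumes open_Q: "open Q"
    and exact_symplectic: "exact_symplectic_on Q \<theta>"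
    and almost_complex: "almost_complex_on Q J"
    and compatible: "compatible_on Q \<theta> J"
    and smooth_H: "smooth_on H Q"
begin

abbreviation (input) "\<omega> \<equiv> omega \<theta>"
abbreviation (input) "g \<equiv> metric \<theta> J"
abbreviation (input) "X \<equiv> hamiltonian_vf \<theta> J H"

definition "d\<theta> x a v = frechet_derivative (\<lambda>y. \<theta> y v) (at x) a"
definition "d\<omega> x a u v = frechet_derivative (\<lambda>y. \<omega> y u v) (at x) a"

lemma linear_\<theta>: "x \<in> Q \<Longrightarrow> linear (\<theta> x)"
  and smooth_\<theta>: "smooth_on (\<lambda>x. \<theta> x v) Q"
  using exact_symplectic by (auto simp: exact_symplectic_on_def smooth_1form_on_def)

lemma linear_J: "x \<in> Q \<Longrightarrow> linear (J x)"
  and smooth_J: "smooth_on (\<lambda>x. J x v) Q"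
  and J_J [simp]: "x \<in> Q \<Longrightarrow> J x (J x v) = - v"
  using almost_complex by (auto simp: almost_complex_on_def)

lemma linear_d\<theta>:
  assumes "x \<in> Q" shows "linear (\<lambda>a. d\<theta> x a v)" "linear (d\<theta> x a)"
  unfolding d\<theta>_def
  using smooth_on_linear_derivative[OF smooth_\<theta> assms] linear_derivative_family[OF open_Q assms linear_\<theta> smooth_\<theta>]
  by auto

lemma smooth_d\<theta>: "smooth_on (\<lambda>x. d\<theta> x a v) Q"
  unfolding d\<theta>_def by (intro smooth_on_frechet_derivative smooth_\<theta>)

lemma omega_eq: "\<omega> x u v = d\<theta> x v u - d\<theta> x u v"
  by (simp add: omega_def ext_deriv_def d\<theta>_def)

lemma linear_\<omega>:
  assumes "x \<in> Q" shows "linear (\<lambda>u. \<omega> x u v)" "linear (\<omega> x u)"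
  using linear_d\<theta>[OF assms] unfolding omega_eq
  by (auto intro!: linear_compose_sub)

lemma omega_self [simp]: "\<omega> x u u = 0"
  by (simp add: omega_eq)

lemma omega_minus: "\<omega> x u v = - \<omega> x v u"
  by (simp add: omega_eq)

lemma smooth_\<omega>: "smooth_on (\<lambda>x. \<omega> x u v) Q"
  unfolding omega_eq by (intro smooth_on_diff open_Q smooth_d\<theta>)

lemmas smooth_\<theta>_comp = smooth_on_linear_family_comp[OF open_Q linear_\<theta> smooth_\<theta>]
lemmas smooth_J_comp = smooth_on_linear_family_comp[OF open_Q linear_J smooth_J]
lemmas smooth_\<omega>_comp = smooth_on_bilinear_family_comp[OF open_Q linear_\<omega> smooth_\<omega>]

lemma linear_metric:
  assumes "x \<in> Q" shows "linear (\<lambda>u. g x u v)" "linear (g x u)"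
proof -
  show "linear (\<lambda>u. g x u v)" using linear_\<omega>[OF assms] by (simp add: metric_def)
  show "linear (g x u)"
    using linear_compose[OF linear_J[OF assms] linear_\<omega>(2)[OF assms, of u]] by (simp add: metric_def[abs_def] o_def)
qed

lemma smooth_metric: "smooth_on (\<lambda>x. g x u v) Q"
  unfolding metric_def by (intro smooth_\<omega>_comp smooth_J open_Q smooth_on_const smooth_on_id)

lemmas smooth_metric_comp = smooth_on_bilinear_family_comp[OF open_Q linear_metric smooth_metric]

lemma omega_J: "x \<in> Q \<Longrightarrow> \<omega> x (J x u) (J x v) = \<omega> x u v"
  and metric_pos: "x \<in> Q \<Longrightarrow> v \<noteq> 0 \<Longrightarrow> g x v v > 0"
  using compatible by (auto simp: compatible_on_def metric_def)

lemma metric_J: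
  assumes x: "x \<in> Q" shows "g x (J x u) v = \<omega> x u v"
  by (simp add: metric_def omega_J[OF x])

lemma metric_sym:
  assumes x: "x \<in> Q" shows "g x u v = g x v u"
proof -
  have "g x u v = \<omega> x (J x u) (J x (J x v))" by (simp add: metric_def omega_J[OF x])
  also have "\<dots> = - \<omega> x (J x u) v" using x by (simp add: linear_neg[OF linear_\<omega>(2)[OF x]])
  also have "\<dots> = g x v u" by (simp add: metric_def omega_minus[of x v])
  finally show ?thesis .
qed

lemma metric_nondeg:
  assumes x: "x \<in> Q" and "\<And>w. g x u w = g x v w" shows "u = v"
proof -
  have "g x (u - v) (u - v) = 0" using assms by (simp add: linear_diff[OF linear_metric(1)[OF x]])
  then show ?thesis using metric_pos[OF x, of "u - v"] by auto
qed

text \<open>Covectors are represented by vectors through the Euclidean inner product. Lowering and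
  raising an index thus become endomorphisms of \<open>'a\<close>, and
  \<open>smooth_on_inverse_linear_family\<close> gives the smoothness of
  \<open>sharp\<close>.\<close>

definition "flat x u = (\<Sum>b\<in>Basis. g x u b *\<^sub>R b)"
definition "sharp x p = inv (flat x) p"

lemma flat_inner:
  assumes x: "x \<in> Q" shows "flat x u \<bullet> w = g x u w"
  unfolding flat_def by (rule inner_representation_functional[OF linear_metric(2)[OF x]])

lemma linear_flat:
  assumes x: "x \<in> Q" shows "linear (flat x)"
proof (rule linearI)
  show "flat x (u + v) = flat x u + flat x v" for u v
    by (simp add: flat_def linear_add[OF linear_metric(1)[OF x]] scaleR_add_left sum.distrib)
  show "flat x (r *\<^sub>R u) = r *\<^sub>R flat x u" for r u
    by (simp add: flat_def linear_cmul[OF linear_metric(1)[OF x]] scaleR_sum_right)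
qed

lemma inj_flat: "x \<in> Q \<Longrightarrow> inj (flat x)"
  by (metis flat_inner injI metric_nondeg)

lemma flat_sharp: "x \<in> Q \<Longrightarrow> flat x (sharp x p) = p"
  using linear_injective_imp_surjective[OF linear_flat inj_flat] by (simp add: sharp_def surj_f_inv_f)

lemma sharp_flat: "x \<in> Q \<Longrightarrow> sharp x (flat x u) = u"
  using inj_flat by (simp add: sharp_def)

lemma metric_sharp: "x \<in> Q \<Longrightarrow> g x (sharp x p) w = p \<bullet> w"
  by (metis flat_inner flat_sharp)

lemma linear_sharp:
  assumes x: "x \<in> Q" shows "linear (sharp x)"
proof (rule linearI)
  show "sharp x (u + v) = sharp x u + sharp x v" for u v
    using flat_sharp[OF x] sharp_flat[OF x] linear_add[OF linear_flat[OF x]] by metis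
  show "sharp x (r *\<^sub>R u) = r *\<^sub>R sharp x u" for r u
    using flat_sharp[OF x] sharp_flat[OF x] linear_cmul[OF linear_flat[OF x]] by metis
qed

lemma smooth_sharp: "smooth_on (\<lambda>x. sharp x p) Q"
proof (rule smooth_on_inverse_linear_family[OF open_Q linear_flat _ flat_sharp sharp_flat])
  show "smooth_on (\<lambda>x. flat x b) Q" for b
    unfolding flat_def by (intro smooth_on_sum smooth_on_scaleR smooth_metric smooth_on_const open_Q)
qed

lemmas smooth_sharp_comp = smooth_on_linear_family_comp[OF open_Q linear_sharp smooth_sharp]

section \<open>Gradient and Hamiltonian vector field\<close>

lemma gradient_eq:
  assumes x: "x \<in> Q"
  shows "gradient \<theta> J H x = sharp x (\<Sum>b\<in>Basis. frechet_derivative H (at x) b *\<^sub>R b)"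
proof -
  let ?G = "sharp x (\<Sum>b\<in>Basis. frechet_derivative H (at x) b *\<^sub>R b)"
  have l: "linear (frechet_derivative H (at x))" by (rule smooth_on_linear_derivative[OF smooth_H x])
  have "g x ?G w = frechet_derivative H (at x) w" for w
    by (simp only: metric_sharp[OF x] inner_representation_functional[OF l])
  then show ?thesis unfolding gradient_def
    by (intro the_equality) (auto intro: metric_nondeg[OF x])
qed

lemma metric_gradient:
  assumes x: "x \<in> Q" shows "g x (gradient \<theta> J H x) w = frechet_derivative H (at x) w"
  by (simp only: gradient_eq[OF x] metric_sharp[OF x]
      inner_representation_functional[OF smooth_on_linear_derivative[OF smooth_H x]])

text \<open>J X is the gradient because J squares to -1, and g(J u, w) = \<omega>(u, w) by
  invariance of \<omega>. This is the identity behind the cancellation at order h.\<close>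

lemma omega_X:
  assumes x: "x \<in> Q" shows "\<omega> x (X x) w = frechet_derivative H (at x) w"
  using metric_gradient[OF x, of w]
  by (simp add: hamiltonian_vf_def metric_J[OF x, symmetric] x linear_neg[OF linear_J[OF x]])

lemma smooth_X: "smooth_on X Q"
proof (rule smooth_on_cong[OF _ open_Q])
  show "smooth_on (\<lambda>x. - J x (sharp x (\<Sum>b\<in>Basis. frechet_derivative H (at x) b *\<^sub>R b))) Q"
    by (intro smooth_on_minus smooth_J_comp smooth_sharp_comp smooth_on_sum smooth_on_scaleR smooth_on_const
        smooth_on_frechet_derivative smooth_H smooth_on_id open_Q) auto
qed (simp add: hamiltonian_vf_def gradient_eq)

lemmas smooth_X_comp = smooth_on_compose[OF smooth_X open_Q]

section \<open>Coordinate-free form of \<Sigma>\<close>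

lemma linear_d\<omega>:
  assumes "x \<in> Q"
  shows "linear (\<lambda>a. d\<omega> x a u v)" "linear (\<lambda>u. d\<omega> x a u v)" "linear (d\<omega> x a u)"
  unfolding d\<omega>_def
  using smooth_on_linear_derivative[OF smooth_\<omega> assms]
    linear_derivative_family[OF open_Q assms linear_\<omega>(1) smooth_\<omega>]
    linear_derivative_family[OF open_Q assms linear_\<omega>(2) smooth_\<omega>]
  by auto

lemma smooth_d\<omega>_comp:
  fixes M :: "'m::euclidean_space set"
  assumes "open M" "smooth_on f M" "\<And>p. p \<in> M \<Longrightarrow> f p \<in> Q" "smooth_on a M" "smooth_on u M" "smooth_on v M"
  shows "smooth_on (\<lambda>p. d\<omega> (f p) (a p) (u p) (v p)) M"
proof -
  have "smooth_on (\<lambda>(x, z). \<omega> x (fst z) (snd z)) (Q \<times> UNIV)"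
    unfolding case_prod_beta'
    by (intro smooth_\<omega>_comp smooth_on_fst smooth_on_snd smooth_on_id open_Times open_Q open_UNIV) auto
  from smooth_on_partial_comp[OF open_Q this assms(1-3), of "\<lambda>p. (u p, v p)" a] show ?thesis
    using assms by (simp add: d\<omega>_def smooth_on_Pair)
qed

lemma d\<omega>_basis_expansion:
  assumes x: "x \<in> Q"
  shows "(\<Sum>k\<in>Basis. \<Sum>j\<in>Basis. \<Sum>l\<in>Basis.
      frechet_derivative (\<lambda>y. \<omega> y j l) (at x) k * (a \<bullet> k) * (u \<bullet> j) * (v \<bullet> l)) = d\<omega> x a u v"
proof -
  have "d\<omega> x a u v = (\<Sum>k\<in>Basis. (a \<bullet> k) *\<^sub>R d\<omega> x k u v)"
    by (rule linear_basis_expansion[OF linear_d\<omega>(1)[OF x]])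
  also have "\<dots> = (\<Sum>k\<in>Basis. (a \<bullet> k) *\<^sub>R (\<Sum>j\<in>Basis. (u \<bullet> j) *\<^sub>R d\<omega> x k j v))"
    by (subst linear_basis_expansion[OF linear_d\<omega>(2)[OF x]]) simp
  also have "\<dots> = (\<Sum>k\<in>Basis. (a \<bullet> k) *\<^sub>R (\<Sum>j\<in>Basis. (u \<bullet> j) *\<^sub>R (\<Sum>l\<in>Basis. (v \<bullet> l) *\<^sub>R d\<omega> x k j l)))"
    by (subst linear_basis_expansion[OF linear_d\<omega>(3)[OF x]]) simp
  finally show ?thesis
    by (simp add: d\<omega>_def sum_distrib_left mult_ac)
qed

text \<open>The part of \<Sigma> that is h^2 times a covector applied to \<xi>. Its second term is
  the counterpart of \<open>K_zero\<close>.\<close>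

definition "T x \<xi> = g x (X x) \<xi> - 1/12 * d\<omega> x (X x) (X x) \<xi>"

lemma linear_T: 
  assumes "x \<in> Q" shows "linear (T x)"
  by (rule linearI) (simp_all add: T_def linear_add[OF linear_metric(2)[OF assms]] linear_cmul[OF linear_metric(2)[OF assms]]
      linear_add[OF linear_d\<omega>(3)[OF assms]] linear_cmul[OF linear_d\<omega>(3)[OF assms]] algebra_simps)

lemma smooth_T_comp:
  fixes M :: "'m::euclidean_space set"
  assumes "open M" "smooth_on f M" "\<And>p. p \<in> M \<Longrightarrow> f p \<in> Q" "smooth_on h M"
  shows "smooth_on (\<lambda>p. T (f p) (h p)) M"
  unfolding T_def using assms
  by (intro smooth_on_diff smooth_on_mult smooth_on_const smooth_metric_comp smooth_d\<omega>_comp smooth_X_comp)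

lemma Sigma_fun_eq:
  assumes x: "x \<in> Q"
  shows "Sigma_fun \<theta> J H \<theta>\<^sub>0 hbar x \<xi> = - hbar * H x + hbar^2 * T x \<xi>
    - 1/4 * (sin \<theta>\<^sub>0 / (1 - cos \<theta>\<^sub>0)) * g x (\<xi> - hbar *\<^sub>R X x) (\<xi> - hbar *\<^sub>R X x)"
  unfolding Sigma_fun_def Let_def d\<omega>_basis_expansion[OF x] T_def
  by (simp add: algebra_simps)

end

subsection \<open>The derivative of the generating function\<close>

lemmas smooth_on_intros = smooth_on_add smooth_on_diff smooth_on_minus smooth_on_scaleR smooth_on_mult
  smooth_on_fst smooth_on_snd smooth_on_Pair smooth_on_const smooth_on_id smooth_on_power smooth_on_sum
  smooth_on_inner

lemma linear_integral_family:
  fixes f :: "real \<Rightarrow> 'v::real_vector \<Rightarrow> real"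
  assumes lin: "\<And>t. t \<in> {0..1} \<Longrightarrow> linear (f t)" and cont: "\<And>v. continuous_on {0..1} (\<lambda>t. f t v)"
  shows "linear (\<lambda>v. integral {0..1} (\<lambda>t. f t v))"
proof (rule linearI)
  fix u v and r :: real
  have "integral {0..1} (\<lambda>t. f t (u + v)) = integral {0..1} (\<lambda>t. f t u + f t v)"
    using lin by (intro integral_cong) (simp add: linear_add)
  also have "\<dots> = integral {0..1} (\<lambda>t. f t u) + integral {0..1} (\<lambda>t. f t v)"
    by (intro integral_add integrable_continuous_real cont)
  finally show "integral {0..1} (\<lambda>t. f t (u + v)) = integral {0..1} (\<lambda>t. f t u) + integral {0..1} (\<lambda>t. f t v)" .
  have "integral {0..1} (\<lambda>t. f t (r *\<^sub>R v)) = integral {0..1} (\<lambda>t. r * f t v)"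
    using lin by (intro integral_cong) (simp add: linear_cmul)
  then show "integral {0..1} (\<lambda>t. f t (r *\<^sub>R v)) = r *\<^sub>R integral {0..1} (\<lambda>t. f t v)"
    by simp
qed

lemma fundamental_theorem_unit_interval:
  fixes f :: "real \<Rightarrow> real"
  assumes "\<And>t. t \<in> {0..1} \<Longrightarrow> (f has_real_derivative f' t) (at t)"
  shows "(f' has_integral (f 1 - f 0)) {0..1}"
  using assms
  by (intro fundamental_theorem_of_calculus)
    (auto simp: has_real_derivative_iff_has_vector_derivative[symmetric] intro: has_field_derivative_at_within)

context almost_kaehler
begin

text \<open>The pair stands for the segment with midpoint m and displacement \<xi>. The segment
  reaches only half of \<xi> from m, but a ball containing all of \<xi> is demanded: points with
  parameter slightly outside [0, 1] then still lie in Q, which leaves an open parameter interval for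
  differentiation under the integral.\<close>

definition "mid_dom = {(m, \<xi> :: 'a). \<exists>r. norm \<xi> < r \<and> ball m r \<subseteq> Q}"

lemma mid_domI: "norm \<xi> < r \<Longrightarrow> ball m r \<subseteq> Q \<Longrightarrow> (m, \<xi>) \<in> mid_dom"
  by (auto simp: mid_dom_def)

lemma open_mid_dom: "open mid_dom"
  unfolding open_dist
proof
  fix z assume "z \<in> mid_dom"
  then obtain m \<xi> r where z: "z = (m, \<xi>)" "norm \<xi> < r" "ball m r \<subseteq> Q" by (auto simp: mid_dom_def)
  \<comment> \<open>A perturbation by s lengthens \<xi> by less than s and shrinks the admissible
    radius by s; halving the gap balances the two.\<close>
  define s where "s = (r - norm \<xi>) / 2"
  have s: "s > 0" "norm \<xi> = r - 2 * s" using z by (auto simp: s_def field_simps)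
  have "z' \<in> mid_dom" if d: "dist z' z < s" for z'
  proof -
    obtain m' \<xi>' where z': "z' = (m', \<xi>')" by (cases z')
    have 1: "dist m' m < s" using d dist_fst_le[of z' z] by (simp add: z z')
    have 2: "norm (\<xi>' - \<xi>) < s" using d dist_snd_le[of z' z] by (simp add: z z' dist_norm)
    have "norm \<xi>' < r - s" using norm_triangle_ineq[of \<xi> "\<xi>' - \<xi>"] 2 s by simp
    moreover have "ball m' (r - s) \<subseteq> Q"
    proof
      fix y assume "y \<in> ball m' (r - s)"
      then have "dist m y < r" using 1 dist_triangle[of m y m'] by (simp add: dist_commute)
      then show "y \<in> Q" using z by auto
    qed
    ultimately show ?thesis unfolding z' by (rule mid_domI)
  qed
  then show "\<exists>e>0. \<forall>y. dist y z < e \<longrightarrow> y \<in> mid_dom" using s by blast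
qed

lemma mid_domD:
  assumes "(m, \<xi>) \<in> mid_dom" "\<bar>s\<bar> \<le> 1" shows "m + s *\<^sub>R \<xi> \<in> Q"
proof -
  obtain r where r: "norm \<xi> < r" "ball m r \<subseteq> Q" using assms by (auto simp: mid_dom_def)
  have "norm (s *\<^sub>R \<xi>) \<le> norm \<xi>" using assms mult_right_mono[of "\<bar>s\<bar>" 1 "norm \<xi>"] by simp
  then show ?thesis using r by (auto simp: dist_norm subset_iff)
qed

lemma mid_dom_base: "(m, \<xi>) \<in> mid_dom \<Longrightarrow> m \<in> Q"
  using mid_domD[of m \<xi> 0] by simp

lemma mid_dom_zero: "m \<in> Q \<Longrightarrow> (m, 0) \<in> mid_dom"
  using openE[OF open_Q, of m] by (metis mid_domI norm_zero)

lemma mid_dom_segment: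
  assumes "((1/2) *\<^sub>R (q + q'), q' - q) \<in> mid_dom" "\<bar>t - 1/2\<bar> \<le> 1"
  shows "q + t *\<^sub>R (q' - q) \<in> Q"
proof -
  have "q + t *\<^sub>R (q' - q) = (1/2) *\<^sub>R (q + q') + (t - 1/2) *\<^sub>R (q' - q)"
    by (simp add: algebra_simps flip: scaleR_add_left)
  then show ?thesis using mid_domD[OF assms] by simp
qed

definition "pair_dom = {(q, q'). ((1/2) *\<^sub>R (q + q'), q' - q) \<in> mid_dom}"

lemma open_pair_dom: "open pair_dom"
proof -
  have "open ((\<lambda>z. ((1/2) *\<^sub>R (fst z + snd z), snd z - fst z)) -` mid_dom)"
    by (intro open_vimage open_mid_dom continuous_intros)
  then show ?thesis by (simp add: pair_dom_def vimage_def case_prod_beta')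
qed

section \<open>First variation of the line integral of \<theta>\<close>

lemma smooth_line_integrand:
  "smooth_on (\<lambda>(t, z). \<theta> (fst z + t *\<^sub>R (snd z - fst z)) (snd z - fst z)) ({-1/4<..<5/4} \<times> pair_dom)"
proof -
  have o: "open ({-1/4<..<5/4::real} \<times> pair_dom)" by (intro open_Times open_pair_dom) auto
  have "fst (snd p) + fst p *\<^sub>R (snd (snd p) - fst (snd p)) \<in> Q" if "p \<in> {-1/4<..<5/4} \<times> pair_dom" for p
    using that by (intro mid_dom_segment) (auto simp: pair_dom_def)
  then show ?thesis unfolding case_prod_beta'
    by (intro smooth_\<theta>_comp smooth_on_intros o) auto
qed

definition "line_integral z = integral {0..1} (\<lambda>t. \<theta> (fst z + t *\<^sub>R (snd z - fst z)) (snd z - fst z))"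

lemma smooth_line_integral: "smooth_on line_integral pair_dom"
  unfolding line_integral_def[abs_def]
  by (rule smooth_on_integral_param[OF _ _ open_pair_dom smooth_line_integrand]) auto

text \<open>First variation formula. Exchanging the two arguments in the derivative of \<theta>
  costs a term \<omega>(q' - q, variation). What is left is the t-derivative of \<theta> evaluated
  on the interpolated variation, and integrates to the boundary terms.\<close>

lemma has_derivative_line_integral:
  assumes z: "(q, q') \<in> pair_dom"
  shows "(line_integral has_derivative (\<lambda>d. \<theta> q' (snd d) - \<theta> q (fst d) +
    integral {0..1} (\<lambda>t. \<omega> (q + t *\<^sub>R (q' - q)) (q' - q) (fst d + t *\<^sub>R (snd d - fst d))))) (at (q, q'))"
proof -
  let ?f = "\<lambda>t z. \<theta> (fst z + t *\<^sub>R (snd z - fst z)) (snd z - fst z)"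
  let ?T = "{-1/4<..<5/4} :: real set"
  let ?x = "\<lambda>t. q + t *\<^sub>R (q' - q)"
  have xQ: "?x t \<in> Q" if "t \<in> ?T" for t
    using that z by (intro mid_dom_segment) (auto simp: pair_dom_def)
  have lin: "((\<lambda>(x, v). \<theta> x v) has_derivative (\<lambda>(dx, dv). d\<theta> x dx v + \<theta> x dv)) (at (x, v))"
    if "x \<in> Q" for x v
    unfolding d\<theta>_def using has_derivative_linear_family[OF open_Q linear_\<theta> smooth_\<theta> that] .
  have fd: "frechet_derivative (?f t) (at (q, q')) d
      = \<omega> (?x t) (q' - q) (fst d + t *\<^sub>R (snd d - fst d))
        + (d\<theta> (?x t) (q' - q) (fst d + t *\<^sub>R (snd d - fst d)) + \<theta> (?x t) (snd d - fst d))"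
    if t: "t \<in> ?T" for t d
  proof -
    have 1: "((\<lambda>z. (fst z + t *\<^sub>R (snd z - fst z), snd z - fst z)) has_derivative
      (\<lambda>d. (fst d + t *\<^sub>R (snd d - fst d), snd d - fst d))) (at (q, q'))"
      by (auto intro!: derivative_eq_intros)
    have "(?f t has_derivative (\<lambda>d. d\<theta> (?x t) (fst d + t *\<^sub>R (snd d - fst d)) (q' - q) + \<theta> (?x t) (snd d - fst d)))
        (at (q, q'))"
    proof -
      have "((\<lambda>(x, v). \<theta> x v) has_derivative (\<lambda>(dx, dv). d\<theta> (?x t) dx (q' - q) + \<theta> (?x t) dv))
        (at (fst (q, q') + t *\<^sub>R (snd (q, q') - fst (q, q')), snd (q, q') - fst (q, q')))"
        using lin[OF xQ[OF t]] by simp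
      from has_derivative_compose[OF 1 this] show ?thesis by simp
    qed
    from frechet_derivative_at[OF this] show ?thesis by (metis (no_types, lifting) add.assoc diff_add_cancel omega_eq)
  qed
  have int: "((\<lambda>t. d\<theta> (?x t) (q' - q) (fst d + t *\<^sub>R (snd d - fst d)) + \<theta> (?x t) (snd d - fst d))
      has_integral (\<theta> q' (snd d) - \<theta> q (fst d))) {0..1}" for d
  proof -
    have "((\<lambda>t. \<theta> (?x t) (fst d + t *\<^sub>R (snd d - fst d))) has_real_derivative
      d\<theta> (?x t) (q' - q) (fst d + t *\<^sub>R (snd d - fst d)) + \<theta> (?x t) (snd d - fst d)) (at t)"
      if t: "t \<in> {0..1}" for t
    proof -
      have 1: "((\<lambda>t. (?x t, fst d + t *\<^sub>R (snd d - fst d))) has_derivative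
        (\<lambda>h. (h *\<^sub>R (q' - q), h *\<^sub>R (snd d - fst d)))) (at t)"
        by (auto intro!: derivative_eq_intros)
      have x: "?x t \<in> Q" using xQ t by auto
      have "((\<lambda>t. \<theta> (?x t) (fst d + t *\<^sub>R (snd d - fst d))) has_derivative
        (\<lambda>h. d\<theta> (?x t) (h *\<^sub>R (q' - q)) (fst d + t *\<^sub>R (snd d - fst d)) + \<theta> (?x t) (h *\<^sub>R (snd d - fst d)))) (at t)"
        using has_derivative_compose[OF 1 lin[OF x]] by simp
      moreover have "(\<lambda>h. d\<theta> (?x t) (h *\<^sub>R (q' - q)) (fst d + t *\<^sub>R (snd d - fst d)) + \<theta> (?x t) (h *\<^sub>R (snd d - fst d)))
        = (*) (d\<theta> (?x t) (q' - q) (fst d + t *\<^sub>R (snd d - fst d)) + \<theta> (?x t) (snd d - fst d))"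
        by (simp add: fun_eq_iff linear_cmul[OF linear_d\<theta>(1)[OF x]] linear_cmul[OF linear_\<theta>[OF x]] distrib_left mult.commute)
      ultimately show ?thesis by (simp add: has_field_derivative_def)
    qed
    from fundamental_theorem_unit_interval[OF this] show ?thesis by simp
  qed
  have om: "(\<lambda>t. \<omega> (?x t) (q' - q) (fst d + t *\<^sub>R (snd d - fst d))) integrable_on {0..1}" for d
  proof (intro integrable_continuous_real continuous_on_subset[OF smooth_on_imp_continuous_on])
    show "smooth_on (\<lambda>t. \<omega> (?x t) (q' - q) (fst d + t *\<^sub>R (snd d - fst d))) ?T"
      using xQ by (intro smooth_\<omega>_comp smooth_on_intros) auto
  qed auto
  have "integral {0..1} (\<lambda>t. frechet_derivative (?f t) (at (q, q')) d) =
    \<theta> q' (snd d) - \<theta> q (fst d) +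
    integral {0..1} (\<lambda>t. \<omega> (?x t) (q' - q) (fst d + t *\<^sub>R (snd d - fst d)))" for d
  proof -
    have "integral {0..1} (\<lambda>t. frechet_derivative (?f t) (at (q, q')) d) =
      integral {0..1} (\<lambda>t. \<omega> (?x t) (q' - q) (fst d + t *\<^sub>R (snd d - fst d))
        + (d\<theta> (?x t) (q' - q) (fst d + t *\<^sub>R (snd d - fst d)) + \<theta> (?x t) (snd d - fst d)))"
      by (intro integral_cong fd) auto
    also have "\<dots> = integral {0..1} (\<lambda>t. \<omega> (?x t) (q' - q) (fst d + t *\<^sub>R (snd d - fst d)))
      + (\<theta> q' (snd d) - \<theta> q (fst d))"
      using integral_add[OF om has_integral_integrable[OF int]] integral_unique[OF int] by simp
    finally show ?thesis by simp
  qed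
  then show ?thesis
    using has_derivative_integral_param[OF _ _ open_pair_dom smooth_line_integrand z]
    by (simp add: line_integral_def[abs_def] subset_iff)
qed

section \<open>Base-point derivatives of the ingredients of \<Sigma>\<close>

definition "T1 x \<xi> u = frechet_derivative (\<lambda>y. T y \<xi>) (at x) u"
definition "G1 x e u = frechet_derivative (\<lambda>y. g y e e) (at x) u"
definition "DX x u = frechet_derivative X (at x) u"

lemma smooth_T: "smooth_on (\<lambda>x. T x \<xi>) Q"
  by (intro smooth_T_comp smooth_on_intros open_Q)

lemma linear_T1:
  assumes "x \<in> Q" shows "linear (\<lambda>\<xi>. T1 x \<xi> u)" "linear (T1 x \<xi>)"
  unfolding T1_def
  using linear_derivative_family[OF open_Q assms linear_T smooth_T] smooth_on_linear_derivative[OF smooth_T assms]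
  by auto

lemma linear_DX: "x \<in> Q \<Longrightarrow> linear (DX x)"
  unfolding DX_def using smooth_on_linear_derivative[OF smooth_X] by auto

lemma linear_G1: "x \<in> Q \<Longrightarrow> linear (G1 x e)"
  unfolding G1_def using smooth_on_linear_derivative[OF smooth_metric] by auto

lemma G1_scaleR:
  assumes x: "x \<in> Q" shows "G1 x (r *\<^sub>R e) u = r^2 * G1 x e u"
proof -
  have "frechet_derivative (\<lambda>y. g y (r *\<^sub>R e) (r *\<^sub>R e)) (at x) = frechet_derivative (\<lambda>y. r^2 *\<^sub>R g y e e) (at x)"
    by (intro frechet_derivative_cong[OF open_Q x])
      (simp add: linear_cmul[OF linear_metric(1)] linear_cmul[OF linear_metric(2)] power2_eq_square)
  also have "\<dots> = (\<lambda>u. r^2 *\<^sub>R G1 x e u)"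
    using frechet_derivative_at[OF has_derivative_scaleR_right[OF smooth_on_has_derivative[OF smooth_metric x]]]
    unfolding G1_def by metis
  finally show ?thesis by (simp add: G1_def)
qed

lemma smooth_metric_square: "smooth_on (\<lambda>(x, e). g x e e) (Q \<times> UNIV)"
  unfolding case_prod_beta' by (intro smooth_metric_comp smooth_on_intros open_Times open_Q) auto

lemma smooth_T1_comp:
  fixes M :: "'m::euclidean_space set"
  assumes "open M" "smooth_on f M" "\<And>p. p \<in> M \<Longrightarrow> f p \<in> Q" "smooth_on h M" "smooth_on k M"
  shows "smooth_on (\<lambda>p. T1 (f p) (h p) (k p)) M"
proof -
  have "smooth_on (\<lambda>(x, \<xi>). T x \<xi>) (Q \<times> UNIV)"
    unfolding case_prod_beta' by (intro smooth_T_comp smooth_on_intros open_Times open_Q) auto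
  from smooth_on_partial_comp[OF open_Q this assms] show ?thesis by (simp add: T1_def)
qed

lemma smooth_G1_comp:
  fixes M :: "'m::euclidean_space set"
  assumes "open M" "smooth_on f M" "\<And>p. p \<in> M \<Longrightarrow> f p \<in> Q" "smooth_on h M" "smooth_on k M"
  shows "smooth_on (\<lambda>p. G1 (f p) (h p) (k p)) M"
  using smooth_on_partial_comp[OF open_Q smooth_metric_square assms] by (simp add: G1_def)

lemma smooth_DX_comp:
  fixes M :: "'m::euclidean_space set"
  assumes "open M" "smooth_on f M" "\<And>p. p \<in> M \<Longrightarrow> f p \<in> Q" "smooth_on k M"
  shows "smooth_on (\<lambda>p. DX (f p) (k p)) M"
  using smooth_on_derivative_comp[OF open_Q smooth_X assms] by (simp add: DX_def)

lemma has_derivative_metric_square: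
  assumes x: "x \<in> Q"
  shows "((\<lambda>(x, e). g x e e) has_derivative (\<lambda>(u, f). G1 x e u + 2 * g x e f)) (at (x, e))"
proof -
  define D where "D = frechet_derivative (\<lambda>(x, e). g x e e) (at (x, e))"
  have D: "((\<lambda>(x, e). g x e e) has_derivative D) (at (x, e))"
    unfolding D_def using x by (intro smooth_on_has_derivative[OF smooth_metric_square]) auto
  have h2: "((\<lambda>e. (x, e)) has_derivative (\<lambda>f. (0, f))) (at e)" by (auto intro!: derivative_eq_intros)
  have 2: "((\<lambda>e. g x e e) has_derivative (\<lambda>f. D (0, f))) (at e)"
    using has_derivative_compose[OF h2, of "\<lambda>(x, e). g x e e"] D by simp
  have "bounded_bilinear (g x)"
    using linear_metric[OF x] by (simp add: bilinear_conv_bounded_bilinear[symmetric] bilinear_def)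
  from has_derivative_unique[OF 2 bounded_bilinear.FDERIV[OF this has_derivative_ident has_derivative_ident]]
  have 2: "D (0, f) = 2 * g x e f" for f by (simp add: fun_eq_iff metric_sym[OF x, of f])
  have 1: "D (u, 0) = G1 x e u" for u
    unfolding D_def G1_def by (rule frechet_derivative_partial[OF smooth_metric_square x, symmetric])
  have "D (u, f) = G1 x e u + 2 * g x e f" for u f
    using linear_add[OF has_derivative_linear[OF D], of "(u, 0)" "(0, f)"] by (simp add: 1 2)
  then have "D = (\<lambda>(u, f). G1 x e u + 2 * g x e f)" by auto
  then show ?thesis using D by simp
qed

text \<open>Integral remainder of \<omega> along the segment, expanded at the midpoint. With \<xi> =
  h \<eta>, one factor h is taken from the slot of \<omega> that holds \<xi> and one from the
  direction of differentiation. \<xi> and \<eta> are separate arguments so that the quotient makes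
  sense at h = 0.\<close>

definition "K m \<xi> \<eta> u w = integral {0..1} (\<lambda>t. (t - 1/2) *
  integral {0..1} (\<lambda>r. d\<omega> (m + (r * (t - 1/2)) *\<^sub>R \<xi>) \<eta> \<eta> (u + (t - 1/2) *\<^sub>R w)))"

lemma kernel_point:
  assumes "(m, \<xi>) \<in> mid_dom" "r \<in> {-1/4<..<5/4}" "t \<in> {-1/4<..<5/4}"
  shows "m + (r * (t - 1/2)) *\<^sub>R \<xi> \<in> Q"
proof (rule mid_domD[OF assms(1)])
  \<comment> \<open>The bound 15/16 explains the interval from -1/4 to 5/4: it is open around [0, 1]
    and yet small enough for the product of both parameters to stay within the margin of
    \<open>mid_domD\<close>.\<close>
  have "\<bar>r\<bar> * \<bar>t - 1/2\<bar> \<le> 5/4 * (3/4)" using assms by (intro mult_mono) (auto simp: abs_if)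
  then show "\<bar>r * (t - 1/2)\<bar> \<le> 1" by (simp add: abs_mult)
qed

lemma smooth_K_inner:
  fixes M :: "'m::euclidean_space set"
  assumes M: "open M" and sm: "smooth_on m M" "smooth_on \<xi> M" "smooth_on \<eta> M" "smooth_on u M" "smooth_on w M"
    and dom: "\<And>p. p \<in> M \<Longrightarrow> (m p, \<xi> p) \<in> mid_dom"
  shows "smooth_on (\<lambda>(t, p). (t - 1/2) *
      integral {0..1} (\<lambda>r. d\<omega> (m p + (r * (t - 1/2)) *\<^sub>R \<xi> p) (\<eta> p) (\<eta> p) (u p + (t - 1/2) *\<^sub>R w p)))
    ({-1/4<..<5/4} \<times> M)"
proof -
  let ?T = "{-1/4<..<5/4} :: real set"
  have o: "open (?T \<times> M)" "open (?T \<times> (?T \<times> M))" by (intro open_Times M open_greaterThanLessThan)+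
  have c: "smooth_on (\<lambda>p. f (snd (snd p))) (?T \<times> (?T \<times> M))" if "smooth_on f M" for f :: "'m \<Rightarrow> 'a"
    by (rule smooth_on_compose[OF that M o(2)], intro smooth_on_intros o) auto
  have "smooth_on (\<lambda>(r, p). d\<omega> (m (snd p) + (r * (fst p - 1/2)) *\<^sub>R \<xi> (snd p)) (\<eta> (snd p)) (\<eta> (snd p))
      (u (snd p) + (fst p - 1/2) *\<^sub>R w (snd p))) (?T \<times> (?T \<times> M))"
    unfolding case_prod_beta'
    by (intro smooth_d\<omega>_comp smooth_on_intros o c sm) (use kernel_point[OF dom] in auto)
  from smooth_on_integral_param[OF _ _ o(1) this]
  have "smooth_on (\<lambda>p. integral {0..1} (\<lambda>r. d\<omega> (m (snd p) + (r * (fst p - 1/2)) *\<^sub>R \<xi> (snd p)) (\<eta> (snd p)) (\<eta> (snd p))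
      (u (snd p) + (fst p - 1/2) *\<^sub>R w (snd p)))) (?T \<times> M)"
    by (simp add: subset_iff)
  then show ?thesis unfolding case_prod_beta'
    by (intro smooth_on_mult smooth_on_diff smooth_on_fst smooth_on_id smooth_on_const o)
qed

lemma smooth_K_comp:
  fixes M :: "'m::euclidean_space set"
  assumes M: "open M" and sm: "smooth_on m M" "smooth_on \<xi> M" "smooth_on \<eta> M" "smooth_on u M" "smooth_on w M"
    and dom: "\<And>p. p \<in> M \<Longrightarrow> (m p, \<xi> p) \<in> mid_dom"
  shows "smooth_on (\<lambda>p. K (m p) (\<xi> p) (\<eta> p) (u p) (w p)) M"
  unfolding K_def
  by (rule smooth_on_integral_param[OF _ _ M smooth_K_inner[OF assms]]) auto

lemma continuous_K_inner:
  assumes "(m, \<xi>) \<in> mid_dom"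
  shows "continuous_on {0..1} (\<lambda>t. (t - 1/2) *
      integral {0..1} (\<lambda>r. d\<omega> (m + (r * (t - 1/2)) *\<^sub>R \<xi>) \<eta> \<eta> (u + (t - 1/2) *\<^sub>R w)))"
proof -
  \<comment> \<open>A dummy real parameter p makes the fixed data constant functions, so that
    \<open>smooth_K_inner\<close> applies.\<close>
  let ?F = "\<lambda>(t, p::real). (t - 1/2) *
      integral {0..1} (\<lambda>r. d\<omega> (m + (r * (t - 1/2)) *\<^sub>R \<xi>) \<eta> \<eta> (u + (t - 1/2) *\<^sub>R w))"
  have "continuous_on ({-1/4<..<5/4} \<times> UNIV) ?F"
    using smooth_K_inner[OF open_UNIV smooth_on_const smooth_on_const smooth_on_const smooth_on_const smooth_on_const,
        of m \<xi> \<eta> u w] assms by (intro smooth_on_imp_continuous_on) simp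
  then have "continuous_on {0..1} (\<lambda>t. ?F (t, 0))"
    by (rule continuous_on_compose2) (auto intro!: continuous_intros)
  then show ?thesis by simp
qed

lemma continuous_K_innermost:
  assumes "(m, \<xi>) \<in> mid_dom" "t \<in> {0..1}"
  shows "continuous_on {0..1} (\<lambda>r. d\<omega> (m + (r * (t - 1/2)) *\<^sub>R \<xi>) \<eta> \<eta> v)"
proof (rule continuous_on_subset[OF smooth_on_imp_continuous_on])
  show "smooth_on (\<lambda>r. d\<omega> (m + (r * (t - 1/2)) *\<^sub>R \<xi>) \<eta> \<eta> v) {-1/4<..<5/4}"
    using assms by (intro smooth_d\<omega>_comp smooth_on_intros kernel_point) auto
qed auto

lemma linear_K:
  assumes dom: "(m, \<xi>) \<in> mid_dom" shows "linear (\<lambda>d. K m \<xi> \<eta> (fst d) (snd d))"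
  unfolding K_def
proof (rule linear_integral_family)
  fix t :: real assume t: "t \<in> {0..1}"
  have l: "linear (\<lambda>v. integral {0..1} (\<lambda>r. d\<omega> (m + (r * (t - 1/2)) *\<^sub>R \<xi>) \<eta> \<eta> v))"
    using kernel_point[OF dom, of _ t] t
    by (intro linear_integral_family continuous_K_innermost[OF dom] linear_d\<omega>) auto
  show "linear (\<lambda>d. (t - 1/2) * integral {0..1} (\<lambda>r. d\<omega> (m + (r * (t - 1/2)) *\<^sub>R \<xi>) \<eta> \<eta> (fst d + (t - 1/2) *\<^sub>R snd d)))"
  proof -
    have "linear (\<lambda>d :: 'a \<times> 'a. fst d + (t - 1/2) *\<^sub>R snd d)"
      by (rule linearI) (simp_all add: algebra_simps)
    from linear_compose_scale_right[OF linear_compose[OF this l], of "t - 1/2"] show ?thesis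
      by (simp add: o_def)
  qed
qed (rule continuous_K_inner[OF dom])

text \<open>For \<xi> = 0 the inner integrand does not depend on r. The integral of t - 1/2
  vanishes, which removes u, and that of (t - 1/2)^2 is 1/12.\<close>

lemma K_zero:
  assumes m: "m \<in> Q" shows "K m 0 \<eta> u w = d\<omega> m \<eta> \<eta> w / 12"
proof -
  have e: "(t - 1/2) * integral {0..1} (\<lambda>r. d\<omega> (m + (r * (t - 1/2)) *\<^sub>R 0) \<eta> \<eta> (u + (t - 1/2) *\<^sub>R w))
    = (t - 1/2) * d\<omega> m \<eta> \<eta> u + (t - 1/2)^2 * d\<omega> m \<eta> \<eta> w" for t
  proof -
    have "d\<omega> m \<eta> \<eta> (u + (t - 1/2) *\<^sub>R w) = d\<omega> m \<eta> \<eta> u + (t - 1/2) * d\<omega> m \<eta> \<eta> w"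
      by (simp only: linear_add[OF linear_d\<omega>(3)[OF m]] linear_cmul[OF linear_d\<omega>(3)[OF m]] real_scaleR_def)
    then show ?thesis by (simp only: scaleR_zero_right add_0_right integral_const_real) (simp add: distrib_left power2_eq_square)
  qed
  have "((\<lambda>t. (t - 1/2)^2 / 2 * d\<omega> m \<eta> \<eta> u + (t - 1/2)^3 / 3 * d\<omega> m \<eta> \<eta> w) has_real_derivative
      (t - 1/2) * d\<omega> m \<eta> \<eta> u + (t - 1/2)^2 * d\<omega> m \<eta> \<eta> w) (at t)" for t
    by (auto intro!: derivative_eq_intros)
  from integral_unique[OF fundamental_theorem_unit_interval[OF this]]
  show ?thesis unfolding K_def e by (simp add: power2_eq_square power3_eq_cube)
qed

text \<open>The variation of \<open>\<omega>\<close> along the segment contributes only at order \<open>h\<^sup>2\<close>; expanding about the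
  midpoint also removes \<open>w\<close> from the leading term.\<close>

lemma omega_segment_integral:
  assumes dom: "(m, \<xi>) \<in> mid_dom" and \<xi>: "\<xi> = h *\<^sub>R \<eta>"
  shows "integral {0..1} (\<lambda>t. \<omega> (m + (t - 1/2) *\<^sub>R \<xi>) \<xi> (u + (t - 1/2) *\<^sub>R w))
    = h * \<omega> m \<eta> u + h^2 * K m \<xi> \<eta> u w"
proof -
  have m: "m \<in> Q" using mid_dom_base[OF dom] .
  define k where "k = (\<lambda>t. (t - 1/2) *
      integral {0..1} (\<lambda>r. d\<omega> (m + (r * (t - 1/2)) *\<^sub>R \<xi>) \<eta> \<eta> (u + (t - 1/2) *\<^sub>R w)))"
  have pt: "\<omega> (m + (t - 1/2) *\<^sub>R \<xi>) \<xi> (u + (t - 1/2) *\<^sub>R w)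
      = (h * \<omega> m \<eta> u + (t - 1/2) * (h * \<omega> m \<eta> w)) + h^2 * k t" if t: "t \<in> {0..1}" for t
  proof -
    let ?v = "u + (t - 1/2) *\<^sub>R w"
    let ?I = "integral {0..1} (\<lambda>r. d\<omega> (m + (r * (t - 1/2)) *\<^sub>R \<xi>) \<eta> \<eta> ?v)"
    have Q: "m + (r * (t - 1/2)) *\<^sub>R \<xi> \<in> Q" if "r \<in> {0..1}" for r
      using kernel_point[OF dom, of r t] that t by simp
    have "((\<lambda>r. \<omega> (m + r *\<^sub>R ((t - 1/2) *\<^sub>R \<xi>)) \<eta> ?v) has_real_derivative
        h * (t - 1/2) * d\<omega> (m + (r * (t - 1/2)) *\<^sub>R \<xi>) \<eta> \<eta> ?v) (at r)" if r: "r \<in> {0..1}" for r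
    proof -
      have eq: "m + r *\<^sub>R ((t - 1/2) *\<^sub>R \<xi>) = m + (r * (t - 1/2)) *\<^sub>R \<xi>" by simp
      have der: "((\<lambda>y. \<omega> y \<eta> ?v) has_derivative (\<lambda>a. d\<omega> (m + r *\<^sub>R ((t - 1/2) *\<^sub>R \<xi>)) a \<eta> ?v)) (at (m + r *\<^sub>R ((t - 1/2) *\<^sub>R \<xi>)))"
        unfolding d\<omega>_def using Q[OF r] eq by (intro smooth_on_has_derivative[OF smooth_\<omega>]) simp
      have "d\<omega> y ((t - 1/2) *\<^sub>R \<xi>) \<eta> ?v = h * (t - 1/2) * d\<omega> y \<eta> \<eta> ?v" if "y \<in> Q" for y
        using linear_cmul[OF linear_d\<omega>(1)[OF that], of "h * (t - 1/2)"] by (simp add: \<xi> mult.commute)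
      note c = this[OF Q[OF r]]
      from has_real_derivative_along_line[OF der] show ?thesis unfolding eq c .
    qed
    from integral_unique[OF fundamental_theorem_unit_interval[OF this]]
    have "h * (t - 1/2) * ?I = \<omega> (m + (t - 1/2) *\<^sub>R \<xi>) \<eta> ?v - \<omega> m \<eta> ?v" by simp
    then have "\<omega> (m + (t - 1/2) *\<^sub>R \<xi>) \<eta> ?v = \<omega> m \<eta> ?v + h * k t" by (simp add: k_def)
    moreover have "\<omega> (m + (t - 1/2) *\<^sub>R \<xi>) \<xi> ?v = h * \<omega> (m + (t - 1/2) *\<^sub>R \<xi>) \<eta> ?v"
      using linear_cmul[OF linear_\<omega>(1)[OF Q[of 1]]] by (simp add: \<xi>)
    moreover have "\<omega> m \<eta> ?v = \<omega> m \<eta> u + (t - 1/2) * \<omega> m \<eta> w"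
      by (simp only: linear_add[OF linear_\<omega>(2)[OF m]] linear_cmul[OF linear_\<omega>(2)[OF m]] real_scaleR_def)
    ultimately show ?thesis by (simp only:) (simp add: distrib_left power2_eq_square)
  qed
  have "((\<lambda>t. t * (h * \<omega> m \<eta> u) + (t - 1/2)^2 / 2 * (h * \<omega> m \<eta> w)) has_real_derivative
      h * \<omega> m \<eta> u + (t - 1/2) * (h * \<omega> m \<eta> w)) (at t)" for t
    by (auto intro!: derivative_eq_intros)
  from fundamental_theorem_unit_interval[OF this]
  have i1: "((\<lambda>t. h * \<omega> m \<eta> u + (t - 1/2) * (h * \<omega> m \<eta> w)) has_integral h * \<omega> m \<eta> u) {0..1}"
    by (simp add: power2_eq_square)
  have "k integrable_on {0..1}"
    unfolding k_def by (intro integrable_continuous_real continuous_K_inner[OF dom])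
  then have i2: "((\<lambda>t. h^2 * k t) has_integral h^2 * K m \<xi> \<eta> u w) {0..1}"
    unfolding K_def k_def[symmetric] by (intro has_integral_mult_right) (simp add: k_def K_def integrable_integral)
  show ?thesis
    by (rule integral_unique[OF has_integral_eq[OF pt[symmetric] has_integral_add[OF i1 i2]]])
qed

end

section \<open>The Lorentz form as an exact form\<close>

lemma ext_deriv_tautological_form:
  "ext_deriv tautological_form z \<delta> \<delta>' = blinfun_apply (snd \<delta>) (fst \<delta>') - blinfun_apply (snd \<delta>') (fst \<delta>)"
proof -
  have "((\<lambda>z. tautological_form z b) has_derivative (\<lambda>d. blinfun_apply (snd d) (fst b))) (at z)" for b
    unfolding tautological_form_def by (auto intro!: derivative_eq_intros)
  from frechet_derivative_at[OF this, symmetric] show ?thesis by (simp add: ext_deriv_def)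
qed

context almost_kaehler
begin

text \<open>The one-form whose values are the left sides of both implicit relations; minus its
  exterior derivative is the Lorentz form by \<open>lorentz_form_eq\<close>.\<close>

definition "lorentz_potential h z d = \<theta> (fst z) (fst d) + h^2 * g (fst z) (snd z) (fst d)"

lemma open_TQ: "open (Q \<times> (UNIV :: 'a set))"
  by (intro open_Times open_Q open_UNIV)

lemma linear_lorentz_potential:
  assumes "z \<in> Q \<times> UNIV" shows "linear (lorentz_potential h z)"
proof -
  have Q: "fst z \<in> Q" using assms by auto
  show ?thesis
    by (rule linearI) (simp_all add: lorentz_potential_def linear_add[OF linear_\<theta>[OF Q]] linear_cmul[OF linear_\<theta>[OF Q]]
        linear_add[OF linear_metric(2)[OF Q]] linear_cmul[OF linear_metric(2)[OF Q]] algebra_simps)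
qed

lemma smooth_metric_TQ: "smooth_on (\<lambda>z. g (fst z) (snd z) w) (Q \<times> UNIV)"
  by (intro smooth_metric_comp smooth_on_intros open_TQ) auto

lemma smooth_lorentz_potential: "smooth_on (\<lambda>z. lorentz_potential h z d) (Q \<times> UNIV)"
  unfolding lorentz_potential_def
  by (intro smooth_on_add smooth_on_mult smooth_metric_TQ smooth_\<theta>_comp smooth_on_fst smooth_on_id smooth_on_const open_TQ) auto

text \<open>On Q the covector is expanded in the functionals \<open>blinfun_inner_left b\<close>,
  whose coefficients are smooth real functions. Over Q the argument of \<open>Blinfun\<close> is
  linear, so the expansion is an identity near z and may be differentiated in place of
  \<open>flat_map\<close>.\<close>

lemma has_derivative_flat_map:
  assumes z: "z \<in> Q \<times> UNIV"
  obtains D where "(flat_map \<theta> J has_derivative D) (at z)"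
    "\<And>d. fst (D d) = fst d"
    "\<And>d w. blinfun_apply (snd (D d)) w = frechet_derivative (\<lambda>z. g (fst z) (snd z) w) (at z) d"
proof -
  define gd where "gd = (\<lambda>w. frechet_derivative (\<lambda>z. g (fst z) (snd z) w) (at z))"
  have eq: "flat_map \<theta> J y = (fst y, \<Sum>b\<in>Basis. g (fst y) (snd y) b *\<^sub>R blinfun_inner_left b)"
    if y: "y \<in> Q \<times> UNIV" for y
  proof -
    have l: "linear (g (fst y) (snd y))" using y by (intro linear_metric) auto
    have "Blinfun (g (fst y) (snd y)) = (\<Sum>b\<in>Basis. g (fst y) (snd y) b *\<^sub>R blinfun_inner_left b)"
    proof (rule blinfun_eqI)
      fix w
      have "blinfun_apply (\<Sum>b\<in>Basis. g (fst y) (snd y) b *\<^sub>R blinfun_inner_left b) w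
        = (\<Sum>b\<in>Basis. (w \<bullet> b) *\<^sub>R g (fst y) (snd y) b)"
        by (simp add: blinfun.sum_left blinfun.scaleR_left mult.commute)
      then show "blinfun_apply (Blinfun (g (fst y) (snd y))) w
        = blinfun_apply (\<Sum>b\<in>Basis. g (fst y) (snd y) b *\<^sub>R blinfun_inner_left b) w"
        using l by (simp only: linear_basis_expansion[OF l, symmetric])
          (simp add: bounded_linear_Blinfun_apply linear_conv_bounded_linear)
    qed
    then show ?thesis by (simp add: flat_map_def)
  qed
  let ?D = "\<lambda>d. (fst d, \<Sum>b\<in>Basis. gd b d *\<^sub>R blinfun_inner_left b)"
  have "((\<lambda>y. (fst y, \<Sum>b\<in>Basis. g (fst y) (snd y) b *\<^sub>R blinfun_inner_left b)) has_derivative ?D) (at z)"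
    unfolding gd_def
    by (intro has_derivative_Pair has_derivative_sum has_derivative_scaleR_left has_derivative_fst has_derivative_ident
        smooth_on_has_derivative[OF smooth_metric_TQ z])
  then have D: "(flat_map \<theta> J has_derivative ?D) (at z)"
    by (rule has_derivative_transform_within_open[OF _ open_TQ z]) (simp add: eq)
  have lin: "linear (\<lambda>w. gd w d)" for d
    unfolding gd_def
    by (rule linear_derivative_family[OF open_TQ z]) (auto intro: linear_metric smooth_metric_TQ)
  have "blinfun_apply (snd (?D d)) w = gd w d" for d w
  proof -
    have "blinfun_apply (snd (?D d)) w = (\<Sum>b\<in>Basis. (w \<bullet> b) *\<^sub>R gd b d)"
      by (simp add: blinfun.sum_left blinfun.scaleR_left mult.commute)
    then show ?thesis by (simp only: linear_basis_expansion[OF lin, symmetric])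
  qed
  then show thesis using that[OF D] by (simp add: gd_def)
qed

lemma lorentz_form_eq:
  assumes z: "z \<in> Q \<times> UNIV"
  shows "lorentz_form \<theta> J h z a b = - ext_deriv (lorentz_potential h) z a b"
proof -
  obtain D where D: "(flat_map \<theta> J has_derivative D) (at z)" "\<And>d. fst (D d) = fst d"
    "\<And>d w. blinfun_apply (snd (D d)) w = frechet_derivative (\<lambda>z. g (fst z) (snd z) w) (at z) d"
    using has_derivative_flat_map[OF z] by blast
  have Q: "fst z \<in> Q" using z by auto
  have fst: "frechet_derivative fst (at z) = fst"
    using frechet_derivative_at[OF has_derivative_fst[OF has_derivative_ident]] by metis
  have pot: "frechet_derivative (\<lambda>z. lorentz_potential h z d) (at z) e
    = d\<theta> (fst z) (fst e) (fst d) + h^2 * frechet_derivative (\<lambda>z. g (fst z) (snd z) (fst d)) (at z) e" for d e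
  proof -
    have "((\<lambda>z. \<theta> (fst z) (fst d)) has_derivative (\<lambda>e. d\<theta> (fst z) (fst e) (fst d))) (at z)"
      unfolding d\<theta>_def
      by (rule has_derivative_compose[OF has_derivative_fst[OF has_derivative_ident] smooth_on_has_derivative[OF smooth_\<theta> Q]])
    from frechet_derivative_at[OF has_derivative_add[OF this
        has_derivative_mult_right[OF smooth_on_has_derivative[OF smooth_metric_TQ z]]], symmetric]
    show ?thesis by (simp only: lorentz_potential_def)
  qed
  have "lorentz_form \<theta> J h z a b = \<omega> (fst z) (fst a) (fst b) + h^2 *
    - (frechet_derivative (\<lambda>z. g (fst z) (snd z) (fst b)) (at z) a - frechet_derivative (\<lambda>z. g (fst z) (snd z) (fst a)) (at z) b)"
    unfolding lorentz_form_def pullback2_def fst canonical_symplectic_def ext_deriv_tautological_form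
      frechet_derivative_at[OF D(1), symmetric] D(2,3) by simp
  then show ?thesis by (simp add: ext_deriv_def pot omega_eq algebra_simps)
qed

end

text \<open>The angle is a real number here, so excluding 0 and \<pi> as angles means excluding all
  integer multiples of \<pi>.\<close>

locale lorentz_map = almost_kaehler Q \<theta> J H
  for Q :: "'a::euclidean_space set" and \<theta> :: "'a \<Rightarrow> 'a \<Rightarrow> real" and J H +
  fixes \<theta>\<^sub>0 :: real
  assumes angle: "\<forall>k::int. \<theta>\<^sub>0 \<noteq> of_int k * pi"
begin

definition "c = sin \<theta>\<^sub>0 / (1 - cos \<theta>\<^sub>0)"

lemma sin_angle: "sin \<theta>\<^sub>0 \<noteq> 0"
  using angle by (auto simp: sin_zero_iff_int2)

lemma cos_angle: "1 - cos \<theta>\<^sub>0 \<noteq> 0"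
  using sin_angle sin_zero_iff[of \<theta>\<^sub>0] sin_cos_squared_add[of \<theta>\<^sub>0]
  by (metis add_diff_cancel_right' diff_self eq_iff_diff_eq_0 one_power2 power_eq_0_iff)

lemma c_nonzero: "c \<noteq> 0"
  using sin_angle cos_angle by (simp add: c_def)

lemma c_cos: "c * (1 - cos \<theta>\<^sub>0) = sin \<theta>\<^sub>0"
  using cos_angle by (simp add: c_def)

text \<open>Cancel 1 - cos in sin^2 = (1 + cos)(1 - cos). Together with \<open>c_cos\<close> this
  determines cosine and sine as rational functions of c.\<close>

lemma c_sin: "c * sin \<theta>\<^sub>0 = 1 + cos \<theta>\<^sub>0"
proof -
  have "(c * sin \<theta>\<^sub>0) * (1 - cos \<theta>\<^sub>0) = sin \<theta>\<^sub>0 * sin \<theta>\<^sub>0" by (metis c_cos mult.assoc mult.commute)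
  also have "\<dots> = (1 + cos \<theta>\<^sub>0) * (1 - cos \<theta>\<^sub>0)"
    using sin_cos_squared_add[of \<theta>\<^sub>0] by (simp add: algebra_simps power2_eq_square)
  finally show ?thesis using cos_angle by simp
qed

abbreviation (input) "Sig \<equiv> Sigma_fun \<theta> J H \<theta>\<^sub>0"
abbreviation (input) "gen h z \<equiv> gen_fun \<theta> J H \<theta>\<^sub>0 h (fst z) (snd z)"

lemma Sig_eq:
  assumes "x \<in> Q"
  shows "Sig h x \<xi> = - h * H x + h^2 * T x \<xi> - c/4 * g x (\<xi> - h *\<^sub>R X x) (\<xi> - h *\<^sub>R X x)"
  using Sigma_fun_eq[OF assms, of \<theta>\<^sub>0 h \<xi>] by (simp add: c_def)

section \<open>The differential of the generating function in the coordinates (m, \<zeta>,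
  h)\<close>

lemma has_derivative_Sig:
  assumes x: "x \<in> Q"
  shows "((\<lambda>p. Sig h (fst p) (snd p)) has_derivative
    (\<lambda>d. - h * frechet_derivative H (at x) (fst d) + h^2 * (T1 x \<xi> (fst d) + T x (snd d))
      - c/4 * (G1 x (\<xi> - h *\<^sub>R X x) (fst d) + 2 * g x (\<xi> - h *\<^sub>R X x) (snd d - h *\<^sub>R DX x (fst d))))) (at (x, \<xi>))"
proof -
  have f: "((\<lambda>p. fst p) has_derivative (\<lambda>d. fst d)) (at (x, \<xi>))" by (auto intro!: derivative_eq_intros)
  have s: "((\<lambda>p. snd p) has_derivative (\<lambda>d. snd d)) (at (x, \<xi>))" by (auto intro!: derivative_eq_intros)
  have 1: "((\<lambda>p. H (fst p)) has_derivative (\<lambda>d. frechet_derivative H (at x) (fst d))) (at (x, \<xi>))"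
    using has_derivative_compose[OF f, of H] smooth_on_has_derivative[OF smooth_H x] by simp
  have 2: "((\<lambda>p. T (fst p) (snd p)) has_derivative (\<lambda>d. T1 x \<xi> (fst d) + T x (snd d))) (at (x, \<xi>))"
    using has_derivative_linear_family[OF open_Q linear_T smooth_T x, of \<xi>] by (simp add: T1_def case_prod_beta')
  have 3: "((\<lambda>p. X (fst p)) has_derivative (\<lambda>d. DX x (fst d))) (at (x, \<xi>))"
    using has_derivative_compose[OF f, of X] smooth_on_has_derivative[OF smooth_X x] by (simp add: DX_def)
  have 4: "((\<lambda>p. (fst p, snd p - h *\<^sub>R X (fst p))) has_derivative (\<lambda>d. (fst d, snd d - h *\<^sub>R DX x (fst d)))) (at (x, \<xi>))"
    by (intro has_derivative_Pair f has_derivative_diff s has_derivative_scaleR_right 3)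
  have 5: "((\<lambda>p. g (fst p) (snd p - h *\<^sub>R X (fst p)) (snd p - h *\<^sub>R X (fst p))) has_derivative
    (\<lambda>d. G1 x (\<xi> - h *\<^sub>R X x) (fst d) + 2 * g x (\<xi> - h *\<^sub>R X x) (snd d - h *\<^sub>R DX x (fst d)))) (at (x, \<xi>))"
  proof -
    have "((\<lambda>(x, e). g x e e) has_derivative (\<lambda>(u, f). G1 x (\<xi> - h *\<^sub>R X x) u + 2 * g x (\<xi> - h *\<^sub>R X x) f))
      (at (fst (x, \<xi>), snd (x, \<xi>) - h *\<^sub>R X (fst (x, \<xi>))))"
      using has_derivative_metric_square[OF x] by simp
    from has_derivative_compose[OF 4 this] show ?thesis by simp
  qed
  have "((\<lambda>p. - h * H (fst p) + h^2 * T (fst p) (snd p)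
      - c/4 * g (fst p) (snd p - h *\<^sub>R X (fst p)) (snd p - h *\<^sub>R X (fst p))) has_derivative
    (\<lambda>d. - h * frechet_derivative H (at x) (fst d) + h^2 * (T1 x \<xi> (fst d) + T x (snd d))
      - c/4 * (G1 x (\<xi> - h *\<^sub>R X x) (fst d) + 2 * g x (\<xi> - h *\<^sub>R X x) (snd d - h *\<^sub>R DX x (fst d))))) (at (x, \<xi>))"
    by (intro has_derivative_diff has_derivative_add has_derivative_mult_right 1 2 5)
  then show ?thesis
    by (rule has_derivative_transform_within_open[OF _ open_TQ]) (use x in \<open>auto simp: Sig_eq\<close>)
qed

lemma gen_fun_eq: "gen h z = line_integral z + Sig h ((1/2) *\<^sub>R (fst z + snd z)) (snd z - fst z)"
  by (simp add: gen_fun_def line_integral_def)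

text \<open>\<open>P m \<zeta> h u w\<close> is the differential of the generating function at \<open>(m - \<xi>/2, m + \<xi>/2)\<close>,
  \<open>\<xi> = h X(m) + h\<^sup>2 \<zeta>\<close>, without its \<open>\<theta>\<close>-part and divided by \<open>h\<^sup>2\<close>. The terms of order \<open>h\<close>
  cancel because of \<open>\<omega>(X, \<cdot>) = dH\<close>, so that it is smooth at \<open>h = 0\<close>.\<close>

definition "P m \<zeta> h u w = \<omega> m \<zeta> u + K m (h *\<^sub>R (X m + h *\<^sub>R \<zeta>)) (X m + h *\<^sub>R \<zeta>) u w
  + h * T1 m (X m + h *\<^sub>R \<zeta>) u + T m w - c/4 * h^2 * G1 m \<zeta> u - c/2 * g m \<zeta> w + c/2 * h * g m \<zeta> (DX m u)"

text \<open>A variation of (q, q') enters through u, the variation of the midpoint, and w, that of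
  the displacement. The line integral contributes h \<omega>(X + h \<zeta>, u), from which - h dH(u)
  leaves h^2 \<omega>(\<zeta>, u). The metric term is differentiated at h^2 \<zeta> and contributes
  only multiples of h^2.\<close>

lemma has_derivative_gen_fun:
  assumes dom: "(m, \<xi>) \<in> mid_dom" and \<xi>: "\<xi> = h *\<^sub>R (X m + h *\<^sub>R \<zeta>)"
    and q: "q = m - (1/2) *\<^sub>R \<xi>" "q' = m + (1/2) *\<^sub>R \<xi>"
  shows "(gen h has_derivative (\<lambda>d. \<theta> q' (snd d) - \<theta> q (fst d)
    + h^2 * P m \<zeta> h ((1/2) *\<^sub>R (fst d + snd d)) (snd d - fst d))) (at (q, q'))"
proof -
  define \<eta> where "\<eta> = X m + h *\<^sub>R \<zeta>"
  have m: "m \<in> Q" using mid_dom_base[OF dom] .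
  have \<xi>': "\<xi> = h *\<^sub>R \<eta>" by (simp add: \<xi> \<eta>_def)
  have e: "\<xi> - h *\<^sub>R X m = h^2 *\<^sub>R \<zeta>" by (simp add: \<xi> algebra_simps power2_eq_square)
  have mid: "(1/2) *\<^sub>R (q + q') = m" "q' - q = \<xi>"
    by (simp_all add: q algebra_simps flip: scaleR_add_left)
  have pd: "(q, q') \<in> pair_dom" using dom by (simp add: pair_dom_def mid)
  have pt: "q + t *\<^sub>R \<xi> = m + (t - 1/2) *\<^sub>R \<xi>" for t by (simp add: q algebra_simps)
  have vt: "a + t *\<^sub>R (b - a) = (1/2) *\<^sub>R (a + b) + (t - 1/2) *\<^sub>R (b - a)" for t and a b :: 'a
    by (simp add: algebra_simps flip: scaleR_add_left)
  have 1: "(line_integral has_derivative (\<lambda>d. \<theta> q' (snd d) - \<theta> q (fst d) +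
    (h * \<omega> m \<eta> ((1/2) *\<^sub>R (fst d + snd d)) + h^2 * K m \<xi> \<eta> ((1/2) *\<^sub>R (fst d + snd d)) (snd d - fst d)))) (at (q, q'))"
    using has_derivative_line_integral[OF pd]
    unfolding mid pt vt omega_segment_integral[OF dom \<xi>'] .
  have l: "((\<lambda>z. ((1/2) *\<^sub>R (fst z + snd z), snd z - fst z)) has_derivative
    (\<lambda>d. ((1/2) *\<^sub>R (fst d + snd d), snd d - fst d))) (at (q, q'))"
    by (auto intro!: derivative_eq_intros)
  have "((\<lambda>p. Sig h (fst p) (snd p)) has_derivative
    (\<lambda>d. - h * frechet_derivative H (at m) (fst d) + h^2 * (T1 m \<xi> (fst d) + T m (snd d))
      - c/4 * (G1 m (\<xi> - h *\<^sub>R X m) (fst d) + 2 * g m (\<xi> - h *\<^sub>R X m) (snd d - h *\<^sub>R DX m (fst d)))))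
    (at ((1/2) *\<^sub>R (fst (q, q') + snd (q, q')), snd (q, q') - fst (q, q')))"
    using has_derivative_Sig[OF m, of h \<xi>] by (simp only: fst_conv snd_conv mid)
  from has_derivative_add[OF 1 has_derivative_compose[OF l this]]
  have D: "(gen h has_derivative (\<lambda>d. \<theta> q' (snd d) - \<theta> q (fst d) +
      (h * \<omega> m \<eta> ((1/2) *\<^sub>R (fst d + snd d)) + h^2 * K m \<xi> \<eta> ((1/2) *\<^sub>R (fst d + snd d)) (snd d - fst d))
    + (- h * frechet_derivative H (at m) ((1/2) *\<^sub>R (fst d + snd d))
      + h^2 * (T1 m \<xi> ((1/2) *\<^sub>R (fst d + snd d)) + T m (snd d - fst d))
      - c/4 * (G1 m (\<xi> - h *\<^sub>R X m) ((1/2) *\<^sub>R (fst d + snd d))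
        + 2 * g m (\<xi> - h *\<^sub>R X m) (snd d - fst d - h *\<^sub>R DX m ((1/2) *\<^sub>R (fst d + snd d))))))) (at (q, q'))"
    by (simp only: gen_fun_eq fst_conv snd_conv)
  have P: "h^2 * P m \<zeta> h u w = (h * \<omega> m \<eta> u + h^2 * K m \<xi> \<eta> u w)
    + (- h * frechet_derivative H (at m) u + h^2 * (T1 m \<xi> u + T m w)
      - c/4 * (G1 m (\<xi> - h *\<^sub>R X m) u + 2 * g m (\<xi> - h *\<^sub>R X m) (w - h *\<^sub>R DX m u)))" for u w
  proof -
    have a: "\<omega> m \<eta> u = frechet_derivative H (at m) u + h * \<omega> m \<zeta> u"
      by (simp only: \<eta>_def linear_add[OF linear_\<omega>(1)[OF m]] linear_cmul[OF linear_\<omega>(1)[OF m]] omega_X[OF m] real_scaleR_def)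
    have b: "T1 m \<xi> u = h * T1 m \<eta> u"
      by (simp only: \<xi>' linear_cmul[OF linear_T1(1)[OF m]] real_scaleR_def)
    have c: "G1 m (h^2 *\<^sub>R \<zeta>) u = h^4 * G1 m \<zeta> u"
      by (simp add: G1_scaleR[OF m])
    have d: "g m (h^2 *\<^sub>R \<zeta>) (w - h *\<^sub>R DX m u) = h^2 * (g m \<zeta> w - h * g m \<zeta> (DX m u))"
      by (simp only: linear_cmul[OF linear_metric(1)[OF m]] linear_diff[OF linear_metric(2)[OF m]]
          linear_cmul[OF linear_metric(2)[OF m]] real_scaleR_def)
        (simp add: algebra_simps)
    show ?thesis
      unfolding P_def e a b c d \<eta>_def[symmetric] \<xi>'[symmetric]
      by (simp add: algebra_simps power2_eq_square power4_eq_xxxx)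
  qed
  show ?thesis using D unfolding P by (simp only: add.assoc)
qed

lemma linear_P:
  assumes "(m, h *\<^sub>R (X m + h *\<^sub>R \<zeta>)) \<in> mid_dom"
  shows "linear (\<lambda>d. P m \<zeta> h (fst d) (snd d))"
proof -
  have m: "m \<in> Q" using mid_dom_base[OF assms] .
  note lin = linear_K[OF assms] linear_\<omega>(2)[OF m] linear_T1(2)[OF m] linear_T[OF m] linear_G1[OF m]
    linear_metric(2)[OF m] linear_DX[OF m]
  have k: "K m \<xi> \<eta> (u + u') (w + w') = K m \<xi> \<eta> u w + K m \<xi> \<eta> u' w'"
     "K m \<xi> \<eta> (r *\<^sub>R u) (r *\<^sub>R w) = r * K m \<xi> \<eta> u w" if "(m, \<xi>) \<in> mid_dom" for \<xi> \<eta> u u' w w' r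
    using linear_add[OF linear_K[OF that], of \<eta> "(u, w)" "(u', w')"] linear_cmul[OF linear_K[OF that], of \<eta> r "(u, w)"]
    by simp_all
  show ?thesis
    by (rule linearI)
      (simp_all only: P_def fst_add snd_add fst_scaleR snd_scaleR k[OF assms] lin[THEN linear_add] lin[THEN linear_cmul] real_scaleR_def,
       simp_all add: algebra_simps)
qed

definition "pz_dom = {((m, \<zeta>), h). m \<in> Q \<and> (m, h *\<^sub>R (X m + h *\<^sub>R \<zeta>)) \<in> mid_dom}"

lemma open_pz_dom: "open pz_dom"
proof -
  let ?S = "(Q \<times> UNIV) \<times> (UNIV :: real set)"
  let ?f = "\<lambda>p. (fst (fst p), snd p *\<^sub>R (X (fst (fst p)) + snd p *\<^sub>R snd (fst p)))"
  have o: "open ?S" by (intro open_Times open_Q open_UNIV)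
  have "smooth_on ?f ?S"
    by (intro smooth_on_intros smooth_X_comp o open_Q) auto
  from continuous_open_preimage[OF smooth_on_imp_continuous_on[OF this] o open_mid_dom]
  have "open (?S \<inter> ?f -` mid_dom)" .
  moreover have "?S \<inter> ?f -` mid_dom = pz_dom" by (auto simp: pz_dom_def)
  ultimately show ?thesis by simp
qed

lemma smooth_P_comp:
  fixes M :: "'m::euclidean_space set"
  assumes M: "open M" and sm: "smooth_on m M" "smooth_on \<zeta> M" "smooth_on h M" "smooth_on u M" "smooth_on w M"
    and dom: "\<And>p. p \<in> M \<Longrightarrow> ((m p, \<zeta> p), h p) \<in> pz_dom"
  shows "smooth_on (\<lambda>p. P (m p) (\<zeta> p) (h p) (u p) (w p)) M"
proof -
  have Q: "m p \<in> Q" "(m p, h p *\<^sub>R (X (m p) + h p *\<^sub>R \<zeta> p)) \<in> mid_dom" if "p \<in> M" for p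
    using dom[OF that] by (auto simp: pz_dom_def)
  show ?thesis
    unfolding P_def
    by (intro smooth_on_intros smooth_\<omega>_comp smooth_K_comp smooth_T1_comp smooth_T_comp smooth_G1_comp
        smooth_metric_comp smooth_DX_comp smooth_X_comp M sm Q)
qed

end

subsection \<open>Solving the relations\<close>

context lorentz_map
begin

section \<open>Smoothness and partial derivatives of the generating function\<close>

lemma pair_domD:
  assumes "(q, q') \<in> pair_dom"
  shows "q \<in> Q" "q' \<in> Q" "(1/2) *\<^sub>R (q + q') \<in> Q"
  using assms mid_dom_segment[of q q' 0] mid_dom_segment[of q q' 1] mid_dom_base
  by (auto simp: pair_dom_def)

lemma smooth_gen_joint: "smooth_on (\<lambda>(z, h). gen h z) (pair_dom \<times> UNIV)"
proof -
  let ?M = "pair_dom \<times> (UNIV :: real set)"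
  let ?m = "\<lambda>p. (1/2) *\<^sub>R (fst (fst p) + snd (fst p))"
  let ?\<xi> = "\<lambda>p. snd (fst p) - fst (fst p)"
  have o: "open ?M" by (intro open_Times open_pair_dom open_UNIV)
  have Q: "?m p \<in> Q" if "p \<in> ?M" for p
    using that pair_domD(3)[of "fst (fst p)" "snd (fst p)"] by auto
  have "smooth_on (\<lambda>p. line_integral (fst p) + (- snd p * H (?m p) + (snd p)^2 * T (?m p) (?\<xi> p)
    - c/4 * g (?m p) (?\<xi> p - snd p *\<^sub>R X (?m p)) (?\<xi> p - snd p *\<^sub>R X (?m p)))) ?M"
    by (intro smooth_on_intros smooth_on_compose[OF smooth_line_integral open_pair_dom] smooth_on_compose[OF smooth_H open_Q]
        smooth_T_comp smooth_metric_comp smooth_X_comp o Q) auto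
  then show ?thesis
    by (rule smooth_on_cong[OF _ o]) (use Q in \<open>auto simp: gen_fun_eq Sig_eq\<close>)
qed

lemma smooth_gen: "smooth_on (gen h) pair_dom"
  using smooth_on_compose[OF smooth_gen_joint _ open_pair_dom, of "\<lambda>z. (z, h)"]
  by (simp add: open_Times open_pair_dom smooth_on_Pair smooth_on_id smooth_on_const)

lemma gen_fun_partials:
  assumes "(q, q') \<in> pair_dom"
  shows "frechet_derivative (\<lambda>y. gen_fun \<theta> J H \<theta>\<^sub>0 h q y) (at q') w = frechet_derivative (gen h) (at (q, q')) (0, w)"
    and "frechet_derivative (\<lambda>y. gen_fun \<theta> J H \<theta>\<^sub>0 h y q') (at q) w = frechet_derivative (gen h) (at (q, q')) (w, 0)"
proof -
  note D = smooth_on_has_derivative[OF smooth_gen assms, of h]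
  have 1: "((\<lambda>y. (q, y)) has_derivative (\<lambda>w. (0, w))) (at q')" by (auto intro!: derivative_eq_intros)
  have 2: "((\<lambda>y. (y, q')) has_derivative (\<lambda>w. (w, 0))) (at q)" by (auto intro!: derivative_eq_intros)
  show "frechet_derivative (\<lambda>y. gen_fun \<theta> J H \<theta>\<^sub>0 h q y) (at q') w = frechet_derivative (gen h) (at (q, q')) (0, w)"
    using frechet_derivative_at[OF has_derivative_compose[OF 1 D], symmetric] by simp
  show "frechet_derivative (\<lambda>y. gen_fun \<theta> J H \<theta>\<^sub>0 h y q') (at q) w = frechet_derivative (gen h) (at (q, q')) (w, 0)"
    using frechet_derivative_at[OF has_derivative_compose[OF 2 D], symmetric] by simp
qed

lemma lorentz_relations_iff:
  assumes "(q, q') \<in> pair_dom"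
  shows "lorentz_relations \<theta> J H \<theta>\<^sub>0 h (q, v) (q', v') \<longleftrightarrow>
    (\<forall>w. \<theta> q' w + h^2 * g q' v' w = frechet_derivative (gen h) (at (q, q')) (0, w)) \<and>
    (\<forall>w. \<theta> q w + h^2 * g q v w = - frechet_derivative (gen h) (at (q, q')) (w, 0))"
  unfolding lorentz_relations_def by (simp add: gen_fun_partials[OF assms])

text \<open>By the second relation, \<open>N q \<xi> h\<close> represents the covector \<open>h\<^sup>2 g(v, \<cdot>)\<close> in terms of the
  displacement \<open>\<xi> = q' - q\<close>.\<close>

definition "N q \<xi> h = (\<Sum>b\<in>Basis. (- frechet_derivative (gen h) (at (q, q + \<xi>)) (b, 0) - \<theta> q b) *\<^sub>R b)"

lemma N_inner:
  assumes "(q, q + \<xi>) \<in> pair_dom"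
  shows "N q \<xi> h \<bullet> w = - frechet_derivative (gen h) (at (q, q + \<xi>)) (w, 0) - \<theta> q w"
proof -
  note l = smooth_on_linear_derivative[OF smooth_gen assms, of h]
  note l' = linear_\<theta>[OF pair_domD(1)[OF assms]]
  have "linear (\<lambda>w. - frechet_derivative (gen h) (at (q, q + \<xi>)) (w, 0) - \<theta> q w)"
  proof (rule linearI)
    fix a b and r :: real
    show "- frechet_derivative (gen h) (at (q, q + \<xi>)) (a + b, 0) - \<theta> q (a + b) =
      - frechet_derivative (gen h) (at (q, q + \<xi>)) (a, 0) - \<theta> q a + (- frechet_derivative (gen h) (at (q, q + \<xi>)) (b, 0) - \<theta> q b)"
      using linear_add[OF l, of "(a, 0)" "(b, 0)"] linear_add[OF l'] by simp
    show "- frechet_derivative (gen h) (at (q, q + \<xi>)) (r *\<^sub>R a, 0) - \<theta> q (r *\<^sub>R a) =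
      r *\<^sub>R (- frechet_derivative (gen h) (at (q, q + \<xi>)) (a, 0) - \<theta> q a)"
      using linear_cmul[OF l, of r "(a, 0)"] linear_cmul[OF l'] by (simp add: algebra_simps)
  qed
  from inner_representation_functional[OF this] show ?thesis by (simp add: N_def)
qed

text \<open>q and h are passed through, so that injectivity in \<xi> for each fixed q and h becomes
  injectivity of one map on a single space.\<close>

definition "\<Gamma> p = (fst p, N (fst p) (fst (snd p)) (snd (snd p)), snd (snd p))"
definition "\<Gamma>_dom = {(q, \<xi>, h :: real). (q, q + \<xi>) \<in> pair_dom}"

lemma open_\<Gamma>_dom: "open \<Gamma>_dom"
proof -
  have "open ((\<lambda>p. (fst p, fst p + fst (snd p))) -` pair_dom :: ('a \<times> 'a \<times> real) set)"
    by (intro open_vimage open_pair_dom continuous_intros)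
  then show ?thesis by (simp add: \<Gamma>_dom_def vimage_def case_prod_beta')
qed

lemma smooth_\<Gamma>: "smooth_on \<Gamma> \<Gamma>_dom"
proof -
  have dom: "(fst p, fst p + fst (snd p)) \<in> pair_dom" if "p \<in> \<Gamma>_dom" for p
    using that by (auto simp: \<Gamma>_dom_def)
  show ?thesis
    unfolding \<Gamma>_def[abs_def] N_def
    by (intro smooth_on_intros smooth_\<theta>_comp smooth_on_partial_comp[OF open_pair_dom smooth_gen_joint] open_\<Gamma>_dom
        pair_domD(1)[OF dom] dom) 
qed

text \<open>A kernel vector must be (0, \<xi>, 0), because q and h are passed through. Along the ray
  s \<xi> at h = 0 the pairing of \<open>N\<close> with \<xi> equals s k(s), with derivative k(0) =
  - c/2 g(\<xi>, \<xi>) at s = 0. This vanishes only for \<xi> = 0, as c is nonzero. Only this one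
  pairing is computed, not the whole derivative of \<open>N\<close>.\<close>

lemma inj_derivative_\<Gamma>:
  assumes q: "q \<in> Q" shows "inj (frechet_derivative \<Gamma> (at (q, 0, 0)))"
proof -
  have p: "(q, 0, 0) \<in> \<Gamma>_dom"
    using mid_dom_zero[OF q] by (simp add: \<Gamma>_dom_def pair_dom_def flip: scaleR_add_left scaleR_2)
  define D where "D = frechet_derivative \<Gamma> (at (q, 0, 0))"
  have D: "(\<Gamma> has_derivative D) (at (q, 0, 0))"
    unfolding D_def by (rule smooth_on_has_derivative[OF smooth_\<Gamma> p])
  have lD: "linear D" using D has_derivative_linear by blast
  have D1: "fst (D d) = fst d" for d
  proof -
    have "((\<lambda>p. fst p) has_derivative (\<lambda>d. fst (D d))) (at (q, 0, 0))"
      using has_derivative_fst[OF D] by (simp add: \<Gamma>_def)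
    from has_derivative_unique[OF this has_derivative_fst[OF has_derivative_ident]] show ?thesis by metis
  qed
  have D3: "snd (snd (D d)) = snd (snd d)" for d
  proof -
    have "((\<lambda>p. snd (snd p)) has_derivative (\<lambda>d. snd (snd (D d)))) (at (q, 0, 0))"
      using has_derivative_snd[OF has_derivative_snd[OF D]] by (simp add: \<Gamma>_def)
    from has_derivative_unique[OF this has_derivative_snd[OF has_derivative_snd[OF has_derivative_ident]]]
    show ?thesis by metis
  qed
  have "d = 0" if d: "D d = 0" for d
  proof -
    define \<xi> where "\<xi> = fst (snd d)"
    have dq: "d = (0, \<xi>, 0)" using D1[of d] D3[of d] d by (simp add: prod_eq_iff \<xi>_def)
    let ?V = "{s. (q, q + s *\<^sub>R \<xi>) \<in> pair_dom}"
    let ?m = "\<lambda>s. (1/2) *\<^sub>R (q + (q + s *\<^sub>R \<xi>))"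
    have oV: "open ?V"
    proof -
      have "open ((\<lambda>s. (q, q + s *\<^sub>R \<xi>)) -` pair_dom)"
        by (intro open_vimage open_pair_dom continuous_intros)
      then show ?thesis by (simp add: vimage_def)
    qed
    have 0: "0 \<in> ?V" using p by (simp add: \<Gamma>_dom_def)
    have mQ: "?m s \<in> Q" if "s \<in> ?V" for s using pair_domD(3) that by blast
    define k where "k = (\<lambda>s. c/4 * (s * G1 (?m s) \<xi> ((1/2) *\<^sub>R \<xi>) - 2 * g (?m s) \<xi> \<xi>))"
    have Nk: "N q (s *\<^sub>R \<xi>) 0 \<bullet> \<xi> = s * k s" if s: "s \<in> ?V" for s
    proof -
      have pd: "(q, q + s *\<^sub>R \<xi>) \<in> pair_dom" using s by simp
      note Q = mQ[OF s]
      have l: "((\<lambda>z. ((1/2) *\<^sub>R (fst z + snd z), snd z - fst z)) has_derivative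
        (\<lambda>d. ((1/2) *\<^sub>R (fst d + snd d), snd d - fst d))) (at (q, q + s *\<^sub>R \<xi>))"
        by (auto intro!: derivative_eq_intros)
      have "((\<lambda>p. Sig 0 (fst p) (snd p)) has_derivative
        (\<lambda>d. - c/4 * (G1 (?m s) (s *\<^sub>R \<xi>) (fst d) + 2 * g (?m s) (s *\<^sub>R \<xi>) (snd d))))
        (at ((1/2) *\<^sub>R (fst (q, q + s *\<^sub>R \<xi>) + snd (q, q + s *\<^sub>R \<xi>)), snd (q, q + s *\<^sub>R \<xi>) - fst (q, q + s *\<^sub>R \<xi>)))"
        using has_derivative_Sig[OF Q, of 0 "s *\<^sub>R \<xi>"] by simp
      from has_derivative_add[OF has_derivative_line_integral[OF pd] has_derivative_compose[OF l this]]
      have "(gen 0 has_derivative (\<lambda>d. \<theta> (q + s *\<^sub>R \<xi>) (snd d) - \<theta> q (fst d) +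
          integral {0..1} (\<lambda>t. \<omega> (q + t *\<^sub>R (q + s *\<^sub>R \<xi> - q)) (q + s *\<^sub>R \<xi> - q) (fst d + t *\<^sub>R (snd d - fst d)))
        + - c/4 * (G1 (?m s) (s *\<^sub>R \<xi>) ((1/2) *\<^sub>R (fst d + snd d)) + 2 * g (?m s) (s *\<^sub>R \<xi>) (snd d - fst d))))
        (at (q, q + s *\<^sub>R \<xi>))"
        by (simp only: gen_fun_eq fst_conv snd_conv)
      from frechet_derivative_at[OF this, symmetric]
      have E: "frechet_derivative (gen 0) (at (q, q + s *\<^sub>R \<xi>)) (\<xi>, 0) = \<theta> (q + s *\<^sub>R \<xi>) 0 - \<theta> q \<xi> +
          integral {0..1} (\<lambda>t. \<omega> (q + t *\<^sub>R (s *\<^sub>R \<xi>)) (s *\<^sub>R \<xi>) (\<xi> - t *\<^sub>R \<xi>))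
        + - c/4 * (G1 (?m s) (s *\<^sub>R \<xi>) ((1/2) *\<^sub>R \<xi>) + 2 * g (?m s) (s *\<^sub>R \<xi>) (- \<xi>))"
        by simp
      \<comment> \<open>Along the ray both arguments of \<omega> are multiples of \<xi>, so the bulk
        term of the first variation disappears.\<close>
      have "\<omega> (q + t *\<^sub>R (s *\<^sub>R \<xi>)) (s *\<^sub>R \<xi>) (\<xi> - t *\<^sub>R \<xi>) = 0" if "t \<in> {0..1}" for t
      proof -
        have y: "q + t *\<^sub>R (s *\<^sub>R \<xi>) \<in> Q"
          using mid_dom_segment[of q "q + s *\<^sub>R \<xi>" t] pd that by (simp add: pair_dom_def abs_if)
        have "\<xi> - t *\<^sub>R \<xi> = (1 - t) *\<^sub>R \<xi>" by (simp add: algebra_simps)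
        then show ?thesis
          by (simp only: linear_cmul[OF linear_\<omega>(1)[OF y]] linear_cmul[OF linear_\<omega>(2)[OF y]] omega_self) simp
      qed
      then have "integral {0..1} (\<lambda>t. \<omega> (q + t *\<^sub>R (s *\<^sub>R \<xi>)) (s *\<^sub>R \<xi>) (\<xi> - t *\<^sub>R \<xi>)) = integral {0..1} (\<lambda>t::real. 0)"
        by (intro integral_cong)
      then have I: "integral {0..1} (\<lambda>t. \<omega> (q + t *\<^sub>R (s *\<^sub>R \<xi>)) (s *\<^sub>R \<xi>) (\<xi> - t *\<^sub>R \<xi>)) = 0"
        by simp
      have G: "g (?m s) (s *\<^sub>R \<xi>) (- \<xi>) = - s * g (?m s) \<xi> \<xi>"
        by (simp only: linear_cmul[OF linear_metric(1)[OF Q]] linear_neg[OF linear_metric(2)[OF Q]] real_scaleR_def)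
      show ?thesis
        unfolding N_inner[OF pd] E I G G1_scaleR[OF Q] k_def
        by (simp add: linear_0[OF linear_\<theta>[OF pair_domD(2)[OF pd]]] field_simps power2_eq_square)
    qed
    have smk: "smooth_on k ?V"
      unfolding k_def
      by (intro smooth_on_intros smooth_G1_comp smooth_metric_comp oV mQ)
    have "(\<Gamma> has_derivative D) (at ((q, 0, 0) + 0 *\<^sub>R d))" using D by (simp add: dq)
    then have "((\<lambda>s. \<Gamma> ((q, 0, 0) + s *\<^sub>R d)) has_derivative (\<lambda>s. D (s *\<^sub>R d))) (at 0)"
      by (intro has_derivative_compose[of "\<lambda>s. (q, 0, 0) + s *\<^sub>R d" "\<lambda>s. s *\<^sub>R d" 0 UNIV \<Gamma> D])
        (auto intro!: derivative_eq_intros)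
    then have "((\<lambda>s. \<Gamma> (q, s *\<^sub>R \<xi>, 0)) has_derivative (\<lambda>s. 0)) (at 0)"
      using d by (simp add: linear_cmul[OF lD]) (simp add: dq)
    from has_derivative_inner_left[OF has_derivative_fst[OF has_derivative_snd[OF this]], of \<xi>]
    have Nd: "((\<lambda>s. N q (s *\<^sub>R \<xi>) 0 \<bullet> \<xi>) has_derivative (\<lambda>s. 0)) (at 0)"
      by (simp add: \<Gamma>_def)
    have kd: "((\<lambda>s. s * k s) has_derivative (\<lambda>s. s * k 0)) (at 0)"
      by (rule has_derivative_eq_rhs[OF has_derivative_mult[OF has_derivative_ident smooth_on_has_derivative[OF smk 0]]]) auto
    have "((\<lambda>s. s * k s) has_derivative (\<lambda>s. 0)) (at 0)"
      by (rule has_derivative_transform_within_open[OF Nd oV 0]) (rule Nk)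
    from fun_cong[OF has_derivative_unique[OF this kd], of 1] have "k 0 = 0" by simp
    then have "g q \<xi> \<xi> = 0" using c_nonzero by (simp add: k_def flip: scaleR_add_left scaleR_2)
    then have "\<xi> = 0" using metric_pos[OF q, of \<xi>] by auto
    then show ?thesis by (simp add: dq zero_prod_def)
  qed
  then show ?thesis using linear_injective_0[OF lD] unfolding D_def by blast
qed

text \<open>A radius that serves both the geometry of Q and the uniqueness of the displacement. It
  is a relation instead of a chosen radius: no continuous choice has to be made, and
  \<open>good_move\<close> suffices for openness.\<close>

definition "good q r \<longleftrightarrow> 0 < r \<and> ball q r \<subseteq> Q \<and> inj_on \<Gamma> (ball (q, 0, 0) r)"

lemma ex_good:
  assumes q: "q \<in> Q" obtains r where "good q r"
proof -
  have p: "(q, 0, 0) \<in> \<Gamma>_dom"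
    using mid_dom_zero[OF q] by (simp add: \<Gamma>_dom_def pair_dom_def flip: scaleR_add_left scaleR_2)
  obtain r where r: "r > 0" "inj_on \<Gamma> (ball (q, 0, 0) r)"
    using smooth_on_locally_injective[OF open_\<Gamma>_dom p smooth_\<Gamma> inj_derivative_\<Gamma>[OF q]] by metis
  obtain e where e: "e > 0" "ball q e \<subseteq> Q" using openE[OF open_Q q] by blast
  have "good q (min r e)"
    using r e by (auto simp: good_def intro: inj_on_subset)
  then show thesis by (rule that)
qed

text \<open>Moving the centre by less than \<delta> costs at most \<delta> of the radius, since the
  smaller balls lie inside the old ones.\<close>

lemma good_move:
  assumes "good q r" "dist q q' < \<delta>" "\<delta> < r" shows "good q' (r - \<delta>)"
proof -
  have "ball q' (r - \<delta>) \<subseteq> ball q r"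
  proof
    fix y assume "y \<in> ball q' (r - \<delta>)"
    then show "y \<in> ball q r" using assms(2) dist_triangle[of q y q'] by simp
  qed
  moreover have "ball (q', 0, 0) (r - \<delta>) \<subseteq> ball (q, 0 :: 'a, 0 :: real) r"
  proof
    fix p :: "'a \<times> 'a \<times> real" assume "p \<in> ball (q', 0, 0) (r - \<delta>)"
    moreover have "dist (q, 0, 0) (q', 0 :: 'a, 0 :: real) = dist q q'" by (simp add: dist_Pair_Pair)
    ultimately show "p \<in> ball (q, 0, 0) r"
      using assms(2) dist_triangle[of "(q, 0, 0)" p "(q', 0, 0)"] by simp
  qed
  ultimately show ?thesis using assms unfolding good_def by (meson diff_gt_0_iff_gt inj_on_subset order_trans)
qed

text \<open>The second component is polymorphic because the same bound is imposed on the
  displacement and on h. The factor 2 allows both at once: (q, \<xi>, h) then lies within r of (q,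
  0, 0).\<close>

definition tube :: "('a \<times> 'b::real_normed_vector) set" where
  "tube = {(q, x). \<exists>r. good q r \<and> 2 * norm x < r}"

lemma open_tube: "open tube"
  unfolding open_dist
proof
  fix z :: "'a \<times> 'b" assume "z \<in> tube"
  then obtain q x r where z: "z = (q, x)" "good q r" "2 * norm x < r" by (auto simp: tube_def)
  \<comment> \<open>Of the gap, 2 \<delta> is spent on the change of 2 * norm x and \<delta> on the
    loss of radius.\<close>
  define \<delta> where "\<delta> = (r - 2 * norm x) / 3"
  have \<delta>: "\<delta> > 0" "2 * norm x = r - 3 * \<delta>" using z by (auto simp: \<delta>_def field_simps)
  then have "\<delta> < r" using norm_ge_zero[of x] by linarith
  have "z' \<in> tube" if d: "dist z' z < \<delta>" for z'
  proof -
    obtain q' x' where z': "z' = (q', x')" by (cases z')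
    have 1: "dist q q' < \<delta>" using d dist_fst_le[of z' z] by (simp add: z z' dist_commute)
    have 2: "norm (x' - x) < \<delta>" using d dist_snd_le[of z' z] by (simp add: z z' dist_norm)
    have "2 * norm x' < r - \<delta>" using norm_triangle_ineq[of x "x' - x"] 2 \<delta> by simp
    then show ?thesis using good_move[OF z(2) 1 \<open>\<delta> < r\<close>] by (auto simp: tube_def z')
  qed
  then show "\<exists>e>0. \<forall>y. dist y z < e \<longrightarrow> y \<in> tube" using \<delta> by blast
qed

lemma tube_zero: "q \<in> Q \<Longrightarrow> (q, 0) \<in> tube"
  by (rule ex_good[of q]) (auto simp: tube_def good_def)

lemma tube_pair_dom:
  assumes "(q, \<xi>) \<in> tube" shows "(q, q + \<xi>) \<in> pair_dom"
proof -
  obtain r where r: "good q r" "2 * norm \<xi> < r" using assms by (auto simp: tube_def)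
  have eq: "(1/2) *\<^sub>R (q + (q + \<xi>)) = q + (1/2) *\<^sub>R \<xi>" by (simp add: algebra_simps flip: scaleR_add_left)
  \<comment> \<open>The midpoint is less than r/4 away from q, which leaves the radius 3/4 r, still
    more than the length of \<xi>.\<close>
  have "ball (q + (1/2) *\<^sub>R \<xi>) (3/4 * r) \<subseteq> ball q r"
  proof
    fix y assume "y \<in> ball (q + (1/2) *\<^sub>R \<xi>) (3/4 * r)"
    moreover have "dist q (q + (1/2) *\<^sub>R \<xi>) = norm \<xi> / 2" by (simp add: dist_norm)
    ultimately show "y \<in> ball q r"
      using dist_triangle[of q y "q + (1/2) *\<^sub>R \<xi>"] r by simp
  qed
  moreover have "norm \<xi> < 3/4 * r" using r by (simp add: good_def)
  ultimately show ?thesis using r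
    unfolding pair_dom_def by (auto simp: eq good_def intro!: mid_domI[of \<xi> "3/4 * r"])
qed

lemma tube_injective:
  assumes \<xi>1: "(q, \<xi>1) \<in> tube" and \<xi>2: "(q, \<xi>2) \<in> tube" and h: "(q, h :: real) \<in> tube"
    and N: "N q \<xi>1 h = N q \<xi>2 h"
  shows "\<xi>1 = \<xi>2"
proof -
  obtain r1 r2 r3 where r: "good q r1" "2 * norm \<xi>1 < r1" "good q r2" "2 * norm \<xi>2 < r2" "good q r3" "2 * norm h < r3"
    using assms by (auto simp: tube_def)
  \<comment> \<open>The largest of the three radii is one of them, hence good, and bounds both
    displacements and h.\<close>
  define r where "r = max r1 (max r2 r3)"
  have "good q r" using r by (auto simp: r_def max_def)
  then have inj: "inj_on \<Gamma> (ball (q, 0, 0) r)" by (simp add: good_def)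
  have mem: "(q, \<xi>, h) \<in> ball (q, 0, 0) r" if "2 * norm \<xi> < r" for \<xi>
  proof -
    have "dist (q, 0, 0) (q, \<xi>, h) = norm (\<xi>, h)" by (simp add: dist_norm norm_Pair)
    also have "\<dots> \<le> norm \<xi> + norm h" by (rule norm_Pair_le)
    finally show ?thesis using that r by (simp add: r_def)
  qed
  have "(q, \<xi>1, h) = (q, \<xi>2, h)"
    by (rule inj_onD[OF inj _ mem mem]) (use r N in \<open>auto simp: \<Gamma>_def r_def\<close>)
  then show ?thesis by simp
qed

end

section \<open>The exponential of a multiple of a complex structure\<close>

lemma sums_imp_real_scaleR:
  assumes "f sums s" shows "(\<lambda>n. f n *\<^sub>R (v :: 'a::real_normed_vector)) sums (s *\<^sub>R v)"
  using bounded_linear.sums[OF bounded_linear_scaleR_left assms] .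

text \<open>Since A squares to -1, its powers alternate between multiples of v and of A v; the
  coefficients are the cosine and sine series.\<close>

lemma endo_exp_complex_structure:
  fixes A :: "'a::real_normed_vector \<Rightarrow> 'a"
  assumes lin: "linear A" and sq: "\<And>w. A (A w) = - w"
  shows "endo_exp (\<lambda>w. t *\<^sub>R A w) v = cos t *\<^sub>R v + sin t *\<^sub>R A v"
proof -
  have pow: "((\<lambda>w. t *\<^sub>R A w) ^^ n) v = (if even n then ((-1) ^ (n div 2) * t^n) *\<^sub>R v
      else ((-1) ^ ((n - 1) div 2) * t^n) *\<^sub>R A v)" for n
  proof (induction n)
    case (Suc n)
    show ?case
    proof (cases "even n")
      case True
      then show ?thesis by (simp add: Suc linear_cmul[OF lin] mult.left_commute)
    next
      case False
      then obtain k where k: "n = 2 * k + 1" by (auto elim: oddE)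
      then have "((\<lambda>w. t *\<^sub>R A w) ^^ Suc n) v = t *\<^sub>R A (((-1) ^ k * t^n) *\<^sub>R A v)"
        using Suc by simp
      also have "\<dots> = ((-1) ^ (k + 1) * t ^ Suc n) *\<^sub>R v"
        by (simp add: linear_cmul[OF lin] sq mult.left_commute)
      finally show ?thesis by (simp add: k)
    qed
  qed simp
  have "(1 / fact n) *\<^sub>R ((\<lambda>w. t *\<^sub>R A w) ^^ n) v = (cos_coeff n * t^n) *\<^sub>R v + (sin_coeff n * t^n) *\<^sub>R A v" for n
    by (simp add: pow cos_coeff_def sin_coeff_def)
  moreover have "(\<lambda>n. (cos_coeff n * t^n) *\<^sub>R v + (sin_coeff n * t^n) *\<^sub>R A v) sums (cos t *\<^sub>R v + sin t *\<^sub>R A v)"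
    using sums_add[OF sums_imp_real_scaleR[OF cos_converges[of t]] sums_imp_real_scaleR[OF sin_converges[of t]]]
    by simp
  ultimately show ?thesis by (simp add: endo_exp_def sums_iff)
qed

context lorentz_map
begin

abbreviation (input) "disp m \<zeta> h \<equiv> h *\<^sub>R (X m + h *\<^sub>R \<zeta>)"

text \<open>Moving q alone by b moves the midpoint by b/2 and the displacement by -b; moving q'
  alone changes the displacement by +b. The outer minus sign is that of the second implicit
  relation.\<close>

definition "source_covector m \<zeta> h = (\<Sum>b\<in>Basis. - P m \<zeta> h ((1/2) *\<^sub>R b) (- b) *\<^sub>R b)"
definition "target_covector m \<zeta> h = (\<Sum>b\<in>Basis. P m \<zeta> h ((1/2) *\<^sub>R b) b *\<^sub>R b)"

lemma covector_inner:
  assumes dom: "(m, disp m \<zeta> h) \<in> mid_dom"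
  shows "source_covector m \<zeta> h \<bullet> w = - P m \<zeta> h ((1/2) *\<^sub>R w) (- w)"
    and "target_covector m \<zeta> h \<bullet> w = P m \<zeta> h ((1/2) *\<^sub>R w) w"
proof -
  note l = linear_P[OF dom]
  have "linear (\<lambda>w::'a. ((1/2) *\<^sub>R w, - w))" "linear (\<lambda>w::'a. ((1/2) *\<^sub>R w, w))"
    by (auto intro!: linearI simp: algebra_simps)
  from linear_compose_neg[OF linear_compose[OF this(1) l]] linear_compose[OF this(2) l]
  have "linear (\<lambda>w. - P m \<zeta> h ((1/2) *\<^sub>R w) (- w))" "linear (\<lambda>w. P m \<zeta> h ((1/2) *\<^sub>R w) w)"
    by (simp_all add: o_def)
  from inner_representation_functional[OF this(1)] inner_representation_functional[OF this(2)]
  show "source_covector m \<zeta> h \<bullet> w = - P m \<zeta> h ((1/2) *\<^sub>R w) (- w)"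
    "target_covector m \<zeta> h \<bullet> w = P m \<zeta> h ((1/2) *\<^sub>R w) w"
    by (simp_all only: source_covector_def target_covector_def)
qed

text \<open>h is kept in the value, so that the inverse function theorem applies to (m, \<zeta>, h)
  -> (q, v, h) and yields smoothness in h as well.\<close>

definition source :: "('a \<times> 'a) \<times> real \<Rightarrow> ('a \<times> 'a) \<times> real" where
  "source p = (let m = fst (fst p); \<zeta> = snd (fst p); h = snd p; q = m - (1/2) *\<^sub>R disp m \<zeta> h
    in ((q, sharp q (source_covector m \<zeta> h)), h))"

definition target :: "('a \<times> 'a) \<times> real \<Rightarrow> 'a \<times> 'a" where
  "target p = (let m = fst (fst p); \<zeta> = snd (fst p); h = snd p; q = m + (1/2) *\<^sub>R disp m \<zeta> h
    in (q, sharp q (target_covector m \<zeta> h)))"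

lemma pz_domD:
  assumes "((m, \<zeta>), h) \<in> pz_dom"
  shows "m \<in> Q" "(m, disp m \<zeta> h) \<in> mid_dom" "m - (1/2) *\<^sub>R disp m \<zeta> h \<in> Q" "m + (1/2) *\<^sub>R disp m \<zeta> h \<in> Q"
    "(m - (1/2) *\<^sub>R disp m \<zeta> h, m + (1/2) *\<^sub>R disp m \<zeta> h) \<in> pair_dom"
proof -
  show m: "m \<in> Q" "(m, disp m \<zeta> h) \<in> mid_dom" using assms by (auto simp: pz_dom_def)
  show "m - (1/2) *\<^sub>R disp m \<zeta> h \<in> Q" "m + (1/2) *\<^sub>R disp m \<zeta> h \<in> Q"
    using mid_domD[OF m(2), of "1/2"] mid_domD[OF m(2), of "-1/2"] by (simp_all del: scaleR_scaleR)
  have "(1/2) *\<^sub>R ((m - (1/2) *\<^sub>R \<xi>) + (m + (1/2) *\<^sub>R \<xi>)) = m" "(m + (1/2) *\<^sub>R \<xi>) - (m - (1/2) *\<^sub>R \<xi>) = \<xi>" for \<xi>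
    by (simp_all flip: scaleR_add_left scaleR_2)
  then show "(m - (1/2) *\<^sub>R disp m \<zeta> h, m + (1/2) *\<^sub>R disp m \<zeta> h) \<in> pair_dom"
    using m(2) by (simp only: pair_dom_def mem_Collect_eq case_prod_conv)
qed

lemma smooth_source_target: "smooth_on source pz_dom" "smooth_on target pz_dom"
proof -
  have D: "fst (fst p) \<in> Q" 
    "fst (fst p) - (1/2) *\<^sub>R disp (fst (fst p)) (snd (fst p)) (snd p) \<in> Q"
    "fst (fst p) + (1/2) *\<^sub>R disp (fst (fst p)) (snd (fst p)) (snd p) \<in> Q"
    "((fst (fst p), snd (fst p)), snd p) \<in> pz_dom" if "p \<in> pz_dom" for p
    using that pz_domD[of "fst (fst p)" "snd (fst p)" "snd p"] by simp_all
  show "smooth_on source pz_dom"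
    unfolding source_def[abs_def] source_covector_def Let_def
    by (intro smooth_on_intros smooth_sharp_comp smooth_P_comp smooth_X_comp open_pz_dom D)
  show "smooth_on target pz_dom"
    unfolding target_def[abs_def] target_covector_def Let_def
    by (intro smooth_on_intros smooth_sharp_comp smooth_P_comp smooth_X_comp open_pz_dom D)
qed

lemma frechet_derivative_gen:
  assumes p: "((m, \<zeta>), h) \<in> pz_dom"
    and q: "q = m - (1/2) *\<^sub>R disp m \<zeta> h" "q' = m + (1/2) *\<^sub>R disp m \<zeta> h"
  shows "frechet_derivative (gen h) (at (q, q')) (0, w) = \<theta> q' w + h^2 * (target_covector m \<zeta> h \<bullet> w)"
    and "frechet_derivative (gen h) (at (q, q')) (w, 0) = - \<theta> q w - h^2 * (source_covector m \<zeta> h \<bullet> w)"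
  using frechet_derivative_at[OF has_derivative_gen_fun[OF pz_domD(2)[OF p] refl q], symmetric]
  using pz_domD[OF p]
  by (simp_all add: covector_inner[OF pz_domD(2)[OF p]] linear_0[OF linear_\<theta>] q)

lemma source_target_relations:
  assumes p: "p \<in> pz_dom"
  shows "lorentz_relations \<theta> J H \<theta>\<^sub>0 (snd p) (fst (source p)) (target p)"
proof -
  obtain m \<zeta> h where pe: "p = ((m, \<zeta>), h)" by (metis prod.collapse)
  define q where "q = m - (1/2) *\<^sub>R disp m \<zeta> h"
  define q' where "q' = m + (1/2) *\<^sub>R disp m \<zeta> h"
  note D = pz_domD[OF p[unfolded pe], folded q_def q'_def]
  note G = frechet_derivative_gen[OF p[unfolded pe] q_def q'_def]
  have "fst (source p) = (q, sharp q (source_covector m \<zeta> h))" "target p = (q', sharp q' (target_covector m \<zeta> h))"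
    by (simp_all add: source_def target_def pe Let_def q_def q'_def)
  then show ?thesis
    by (simp add: lorentz_relations_iff[OF D(5)] G metric_sharp D pe)
qed

lemma relation_source:
  assumes pd: "(q, q') \<in> pair_dom" and rel: "lorentz_relations \<theta> J H \<theta>\<^sub>0 h (q, v) (q', v')"
  shows "N q (q' - q) h \<bullet> w = h^2 * g q v w"
proof -
  have e: "q + (q' - q) = q'" by simp
  have pd': "(q, q + (q' - q)) \<in> pair_dom" unfolding e by (rule pd)
  have "\<theta> q w + h^2 * g q v w = - frechet_derivative (gen h) (at (q, q')) (w, 0)"
    using rel unfolding lorentz_relations_iff[OF pd] by blast
  then show ?thesis using N_inner[OF pd', of h w] unfolding e by linarith
qed

text \<open>By the second relation both displacements have the same value of \<open>N\<close>,
  namely the covector h^2 g(v, .), and \<open>tube_injective\<close> identifies them. The first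
  relation contains v' only with the factor h^2, which is why v' is determined for nonzero h
  only.\<close>

lemma relations_unique:
  assumes 1: "(q, q1 - q) \<in> tube" "lorentz_relations \<theta> J H \<theta>\<^sub>0 h (q, v) (q1, v1)"
    and 2: "(q, q2 - q) \<in> tube" "lorentz_relations \<theta> J H \<theta>\<^sub>0 h (q, v) (q2, v2)"
    and h: "(q, h) \<in> tube"
  shows "q1 = q2" "h \<noteq> 0 \<Longrightarrow> v1 = v2"
proof -
  have pd: "(q, q1) \<in> pair_dom" "(q, q2) \<in> pair_dom"
    using tube_pair_dom[OF 1(1)] tube_pair_dom[OF 2(1)] by simp_all
  have "N q (q1 - q) h \<bullet> w = N q (q2 - q) h \<bullet> w" for w
    using relation_source[OF pd(1) 1(2)] relation_source[OF pd(2) 2(2)] by simp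
  from euclidean_eqI[OF this] have "N q (q1 - q) h = N q (q2 - q) h" .
  from tube_injective[OF 1(1) 2(1) h this] show eq: "q1 = q2" by simp
  assume h0: "h \<noteq> 0"
  have "\<theta> q2 w + h^2 * g q2 v1 w = frechet_derivative (gen h) (at (q, q2)) (0, w)"
    "\<theta> q2 w + h^2 * g q2 v2 w = frechet_derivative (gen h) (at (q, q2)) (0, w)" for w
    using 1(2)[unfolded eq] 2(2) unfolding lorentz_relations_iff[OF pd(2)] by blast+
  then have "\<theta> q2 w + h^2 * g q2 v1 w = \<theta> q2 w + h^2 * g q2 v2 w" for w by simp
  then show "v1 = v2" using h0 by (intro metric_nondeg[OF pair_domD(2)[OF pd(2)]]) simp
qed

text \<open>At h = 0 the displacement vanishes, and the 1/12 terms of \<open>K\<close> and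
  \<open>T\<close> cancel. What remains of P is \<omega>(\<zeta>, u) + g(X, w) - c/2 g(\<zeta>, w),
  and \<omega>(\<zeta>, .) is g(J \<zeta>, .).\<close>

lemma source_target_zero:
  assumes m: "m \<in> Q"
  shows "source ((m, \<zeta>), 0) = ((m, X m - (1/2) *\<^sub>R (J m \<zeta> + c *\<^sub>R \<zeta>)), 0)"
    and "target ((m, \<zeta>), 0) = (m, X m + (1/2) *\<^sub>R (J m \<zeta> - c *\<^sub>R \<zeta>))"
proof -
  have dom: "(m, disp m \<zeta> 0) \<in> mid_dom" using mid_dom_zero[OF m] by simp
  note lin = linear_add[OF linear_metric(1)[OF m]] linear_diff[OF linear_metric(1)[OF m]] linear_cmul[OF linear_metric(1)[OF m]]
  have "source_covector m \<zeta> 0 \<bullet> w = flat m (X m - (1/2) *\<^sub>R (J m \<zeta> + c *\<^sub>R \<zeta>)) \<bullet> w" for w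
    by (simp add: covector_inner[OF dom] flat_inner[OF m] lin metric_J[OF m] P_def K_zero[OF m] T_def
        linear_neg[OF linear_metric(2)[OF m]] linear_neg[OF linear_d\<omega>(3)[OF m]] linear_cmul[OF linear_\<omega>(2)[OF m]] algebra_simps)
  from euclidean_eqI[OF this] have "source_covector m \<zeta> 0 = flat m (X m - (1/2) *\<^sub>R (J m \<zeta> + c *\<^sub>R \<zeta>))" .
  then show "source ((m, \<zeta>), 0) = ((m, X m - (1/2) *\<^sub>R (J m \<zeta> + c *\<^sub>R \<zeta>)), 0)"
    by (simp add: source_def sharp_flat[OF m])
  have "target_covector m \<zeta> 0 \<bullet> w = flat m (X m + (1/2) *\<^sub>R (J m \<zeta> - c *\<^sub>R \<zeta>)) \<bullet> w" for w
    by (simp add: covector_inner[OF dom] flat_inner[OF m] lin metric_J[OF m] P_def K_zero[OF m] T_def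
        linear_cmul[OF linear_\<omega>(2)[OF m]] algebra_simps)
  from euclidean_eqI[OF this] have "target_covector m \<zeta> 0 = flat m (X m + (1/2) *\<^sub>R (J m \<zeta> - c *\<^sub>R \<zeta>))" .
  then show "target ((m, \<zeta>), 0) = (m, X m + (1/2) *\<^sub>R (J m \<zeta> - c *\<^sub>R \<zeta>))"
    by (simp add: target_def sharp_flat[OF m])
qed

text \<open>J has no real eigenvalue, because its square would be -1.\<close>

lemma J_eigen_zero:
  assumes m: "m \<in> Q" and 0: "J m \<zeta> + c *\<^sub>R \<zeta> = 0" shows "\<zeta> = 0"
proof -
  have "J m \<zeta> = (- c) *\<^sub>R \<zeta>" using 0 by (simp add: eq_neg_iff_add_eq_0)
  then have "J m (J m \<zeta>) = (- c) *\<^sub>R ((- c) *\<^sub>R \<zeta>)" by (metis linear_cmul[OF linear_J[OF m]])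
  then have "- \<zeta> = (c * c) *\<^sub>R \<zeta>" using m by simp
  then have "\<zeta> + (c * c) *\<^sub>R \<zeta> = 0" by (metis add.right_inverse)
  then have "(1 + c * c) *\<^sub>R \<zeta> = 0" by (simp add: scaleR_add_left)
  moreover have "1 + c * c \<noteq> 0" by (metis add.commute add_pos_nonneg less_irrefl zero_le_square zero_less_one)
  ultimately show ?thesis by simp
qed

lemma pz_dom_zero: "m \<in> Q \<Longrightarrow> ((m, \<zeta>), 0) \<in> pz_dom"
  by (simp add: pz_dom_def mid_dom_zero)

text \<open>A kernel vector has no h-component, so the explicit values on the slice h = 0 are enough
  and \<open>P\<close> need not be differentiated in h. On the slice the base point is passed
  through and the fibre map is affine with linear part - (J + c)/2.\<close>

lemma inj_derivative_source:
  assumes m: "m \<in> Q" shows "inj (frechet_derivative source (at ((m, \<zeta>), 0)))"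
proof -
  note p = pz_dom_zero[OF m, of \<zeta>]
  define D where "D = frechet_derivative source (at ((m, \<zeta>), 0))"
  have D: "(source has_derivative D) (at ((m, \<zeta>), 0))"
    unfolding D_def by (rule smooth_on_has_derivative[OF smooth_source_target(1) p])
  have lD: "linear D" using D has_derivative_linear by blast
  have line: "((\<lambda>s. source (((m, \<zeta>), 0) + s *\<^sub>R d)) has_derivative (\<lambda>s. s *\<^sub>R D d)) (at 0)" for d
  proof -
    have "((\<lambda>s. ((m, \<zeta>), 0) + s *\<^sub>R d) has_derivative (\<lambda>s. s *\<^sub>R d)) (at 0)"
      by (auto intro!: derivative_eq_intros)
    moreover have "(source has_derivative D) (at (((m, \<zeta>), 0) + 0 *\<^sub>R d))" using D by simp
    ultimately have "((\<lambda>s. source (((m, \<zeta>), 0) + s *\<^sub>R d)) has_derivative (\<lambda>s. D (s *\<^sub>R d))) (at 0)"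
      by (rule has_derivative_compose)
    then show ?thesis by (simp only: linear_cmul[OF lD])
  qed
  have snd: "snd (D d) = snd d" for d
  proof -
    have "snd (source p) = snd p" for p by (simp add: source_def Let_def)
    with has_derivative_snd[OF D] have "(snd has_derivative (\<lambda>d. snd (D d))) (at ((m, \<zeta>), 0))" by simp
    from has_derivative_unique[OF this has_derivative_snd[OF has_derivative_ident]] show ?thesis by metis
  qed
  have "d = 0" if d: "D d = 0" for d
  proof -
    obtain a b where dd: "d = ((a, b), 0)" using snd[of d] d by (metis prod.collapse snd_zero)
    have oV: "open {s. m + s *\<^sub>R a \<in> Q}"
      using open_vimage[OF open_Q, of "\<lambda>s. m + s *\<^sub>R a"] by (simp add: vimage_def continuous_intros)
    have src: "source (((m, \<zeta>), 0) + s *\<^sub>R d) = ((m + s *\<^sub>R a,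
        X (m + s *\<^sub>R a) - (1/2) *\<^sub>R (J (m + s *\<^sub>R a) (\<zeta> + s *\<^sub>R b) + c *\<^sub>R (\<zeta> + s *\<^sub>R b))), 0)"
      if "m + s *\<^sub>R a \<in> Q" for s
      using source_target_zero(1)[OF that] by (simp add: dd)
    have "((\<lambda>s. m + s *\<^sub>R a) has_derivative (\<lambda>s. s *\<^sub>R fst (fst (D d)))) (at 0)"
    proof (rule has_derivative_transform_within_open[OF _ oV])
      show "((\<lambda>s. fst (fst (source (((m, \<zeta>), 0) + s *\<^sub>R d)))) has_derivative (\<lambda>s. s *\<^sub>R fst (fst (D d)))) (at 0)"
        using has_derivative_fst[OF has_derivative_fst[OF line]] by simp
    qed (use src m in auto)
    moreover have "((\<lambda>s. m + s *\<^sub>R a) has_derivative (\<lambda>s. s *\<^sub>R a)) (at 0)"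
      by (auto intro!: derivative_eq_intros)
    ultimately have "(\<lambda>s. s *\<^sub>R fst (fst (D d))) = (\<lambda>s. s *\<^sub>R a)" by (rule has_derivative_unique)
    from fun_cong[OF this, of 1] have a: "a = 0" using d by simp
    have l: "J m (\<zeta> + s *\<^sub>R b) = J m \<zeta> + s *\<^sub>R J m b" for s
      by (simp only: linear_add[OF linear_J[OF m]] linear_cmul[OF linear_J[OF m]])
    have "((\<lambda>s. X m - (1/2) *\<^sub>R (J m (\<zeta> + s *\<^sub>R b) + c *\<^sub>R (\<zeta> + s *\<^sub>R b))) has_derivative (\<lambda>s. s *\<^sub>R snd (fst (D d)))) (at 0)"
      using has_derivative_snd[OF has_derivative_fst[OF line[of d]]] src m by (simp add: a)
    moreover have "((\<lambda>s. X m - (1/2) *\<^sub>R (J m (\<zeta> + s *\<^sub>R b) + c *\<^sub>R (\<zeta> + s *\<^sub>R b))) has_derivative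
        (\<lambda>s. - (1/2) *\<^sub>R (s *\<^sub>R J m b + c *\<^sub>R (s *\<^sub>R b)))) (at 0)"
      unfolding l by (auto intro!: derivative_eq_intros)
    ultimately have "(\<lambda>s. s *\<^sub>R snd (fst (D d))) = (\<lambda>s. - (1/2) *\<^sub>R (s *\<^sub>R J m b + c *\<^sub>R (s *\<^sub>R b)))"
      by (rule has_derivative_unique)
    from fun_cong[OF this, of 1] have "J m b + c *\<^sub>R b = 0" using d by simp
    from J_eigen_zero[OF m this] show ?thesis by (simp add: dd a zero_prod_def)
  qed
  then show ?thesis using linear_injective_0[OF lD] unfolding D_def by blast
qed

text \<open>Open conditions that hold on the whole slice h = 0: invertible derivative for the
  smoothness of the inverse, and the two bounds under which \<open>relations_unique\<close> makes
  \<open>source\<close> injective.\<close>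

definition "flow_dom = {p \<in> pz_dom. inj (frechet_derivative source (at p)) \<and>
  (fst (fst (source p)), fst (target p) - fst (fst (source p))) \<in> tube \<and> (fst (fst (source p)), snd p) \<in> tube}"

lemma open_flow_dom: "open flow_dom"
proof -
  let ?A = "{p \<in> pz_dom. inj (frechet_derivative source (at p))}"
  have cont: "continuous_on pz_dom source" "continuous_on pz_dom target"
    using smooth_source_target by (auto intro: smooth_on_imp_continuous_on)
  have 1: "open ?A" by (rule open_inj_derivative[OF open_pz_dom smooth_source_target(1)])
  have 2: "open (pz_dom \<inter> (\<lambda>p. (fst (fst (source p)), fst (target p) - fst (fst (source p)))) -` tube)"
    by (intro continuous_open_preimage open_pz_dom open_tube continuous_intros cont)
  have 3: "open (pz_dom \<inter> (\<lambda>p. (fst (fst (source p)), snd p)) -` tube)"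
    by (intro continuous_open_preimage open_pz_dom open_tube continuous_intros cont)
  have "flow_dom = ?A \<inter> (pz_dom \<inter> (\<lambda>p. (fst (fst (source p)), fst (target p) - fst (fst (source p)))) -` tube)
      \<inter> (pz_dom \<inter> (\<lambda>p. (fst (fst (source p)), snd p)) -` tube)"
    by (auto simp: flow_dom_def)
  then show ?thesis using 1 2 3 by auto
qed

lemma flow_dom_zero: "m \<in> Q \<Longrightarrow> ((m, \<zeta>), 0) \<in> flow_dom"
  by (simp add: flow_dom_def pz_dom_zero inj_derivative_source source_target_zero tube_zero)

text \<open>Two preimages of (q, v, h) give two solutions of the same relations, so their endpoints
  q' agree. The pair (q, q') determines the midpoint and the displacement, and for nonzero h the
  latter determines \<zeta>. On the slice h = 0, where the displacement carries no information,
  invertibility of J + c replaces it.\<close>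

lemma inj_on_source: "inj_on source flow_dom"
proof (rule inj_onI)
  fix p1 p2 assume p: "p1 \<in> flow_dom" "p2 \<in> flow_dom" "source p1 = source p2"
  obtain m1 \<zeta>1 h1 m2 \<zeta>2 h2 where e: "p1 = ((m1, \<zeta>1), h1)" "p2 = ((m2, \<zeta>2), h2)" by (metis prod.collapse)
  have h: "h2 = h1" using p(3) by (simp add: source_def Let_def e)
  have "snd (source p1) = h1" by (simp add: source_def Let_def e)
  then obtain q v where q: "source p1 = ((q, v), h1)" "source p2 = ((q, v), h1)"
    using p(3) by (metis prod.collapse)
  obtain q1 v1 q2 v2 where t: "target p1 = (q1, v1)" "target p2 = (q2, v2)" by fastforce
  have "lorentz_relations \<theta> J H \<theta>\<^sub>0 h1 (q, v) (q1, v1)" "lorentz_relations \<theta> J H \<theta>\<^sub>0 h1 (q, v) (q2, v2)"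
    using source_target_relations[of p1] source_target_relations[of p2] p q t e h by (simp_all add: flow_dom_def)
  moreover have "(q, q1 - q) \<in> tube" "(q, q2 - q) \<in> tube" "(q, h1) \<in> tube"
    using p(1,2) by (simp_all add: flow_dom_def q t, simp_all add: e)
  ultimately have qe: "q1 = q2" using relations_unique(1) by metis
  have qs: "q = m1 - (1/2) *\<^sub>R disp m1 \<zeta>1 h1" "q = m2 - (1/2) *\<^sub>R disp m2 \<zeta>2 h1"
    and qt: "q1 = m1 + (1/2) *\<^sub>R disp m1 \<zeta>1 h1" "q2 = m2 + (1/2) *\<^sub>R disp m2 \<zeta>2 h1"
    using q t by (simp_all add: source_def target_def Let_def e h)
  have "q + q1 = 2 *\<^sub>R m1" "q + q2 = 2 *\<^sub>R m2" 
    unfolding qt by (subst qs(1), simp add: scaleR_2) (subst qs(2), simp add: scaleR_2)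
  then have m: "m1 = m2" using qe by simp
  have mQ: "m1 \<in> Q" using p(1) pz_domD(1) by (auto simp: flow_dom_def e)
  have "q1 - q = disp m1 \<zeta>1 h1" "q2 - q = disp m2 \<zeta>2 h1"
    unfolding qt by (subst qs(1), simp flip: scaleR_add_left) (subst qs(2), simp flip: scaleR_add_left)
  then have d: "disp m1 \<zeta>1 h1 = disp m1 \<zeta>2 h1" by (simp only: qe m)
  have "\<zeta>1 = \<zeta>2"
  proof (cases "h1 = 0")
    case False
    then show ?thesis using d by auto
  next
    case True
    then have "J m1 \<zeta>1 + c *\<^sub>R \<zeta>1 = J m1 \<zeta>2 + c *\<^sub>R \<zeta>2"
      using p(3) by (simp add: e h m[symmetric] source_target_zero(1)[OF mQ])
    then have "J m1 (\<zeta>1 - \<zeta>2) + c *\<^sub>R (\<zeta>1 - \<zeta>2) = 0"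
      by (simp add: linear_diff[OF linear_J[OF mQ]] algebra_simps)
    from J_eigen_zero[OF mQ this] show ?thesis by simp
  qed
  then show "p1 = p2" by (simp add: e h m)
qed

end

context lorentz_map
begin

text \<open>The relations say that \<open>f\<close> pulls \<open>lorentz_potential\<close> back to itself up to the differential of
  the generating function.\<close>

lemma pullback_lorentz_form:
  assumes M: "open M" "x \<in> M" and f: "smooth_on f M"
    and pd: "\<And>z. z \<in> M \<Longrightarrow> (fst z, fst (f z)) \<in> pair_dom"
    and rel: "\<And>z. z \<in> M \<Longrightarrow> lorentz_relations \<theta> J H \<theta>\<^sub>0 h z (f z)"
  shows "pullback2 f (lorentz_form \<theta> J h) x = lorentz_form \<theta> J h x"
proof (intro ext)
  fix u v
  \<comment> \<open>The generating function along the graph of f; its differential collects both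
    relations with the correct signs.\<close>
  define F where "F z = gen h (fst z, fst (f z))" for z
  have TQ: "z \<in> Q \<times> UNIV" "f z \<in> Q \<times> UNIV" if "z \<in> M" for z
    using pair_domD[OF pd[OF that]] by (auto simp: mem_Times_iff)
  have F: "smooth_on F M"
    unfolding F_def
    by (rule smooth_on_compose[OF smooth_gen open_pair_dom M(1)])
      (auto intro!: smooth_on_Pair smooth_on_fst smooth_on_id M f pd)
  have eq: "lorentz_potential h (f y) (frechet_derivative f (at y) d)
      = lorentz_potential h y d + frechet_derivative F (at y) d" if y: "y \<in> M" for y d
  proof -
    let ?D = "frechet_derivative (gen h) (at (fst y, fst (f y)))"
    let ?b = "fst (frechet_derivative f (at y) d)"
    have "((\<lambda>z. (fst z, fst (f z))) has_derivative (\<lambda>d. (fst d, fst (frechet_derivative f (at y) d)))) (at y)"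
      by (intro has_derivative_Pair has_derivative_fst has_derivative_ident smooth_on_has_derivative[OF f y])
    from frechet_derivative_at[OF has_derivative_compose[OF this smooth_on_has_derivative[OF smooth_gen pd[OF y]]], symmetric]
    have "frechet_derivative F (at y) d = ?D (fst d, ?b)"
      unfolding F_def[abs_def] by (rule fun_cong)
    also have "\<dots> = ?D (fst d, 0) + ?D (0, ?b)"
      using linear_add[OF smooth_on_linear_derivative[OF smooth_gen pd[OF y]], of h "(fst d, 0)" "(0, ?b)"] by simp
    also have "\<dots> = - lorentz_potential h y d + lorentz_potential h (f y) (frechet_derivative f (at y) d)"
      using rel[OF y] lorentz_relations_iff[OF pd[OF y], of h "snd y" "snd (f y)"]
      by (simp add: lorentz_potential_def)
    finally show ?thesis by simp
  qed
  have D: "frechet_derivative (\<lambda>y. lorentz_potential h (f y) (frechet_derivative f (at y) b)) (at x) a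
      = frechet_derivative (\<lambda>y. lorentz_potential h y b) (at x) a
        + frechet_derivative (\<lambda>y. frechet_derivative F (at y) b) (at x) a" for a b
  proof -
    have "((\<lambda>y. lorentz_potential h y b + frechet_derivative F (at y) b) has_derivative
      (\<lambda>a. frechet_derivative (\<lambda>y. lorentz_potential h y b) (at x) a
        + frechet_derivative (\<lambda>y. frechet_derivative F (at y) b) (at x) a)) (at x)"
      using TQ[OF M(2)]
      by (intro has_derivative_add smooth_on_has_derivative[OF smooth_lorentz_potential]
          smooth_on_has_derivative[OF smooth_on_frechet_derivative[OF F]] M)
    from frechet_derivative_at[OF has_derivative_transform_within_open[OF this M eq[symmetric]], symmetric]
    show ?thesis by (rule fun_cong)
  qed
  have "pullback2 f (ext_deriv (lorentz_potential h)) x u v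
      = ext_deriv (\<lambda>y d. lorentz_potential h (f y) (frechet_derivative f (at y) d)) x u v"
    using TQ(2)
    by (intro ext_deriv_pullback(2)[OF M open_TQ image_subsetI f linear_lorentz_potential smooth_lorentz_potential, symmetric])
  also have "\<dots> = ext_deriv (lorentz_potential h) x u v + ext_deriv (\<lambda>y. frechet_derivative F (at y)) x u v"
    by (simp add: ext_deriv_def D)
  also have "\<dots> = ext_deriv (lorentz_potential h) x u v"
    by (simp add: ext_deriv_exact[OF M(1) F M(2)])
  finally show "pullback2 f (lorentz_form \<theta> J h) x u v = lorentz_form \<theta> J h x u v"
    using TQ[OF M(2)] by (simp add: pullback2_def lorentz_form_eq)
qed

lemma source_target_limit:
  assumes q: "q \<in> Q"
  obtains \<zeta> where "source ((q, \<zeta>), 0) = ((q, v), 0)"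
    "target ((q, \<zeta>), 0) = (q, X q + endo_exp (\<lambda>w. (- \<theta>\<^sub>0) *\<^sub>R J q w) (v - X q))"
proof -
  define y where "y = v - X q"
  define r where "r = 1 / (1 + c * c)"
  \<comment> \<open>The solution of (J + c) \<zeta> = - 2 y, because (J + c)(J - c) = - (1 + c^2).
    Then (J - c) \<zeta> / 2 is r (J - c)^2 y = r (c^2 - 1 - 2 c J) y, where r (c^2 - 1) and 2 r c
    are the cosine and sine of \<open>\<theta>\<^sub>0\<close>.\<close>
  define \<zeta> where "\<zeta> = (2 * r) *\<^sub>R (J q y - c *\<^sub>R y)"
  have c0: "1 + c * c \<noteq> 0" by (metis add.commute add_pos_nonneg less_irrefl zero_le_square zero_less_one)
  then have r: "r * (1 + c * c) = 1" by (simp add: r_def)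
  have J: "J q \<zeta> = (2 * r) *\<^sub>R (- y - c *\<^sub>R J q y)"
    by (simp add: \<zeta>_def linear_cmul[OF linear_J[OF q]] linear_diff[OF linear_J[OF q]] q)
  have "(1/2) *\<^sub>R (J q \<zeta> + c *\<^sub>R \<zeta>) = - (r * (1 + c * c)) *\<^sub>R y"
    unfolding J by (simp add: \<zeta>_def algebra_simps)
  then have 1: "X q - (1/2) *\<^sub>R (J q \<zeta> + c *\<^sub>R \<zeta>) = v" by (simp add: r y_def)
  have "c * c * (1 - cos \<theta>\<^sub>0) = 1 + cos \<theta>\<^sub>0" using c_cos c_sin by (metis mult.assoc)
  moreover have "c * c * (1 - cos \<theta>\<^sub>0) = c * c - c * c * cos \<theta>\<^sub>0"
    "cos \<theta>\<^sub>0 * (1 + c * c) = cos \<theta>\<^sub>0 + c * c * cos \<theta>\<^sub>0"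
    by (simp_all add: algebra_simps)
  ultimately have e: "cos \<theta>\<^sub>0 * (1 + c * c) = c * c - 1" by linarith
  have "cos \<theta>\<^sub>0 = r * (cos \<theta>\<^sub>0 * (1 + c * c))"
    by (simp only: mult.left_commute[of r] r mult_1_right)
  then have cos: "cos \<theta>\<^sub>0 = r * (c * c - 1)" unfolding e .
  have "1 - cos \<theta>\<^sub>0 = 2 * r" using r by (simp add: cos algebra_simps)
  then have sin: "sin \<theta>\<^sub>0 = 2 * r * c" using c_cos by (simp add: mult.commute)
  have "endo_exp (\<lambda>w. (- \<theta>\<^sub>0) *\<^sub>R J q w) y = cos \<theta>\<^sub>0 *\<^sub>R y - sin \<theta>\<^sub>0 *\<^sub>R J q y"
    using endo_exp_complex_structure[OF linear_J[OF q] J_J[OF q], of "- \<theta>\<^sub>0" y] by simp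
  also have "\<dots> = (1/2) *\<^sub>R (J q \<zeta> - c *\<^sub>R \<zeta>)"
    unfolding J cos sin by (simp add: \<zeta>_def algebra_simps, simp flip: scaleR_add_left)
  finally have 2: "(1/2) *\<^sub>R (J q \<zeta> - c *\<^sub>R \<zeta>) = endo_exp (\<lambda>w. (- \<theta>\<^sub>0) *\<^sub>R J q w) (v - X q)"
    by (simp add: y_def)
  show thesis
    by (rule that[of \<zeta>]) (simp_all only: source_target_zero[OF q] 1 2)
qed

end

section \<open>Assembly of the Lorentz map\<close>

theorem proposition5:
  fixes Q :: "'a::euclidean_space set"
    and \<theta> :: "'a \<Rightarrow> 'a \<Rightarrow> real"
    and J :: "'a \<Rightarrow> 'a \<Rightarrow> 'a"
    and H :: "'a \<Rightarrow> real"
    and \<theta>\<^sub>0 :: real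
  assumes "open Q" and "connected Q"
    and "exact_symplectic_on Q \<theta>"
    and "almost_complex_on Q J"
    and "compatible_on Q \<theta> J"
    and "smooth_on H Q"
    and "\<forall>k::int. \<theta>\<^sub>0 \<noteq> of_int k * pi"
  shows "\<exists>(U :: (('a \<times> 'a) \<times> real) set) (W :: ('a \<times> 'a) set) (\<Psi> :: real \<Rightarrow> 'a \<times> 'a \<Rightarrow> 'a \<times> 'a).
     \<comment> \<open>\<open>U\<close> is an open neighbourhood of \<open>\<hbar> = 0\<close> in \<open>TQ \<times> \<real>\<close>,
         \<open>W\<close> an open neighbourhood of the diagonal on which the generating function is defined\<close>
     open U \<and> U \<subseteq> (Q \<times> UNIV) \<times> UNIV \<and> (Q \<times> UNIV) \<times> {0} \<subseteq> U \<and>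
     open W \<and> (\<forall>q\<in>Q. (q, q) \<in> W) \<and> (\<forall>(q, q')\<in>W. closed_segment q q' \<subseteq> Q) \<and>
     \<comment> \<open>existence and uniqueness of the solution with \<open>(q, q') \<in> W\<close>; for \<open>\<hbar> = 0\<close> the
         relations do not involve \<open>v'\<close>\<close>
     (\<forall>q v hbar. ((q, v), hbar) \<in> U \<longrightarrow>
        \<Psi> hbar (q, v) \<in> Q \<times> UNIV \<and>
        (q, fst (\<Psi> hbar (q, v))) \<in> W \<and>
        lorentz_relations \<theta> J H \<theta>\<^sub>0 hbar (q, v) (\<Psi> hbar (q, v)) \<and>
        (\<forall>q' v'. (q, q') \<in> W \<and> lorentz_relations \<theta> J H \<theta>\<^sub>0 hbar (q, v) (q', v') \<longrightarrow>
           q' = fst (\<Psi> hbar (q, v)) \<and> (hbar \<noteq> 0 \<longrightarrow> v' = snd (\<Psi> hbar (q, v))))) \<and>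
     smooth_on (\<lambda>(z, hbar). \<Psi> hbar z) U \<and>
     (\<forall>z hbar. (z, hbar) \<in> U \<longrightarrow>
        pullback2 (\<Psi> hbar) (lorentz_form \<theta> J hbar) z = lorentz_form \<theta> J hbar z) \<and>
     (\<forall>q\<in>Q. \<forall>v.
        \<Psi> 0 (q, v) =
          (q, hamiltonian_vf \<theta> J H q +
              endo_exp (\<lambda>w. (- \<theta>\<^sub>0) *\<^sub>R J q w) (v - hamiltonian_vf \<theta> J H q)))"
proof -
  interpret lorentz_map Q \<theta> J H \<theta>\<^sub>0
    using assms by unfold_locales
  define U where "U = source ` flow_dom"
  define W where "W = {(q, q'). (q, q' - q) \<in> tube}"
  define sol where "sol = inv_into flow_dom source"
  define \<Psi> where "\<Psi> hbar z = target (sol (z, hbar))" for hbar z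
  have sol_source: "sol (source p) = p" if "p \<in> flow_dom" for p
    using inj_on_source that by (simp add: sol_def)
  have sol: "sol y \<in> flow_dom" "source (sol y) = y" if "y \<in> U" for y
    using that sol_source by (auto simp: U_def)
  have pz: "flow_dom \<subseteq> pz_dom" by (auto simp: flow_dom_def)
  note smooth = smooth_source_target[THEN smooth_on_subset, OF pz]
  have inj: "inj (frechet_derivative source (at p))" if "p \<in> flow_dom" for p
    using that by (simp add: flow_dom_def)
  have U: "open U" "smooth_on sol U"
    unfolding U_def using smooth_on_inverse_function[OF open_flow_dom smooth(1) sol_source inj] by auto
  \<comment> \<open>Besides the limit formula this gives surjectivity: every (q, v, 0) has a
    preimage in \<open>flow_dom\<close>, so \<open>U\<close> contains the whole slice.\<close>
  have zero: "((q, v), 0) \<in> U \<and> \<Psi> 0 (q, v) =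
      (q, hamiltonian_vf \<theta> J H q + endo_exp (\<lambda>w. (- \<theta>\<^sub>0) *\<^sub>R J q w) (v - hamiltonian_vf \<theta> J H q))"
    if q: "q \<in> Q" for q v
  proof -
    obtain \<zeta> where \<zeta>: "source ((q, \<zeta>), 0) = ((q, v), 0)"
      "target ((q, \<zeta>), 0) = (q, hamiltonian_vf \<theta> J H q + endo_exp (\<lambda>w. (- \<theta>\<^sub>0) *\<^sub>R J q w) (v - hamiltonian_vf \<theta> J H q))"
      using source_target_limit[OF q] by blast
    show ?thesis
      using \<zeta> sol_source[OF flow_dom_zero[OF q, of \<zeta>]] flow_dom_zero[OF q, of \<zeta>]
      by (auto simp: U_def \<Psi>_def intro: rev_image_eqI)
  qed
  have openW: "open W"
  proof -
    have "open ((\<lambda>z. (fst z, snd z - fst z)) -` (tube :: ('a \<times> 'a) set))"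
      by (intro open_vimage open_tube continuous_intros)
    then show ?thesis by (simp add: W_def vimage_def case_prod_beta')
  qed
  have W_pair: "(q, q') \<in> pair_dom" if "(q, q') \<in> W" for q q'
    using that tube_pair_dom[of q "q' - q"] by (simp add: W_def)
  have segment: "closed_segment q q' \<subseteq> Q" if "(q, q') \<in> W" for q q'
  proof
    fix y assume "y \<in> closed_segment q q'"
    then obtain t where t: "y = (1 - t) *\<^sub>R q + t *\<^sub>R q'" "0 \<le> t" "t \<le> 1"
      by (auto simp: closed_segment_def)
    have "y = q + t *\<^sub>R (q' - q)" unfolding t(1) by (simp add: algebra_simps)
    then show "y \<in> Q"
      using mid_dom_segment[of q q' t] W_pair[OF that] t by (simp add: pair_dom_def abs_if)
  qed
  have sol_rel: "(fst z, fst (\<Psi> hbar z)) \<in> W" "(fst z, hbar) \<in> tube"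
    "lorentz_relations \<theta> J H \<theta>\<^sub>0 hbar z (\<Psi> hbar z)" if "(z, hbar) \<in> U" for z hbar
  proof -
    note s = sol[OF that]
    \<comment> \<open>\<open>source\<close> preserves h, so the parameters found solve the relations
      for the prescribed value.\<close>
    have h: "snd (sol (z, hbar)) = hbar" using s(2) by (simp add: source_def Let_def prod_eq_iff)
    show "(fst z, fst (\<Psi> hbar z)) \<in> W" "(fst z, hbar) \<in> tube"
      using s(1) by (simp_all add: flow_dom_def s(2) h W_def \<Psi>_def)
    show "lorentz_relations \<theta> J H \<theta>\<^sub>0 hbar z (\<Psi> hbar z)"
      using source_target_relations[of "sol (z, hbar)"] s pz by (auto simp: h \<Psi>_def)
  qed
  have TQ: "z \<in> Q \<times> UNIV" "\<Psi> hbar z \<in> Q \<times> UNIV" if "(z, hbar) \<in> U" for z hbar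
    using pair_domD(1,2)[OF W_pair[OF sol_rel(1)[OF that]]] by (auto simp: mem_Times_iff)
  have smooth_\<Psi>: "smooth_on (\<lambda>(z, hbar). \<Psi> hbar z) U"
    using smooth_on_compose[OF smooth(2) open_flow_dom U sol(1)] by (simp add: \<Psi>_def case_prod_beta')
  have symplectic: "pullback2 (\<Psi> hbar) (lorentz_form \<theta> J hbar) z = lorentz_form \<theta> J hbar z"
    if z: "(z, hbar) \<in> U" for z hbar
  proof (rule pullback_lorentz_form)
    \<comment> \<open>Symplecticity concerns one value of h at a time and is therefore proved on an
      open slice of \<open>U\<close>.\<close>
    have "open ((\<lambda>z. (z, hbar)) -` U)"
      by (intro open_vimage U continuous_intros)
    then show o: "open {z. (z, hbar) \<in> U}" by (simp add: vimage_def)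
    show "z \<in> {z. (z, hbar) \<in> U}" using z by simp
    show "smooth_on (\<Psi> hbar) {z. (z, hbar) \<in> U}"
    proof -
      have "smooth_on (\<lambda>z. (z, hbar)) {z. (z, hbar) \<in> U}"
        by (intro smooth_on_Pair smooth_on_id smooth_on_const o)
      from smooth_on_compose[OF smooth_\<Psi> U(1) o this] show ?thesis by simp
    qed
  qed (use sol_rel W_pair in auto)
  have unique: "q' = fst (\<Psi> hbar (q, v)) \<and> (hbar \<noteq> 0 \<longrightarrow> v' = snd (\<Psi> hbar (q, v)))"
    if u: "((q, v), hbar) \<in> U" and w: "(q, q') \<in> W" "lorentz_relations \<theta> J H \<theta>\<^sub>0 hbar (q, v) (q', v')"
    for q v hbar q' v'
  proof -
    note r = sol_rel[OF u]
    have "(q, q' - q) \<in> tube" "(q, fst (\<Psi> hbar (q, v)) - q) \<in> tube" "(q, hbar) \<in> tube"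
      using w r by (simp_all add: W_def)
    then show ?thesis
      using relations_unique[of q q' hbar v v' "fst (\<Psi> hbar (q, v))" "snd (\<Psi> hbar (q, v))"] w(2) r(3) by simp
  qed
  show ?thesis
  proof (intro exI[of _ U] exI[of _ W] exI[of _ \<Psi>] conjI allI impI ballI)
    show "U \<subseteq> (Q \<times> UNIV) \<times> UNIV" using TQ(1) by auto
    show "(Q \<times> UNIV) \<times> {0} \<subseteq> U" using zero by auto
    show "(q, q) \<in> W" if "q \<in> Q" for q using tube_zero[OF that] by (simp add: W_def)
    show "case p of (q, q') \<Rightarrow> closed_segment q q' \<subseteq> Q" if "p \<in> W" for p
      using segment that by auto
    show "\<Psi> hbar (q, v) \<in> Q \<times> UNIV" "(q, fst (\<Psi> hbar (q, v))) \<in> W"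
      "lorentz_relations \<theta> J H \<theta>\<^sub>0 hbar (q, v) (\<Psi> hbar (q, v))" if "((q, v), hbar) \<in> U" for q v hbar
      using TQ(2)[OF that] sol_rel[OF that] by simp_all
    show "q' = fst (\<Psi> hbar (q, v))" if "((q, v), hbar) \<in> U"
      "(q, q') \<in> W \<and> lorentz_relations \<theta> J H \<theta>\<^sub>0 hbar (q, v) (q', v')" for q v hbar q' v'
      using unique that by blast
    show "v' = snd (\<Psi> hbar (q, v))" if "((q, v), hbar) \<in> U"
      "(q, q') \<in> W \<and> lorentz_relations \<theta> J H \<theta>\<^sub>0 hbar (q, v) (q', v')" "hbar \<noteq> 0" for q v hbar q' v'
      using unique that by blast
    show "\<Psi> 0 (q, v) = (q, hamiltonian_vf \<theta> J H q +
        endo_exp (\<lambda>w. (- \<theta>\<^sub>0) *\<^sub>R J q w) (v - hamiltonian_vf \<theta> J H q))" if "q \<in> Q" for q v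
      using zero that by blast
  qed (fact U openW smooth_\<Psi> symplectic)+
qed

end
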